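(* Every countable (finite or infinite) poset can be represented by a set of graphs and existence of cycle-continuous mappings between them. That is, for every countable poset $(P,\le)$ there is a family of graphs $(G_x)_{x\in P}$ such that for all $x,y\in P$: $x\le y$ if and only if there exists a cycle-continuous mapping $E(G_x)\to E(G_y)$.
   Context: Graphs are finite and may have parallel edges and loops. A \emph{cycle} in a graph is a set of edges such that every vertex is incident with an even number of them (a loop counting twice); so a cycle is an element of the $\mathbb{Z}_2$-cycle space, and the empty set is a cycle. A mapping $f:E(G)\to E(H)$ is \emph{cycle-continuous} ($cc$) if for every cycle $C\subseteq E(H)$ the preimage $f^{-1}(C)$ is a cycle in $G$. *)

theory Defs
  imports "HOL-Library.Multiset" "HOL-Library.Countable_Set" "HOL-Library.FuncSet"
begin

(* An edge is an abstract name, so parallel edges are allowed; its two ends form a multiset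
   of size 2, and a loop at v has ends {#v, v#}. *)
record ('v, 'e) multigraph =
  verts :: "'v set"
  edges :: "'e set"
  ends :: "'e \<Rightarrow> 'v multiset"

definition finite_multigraph :: "('v, 'e) multigraph \<Rightarrow> bool" where
  "finite_multigraph G \<longleftrightarrow>
     finite (verts G) \<and> finite (edges G) \<and>
     (\<forall>e\<in>edges G. size (ends G e) = 2 \<and> set_mset (ends G e) \<subseteq> verts G)"

(* The multiplicity count makes a loop contribute 2 at its vertex. *)
definition degree_in :: "('v, 'e) multigraph \<Rightarrow> 'e set \<Rightarrow> 'v \<Rightarrow> nat" where
  "degree_in G C v = (\<Sum>e\<in>C. count (ends G e) v)"

definition is_cycle :: "('v, 'e) multigraph \<Rightarrow> 'e set \<Rightarrow> bool" where
  "is_cycle G C \<longleftrightarrow> C \<subseteq> edges G \<and> (\<forall>v\<in>verts G. even (degree_in G C v))"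

(* Only the restriction of f to the edges of G is relevant. *)
definition cycle_continuous ::
  "('v, 'e) multigraph \<Rightarrow> ('w, 'f) multigraph \<Rightarrow> ('e \<Rightarrow> 'f) \<Rightarrow> bool" where
  "cycle_continuous G H f \<longleftrightarrow>
     f \<in> edges G \<rightarrow> edges H \<and>
     (\<forall>C. is_cycle H C \<longrightarrow> is_cycle G (f -` C \<inter> edges G))"

end

theory Submission
  imports Defs
begin

text \<open>
  Call a set of edges a join if its complement is a cycle; in a graph all of whose degrees are odd, a join
  meets every vertex star in an odd number of edges, and cycle-continuous maps pull joins back to joins.
  The building blocks (atoms) are five Petersen graphs with parallel edges, all 71-regular. If the target has
  142 joins that cover every edge exactly twice, then a source star of 71 edges meets these joins 142 times in total, so
  each of them exactly once: perfect matchings pull back to perfect matchings. This makes stars go to stars,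
  and parity of the fibres of the induced vertex map shows that an atom only maps to an atom of its own colour.

  Atoms are glued along single edges in a tree-like way, with a set being a cycle iff its trace on every atom is one.
  Every map from an atom to such an amalgam lands in a single atom, so maps between amalgams amount to
  colour-preserving maps between trees of coloured atoms. Number the poset by naturals. The chain of \<open>n\<close> is a path whose edges
  are coloured cyclically by 0, 1, 2, each colour occurring twice in succession; a pendant atom of colour 4 marks its start, pendant atoms
  of colour 3 mark the positions \<open>i \<le> n\<close> with not \<open>n \<le> i\<close> in the poset, and the end
  carries all the colours 0, 1, 2, 3, so that it can absorb the rest of a longer chain. The chain of \<open>n\<close> maps
  to the chain of \<open>m\<close> iff \<open>m\<close> is not numbered after \<open>n\<close> and \<open>n \<le> m\<close> in the poset. Finally \<open>x\<close> is represented by the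
  disjoint union of the chains of those \<open>n \<le> x\<close> that are not numbered after \<open>x\<close>.
\<close>

section \<open>The Petersen graph\<close>

text \<open>A partition of an atom into 71 perfect matchings would serve for the averaging, but it
  must not exist: it would let the atom map into any single vertex star of any other atom. The
  Petersen graph allows a substitute, because every edge lies in exactly two of its six perfect
  matchings. Taking the spoke matching \<open>47 - 10 * c\<close> times and each of the other five
  \<open>19 + 2 * c\<close> times meets every class of parallel edges twice as often as its
  multiplicity, with 142 matchings in all. In a chain, a pair of consecutive atoms of one colour can
  fold onto a single pendant atom and return to the same junction; this is how the end absorbs a
  longer chain. Period three separates the colour ahead from the colour behind. Marks record failed
  relations since these persist when \<open>n\<close> is replaced by something above it, whereas the
  chain of \<open>m\<close> has no mark at \<open>m\<close> by reflexivity: position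
  \<open>m\<close> tests the relation between \<open>n\<close> and \<open>m\<close>. A finite chain
  can test only positions up to its own number, hence maps only to chains numbered no later. An
  upper bound with a later number is reached because its disjoint union contains the given chain
  itself.\<close>

text \<open>Edges 0 to 4 form the outer 5-cycle, 5 to 9 are the spokes, 10 to 14 form the inner 5-cycle.\<close>

definition pet_ends :: "nat \<Rightarrow> nat \<times> nat" where
  "pet_ends p = [(0,1), (1,2), (2,3), (3,4), (4,0), (0,5), (1,6), (2,7), (3,8), (4,9),
     (5,7), (6,8), (7,9), (8,5), (9,6)] ! p"

definition incident :: "nat \<Rightarrow> nat \<Rightarrow> bool" where
  "incident v p \<longleftrightarrow> v = fst (pet_ends p) \<or> v = snd (pet_ends p)"

text \<open>The six perfect matchings, number 0 being the spokes; any two of them share exactly one edge.\<close>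

definition pet_matching :: "nat \<Rightarrow> nat set" where
  "pet_matching i = [{5,6,7,8,9}, {5,1,3,12,11}, {6,2,4,13,12}, {7,3,0,14,13}, {8,4,1,10,14}, {9,0,2,11,10}] ! i"

lemma all_less_6: "(\<forall>v<6::nat. Q v) \<longleftrightarrow> Q 0 \<and> Q 1 \<and> Q 2 \<and> Q 3 \<and> Q 4 \<and> Q 5"
  by (simp add: eval_nat_numeral All_less_Suc conj_ac)

lemma all_less_10: "(\<forall>v<10::nat. Q v) \<longleftrightarrow> Q 0 \<and> Q 1 \<and> Q 2 \<and> Q 3 \<and> Q 4 \<and> Q 5 \<and> Q 6 \<and> Q 7 \<and> Q 8 \<and> Q 9"
  by (simp add: eval_nat_numeral All_less_Suc conj_ac)

lemma all_less_15: "(\<forall>v<15::nat. Q v) \<longleftrightarrow> Q 0 \<and> Q 1 \<and> Q 2 \<and> Q 3 \<and> Q 4 \<and> Q 5 \<and> Q 6 \<and> Q 7 \<and> Q 8 \<and> Q 9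
    \<and> Q 10 \<and> Q 11 \<and> Q 12 \<and> Q 13 \<and> Q 14"
  by (simp add: eval_nat_numeral All_less_Suc conj_ac)

lemma pet_ends_simps:
  "pet_ends 0 = (0,1)" "pet_ends (Suc 0) = (1,2)" "pet_ends 2 = (2,3)" "pet_ends 3 = (3,4)" "pet_ends 4 = (4,0)"
  "pet_ends 5 = (0,5)" "pet_ends 6 = (1,6)" "pet_ends 7 = (2,7)" "pet_ends 8 = (3,8)" "pet_ends 9 = (4,9)"
  "pet_ends 10 = (5,7)" "pet_ends 11 = (6,8)" "pet_ends 12 = (7,9)" "pet_ends 13 = (8,5)" "pet_ends 14 = (9,6)"
  by (simp_all add: pet_ends_def)

lemma pet_matching_simps:
  "pet_matching 0 = {5,6,7,8,9}" "pet_matching (Suc 0) = {5,1,3,12,11}" "pet_matching 2 = {6,2,4,13,12}" "pet_matching 3 = {7,3,0,14,13}"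
  "pet_matching 4 = {8,4,1,10,14}" "pet_matching 5 = {9,0,2,11,10}"
  by (simp_all add: pet_matching_def)

lemma pet_ends_less:
  assumes "p < 15" shows "fst (pet_ends p) < 10" "snd (pet_ends p) < 10" "fst (pet_ends p) \<noteq> snd (pet_ends p)"
proof -
  have "\<forall>p<15. fst (pet_ends p) < 10 \<and> snd (pet_ends p) < 10 \<and> fst (pet_ends p) \<noteq> snd (pet_ends p)"
    unfolding all_less_15 by (simp add: pet_ends_simps)
  then show "fst (pet_ends p) < 10" "snd (pet_ends p) < 10" "fst (pet_ends p) \<noteq> snd (pet_ends p)" using assms by blast+
qed

definition pet_star :: "nat \<Rightarrow> nat set" where
  "pet_star v = {p. p < 15 \<and> incident v p}"

lemma lt15: "p < 15 \<longleftrightarrow> p \<in> {0,1,2,3,4,5,6,7,8,9,10,11,12,13,14::nat}"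
  by simp presburger

lemma pet_star_simps:
  "pet_star 0 = {0,4,5}" "pet_star (Suc 0) = {0,1,6}" "pet_star 2 = {1,2,7}" "pet_star 3 = {2,3,8}" "pet_star 4 = {3,4,9}"
  "pet_star 5 = {5,10,13}" "pet_star 6 = {6,11,14}" "pet_star 7 = {7,10,12}" "pet_star 8 = {8,11,13}" "pet_star 9 = {9,12,14}"
  unfolding pet_star_def incident_def lt15 by (auto simp: pet_ends_simps)

lemma pet_matching_subset: "i < 6 \<Longrightarrow> pet_matching i \<subseteq> {..<15}"
proof -
  have "\<forall>i<6. pet_matching i \<subseteq> {..<15}" unfolding all_less_6 by (simp add: pet_matching_simps)
  then show "i < 6 \<Longrightarrow> pet_matching i \<subseteq> {..<15}" by blast
qed

lemma pet_matching_star: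
  assumes "i < 6" "v < 10" shows "\<exists>p. pet_matching i \<inter> pet_star v = {p}"
proof -
  have "\<forall>i<6. \<forall>v<10. card (pet_matching i \<inter> pet_star v) = 1"
    unfolding all_less_6 all_less_10 by (simp add: pet_star_simps pet_matching_simps)
  then show ?thesis using assms by (metis card_1_singletonE)
qed

lemma pet_matching_ex:
  assumes "p < 15" shows "\<exists>i<6. p \<in> pet_matching i"
proof -
  have "\<forall>p<15. \<not> (\<forall>i<6. p \<notin> pet_matching i)"
    unfolding all_less_15 all_less_6 by (simp add: pet_matching_simps)
  then show ?thesis using assms by blast
qed

text \<open>Spokes lie in matching 0 and one other, all other edges in two of the matchings 1 to 5.
  Repeating matching 0 \<open>a\<close> times and each of the others \<open>b\<close> times
  therefore realises two prescribed multiplicities.\<close>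

lemma pet_matching_weight:
  fixes a b :: nat
  assumes "p < 15"
  shows "(\<Sum>i | i < 6 \<and> p \<in> pet_matching i. if i = 0 then a else b) = (if 5 \<le> p \<and> p < 10 then a + b else 2 * b)"
proof -
  have *: "(\<Sum>i | i < 6 \<and> p \<in> pet_matching i. f i) = (\<Sum>i\<in>{0,1,2,3,4,5}. if p \<in> pet_matching i then f i else 0)" for f :: "nat \<Rightarrow> nat" and p
    by (rule sum.mono_neutral_cong_left) auto
  have "\<forall>p<15. (\<Sum>i | i < 6 \<and> p \<in> pet_matching i. if i = 0 then a else b) = (if 5 \<le> p \<and> p < 10 then a + b else 2 * b)"
    unfolding * all_less_15 by (simp add: pet_matching_simps)
  then show ?thesis using assms by blast
qed

text \<open>The edges 3, 12 and 13 are the pairwise intersections of three of the six perfect matchings, so that every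
  perfect matching contains none or two of them.\<close>

lemma pet_matching_parity:
  fixes x :: "nat \<Rightarrow> nat"
  assumes "\<And>v. v < 10 \<Longrightarrow> (\<Sum>p\<in>pet_star v. x p) = 1"
  shows "even (x 3 + x 12 + x 13)"
proof -
  \<comment> \<open>A sum of 1 over the naturals means one odd and two even terms; with oddness as a
    propositional variable, \<open>argo\<close> can finish.\<close>
  have sum3: "a + b + c = (1::nat) \<Longrightarrow> (odd a \<or> odd b \<or> odd c) \<and> \<not> (odd a \<and> odd b) \<and> \<not> (odd a \<and> odd c) \<and> \<not> (odd b \<and> odd c)" for a b c
    by presburger
  have "\<forall>v<10. (\<Sum>p\<in>pet_star v. x p) = 1" using assms by blast
  then have "x 0 + x 4 + x 5 = 1" "x 0 + x 1 + x 6 = 1" "x 1 + x 2 + x 7 = 1" "x 2 + x 3 + x 8 = 1"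
    "x 3 + x 4 + x 9 = 1" "x 5 + x 10 + x 13 = 1" "x 6 + x 11 + x 14 = 1" "x 7 + x 10 + x 12 = 1"
    "x 8 + x 11 + x 13 = 1" "x 9 + x 12 + x 14 = 1"
    unfolding all_less_10 by (simp_all add: pet_star_simps)
  note this[THEN sum3]
  moreover have "even (x 3 + x 12 + x 13) \<longleftrightarrow> ((odd (x 3) \<longleftrightarrow> odd (x 12)) \<longleftrightarrow> even (x 13))" by simp
  ultimately show ?thesis by argo
qed

text \<open>A basis of the cycle space, whose dimension is 15 - 10 + 1 = 6: each of the first five
  cycles owns one of the inner edges 10 to 14, and the last is the outer 5-cycle.\<close>

definition pet_some_cycles :: "nat set list" where
  "pet_some_cycles = [{0,1,5,7,10}, {1,2,6,8,11}, {2,3,7,9,12}, {3,4,8,5,13}, {4,0,9,6,14}, {0,1,2,3,4}]"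

lemma pet_some_cycles:
  assumes "Z \<in> set pet_some_cycles" shows "Z \<subseteq> {..<15}" "\<And>v. v < 10 \<Longrightarrow> even (card (Z \<inter> pet_star v))"
proof -
  have "\<forall>Z\<in>set pet_some_cycles. Z \<subseteq> {..<15} \<and> (\<forall>v<10. even (card (Z \<inter> pet_star v)))"
    unfolding all_less_10 pet_some_cycles_def by (simp add: pet_star_simps)
  then show "Z \<subseteq> {..<15}" "\<And>v. v < 10 \<Longrightarrow> even (card (Z \<inter> pet_star v))" using assms by blast+
qed

text \<open>Evenness on a basis of the cycle space makes \<open>d\<close> an edge cut, and the only
  cuts meeting all six perfect matchings exactly once are the vertex stars. With 15 Boolean unknowns
  this is a propositional check.\<close>

lemma pet_star_char:
  assumes 1: "\<And>i. i < 6 \<Longrightarrow> \<exists>p\<in>pet_matching i. d p"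
  and 2: "\<And>i p q. i < 6 \<Longrightarrow> p \<in> pet_matching i \<Longrightarrow> q \<in> pet_matching i \<Longrightarrow> d p \<Longrightarrow> d q \<Longrightarrow> p = q"
  and 3: "\<And>Z. Z \<in> set pet_some_cycles \<Longrightarrow> even (card {p\<in>Z. d p})"
  shows "\<exists>w<10. \<forall>p<15. d p \<longleftrightarrow> p \<in> pet_star w"
proof -
  \<comment> \<open>Parity as an iterated exclusive or, the form in which \<open>argo\<close> can
    use assumption 3.\<close>
  have card: "even (card {p \<in> set xs. d p}) \<longleftrightarrow> foldr (\<lambda>p b. d p \<noteq> b) xs False = False" if "distinct xs" for xs
    using that
  proof (induction xs)
    case (Cons a xs)
    have "{p \<in> set (a # xs). d p} = (if d a then insert a {p \<in> set xs. d p} else {p \<in> set xs. d p})" by auto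
    with Cons show ?case by simp
  qed simp
  have "\<forall>xs\<in>set [[0,1,5,7,10], [1,2,6,8,11], [2,3,7,9,12], [3,4,8,5,13], [4,0,9,6,14], [0,1,2,3,4]].
     distinct xs \<and> set xs \<in> set pet_some_cycles"
    by (simp add: pet_some_cycles_def)
  then have "\<forall>xs\<in>set [[0,1,5,7,10], [1,2,6,8,11], [2,3,7,9,12], [3,4,8,5,13], [4,0,9,6,14], [0,1,2,3,4]].
     foldr (\<lambda>p b. d p \<noteq> b) xs False = False"
    using card 3 by blast
  note c = this[unfolded list.set ball_simps foldr.simps o_apply id_apply]
  have "\<forall>i<6. \<exists>p\<in>pet_matching i. d p" using 1 by blast
  note d1 = this[unfolded all_less_6 One_nat_def pet_matching_simps bex_simps]
  have "\<forall>i<6. \<forall>p\<in>pet_matching i. \<forall>q\<in>pet_matching i. p \<noteq> q \<longrightarrow> \<not> (d p \<and> d q)" using 2 by blast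
  note d2 = this[unfolded all_less_6 One_nat_def pet_matching_simps ball_simps, simplified]
  show ?thesis
  proof (rule ccontr)
    assume "\<not> ?thesis"
    then have "\<forall>w<10. \<not> (\<forall>p<15. d p \<longleftrightarrow> p \<in> pet_star w)" by blast
    note n = this[unfolded all_less_10 One_nat_def pet_star_simps all_less_15, simplified]
    show False using d1[unfolded One_nat_def] d2[unfolded One_nat_def] c[unfolded One_nat_def] n[unfolded One_nat_def]  by argo
  qed
qed

section \<open>Neighbourhoods and foldings of the Petersen graph\<close>

definition pet_nbs :: "nat \<Rightarrow> nat set" where
  "pet_nbs v = [{1,4,5}, {0,2,6}, {1,3,7}, {2,4,8}, {3,0,9}, {0,7,8}, {1,8,9}, {2,9,5}, {3,5,6}, {4,6,7}] ! v"

lemma pet_nbs_simps: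
  "pet_nbs 0 = {1,4,5}" "pet_nbs (Suc 0) = {0,2,6}" "pet_nbs 2 = {1,3,7}" "pet_nbs 3 = {2,4,8}" "pet_nbs 4 = {3,0,9}"
  "pet_nbs 5 = {0,7,8}" "pet_nbs 6 = {1,8,9}" "pet_nbs 7 = {2,9,5}" "pet_nbs 8 = {3,5,6}" "pet_nbs 9 = {4,6,7}"
  by (simp_all add: pet_nbs_def)

lemma pet_nbs_star:
  assumes "u < 10" "v < 10" "u \<noteq> v"
  shows "v \<in> pet_nbs u \<Longrightarrow> \<exists>p. pet_star u \<inter> pet_star v = {p}" "v \<notin> pet_nbs u \<Longrightarrow> pet_star u \<inter> pet_star v = {}"
proof -
  have "\<forall>u<10. \<forall>v<10. u \<noteq> v \<longrightarrow> (if v \<in> pet_nbs u then card (pet_star u \<inter> pet_star v) = 1 else pet_star u \<inter> pet_star v = {})"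
    unfolding all_less_10 by (simp add: pet_star_simps pet_nbs_simps)
  then have "if v \<in> pet_nbs u then card (pet_star u \<inter> pet_star v) = 1 else pet_star u \<inter> pet_star v = {}"
    using assms by blast
  then show "v \<in> pet_nbs u \<Longrightarrow> \<exists>p. pet_star u \<inter> pet_star v = {p}" "v \<notin> pet_nbs u \<Longrightarrow> pet_star u \<inter> pet_star v = {}"
    by (auto simp: card_1_singleton_iff)
qed

lemma pet_nbs_less: "u < 10 \<Longrightarrow> v \<in> pet_nbs u \<Longrightarrow> v < 10"
proof -
  have "\<forall>u<10. \<forall>v\<in>pet_nbs u. v < 10"
    unfolding all_less_10 by (simp add: pet_nbs_simps)
  then show "u < 10 \<Longrightarrow> v \<in> pet_nbs u \<Longrightarrow> v < 10" by blast
qed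

lemma pet_nbs_sym: "u < 10 \<Longrightarrow> v \<in> pet_nbs u \<Longrightarrow> u \<in> pet_nbs v"
proof -
  have "\<forall>u<10. \<forall>v\<in>pet_nbs u. u \<in> pet_nbs v"
    unfolding all_less_10 by (simp add: pet_nbs_simps)
  then show "u < 10 \<Longrightarrow> v \<in> pet_nbs u \<Longrightarrow> u \<in> pet_nbs v" by blast
qed

lemma pet_nbs_irrefl: "u < 10 \<Longrightarrow> u \<notin> pet_nbs u"
proof -
  have "\<forall>u<10. u \<notin> pet_nbs u"
    unfolding all_less_10 by (simp add: pet_nbs_simps)
  then show "u < 10 \<Longrightarrow> u \<notin> pet_nbs u" by blast
qed

lemma pet_nbs_triangle: "u < 10 \<Longrightarrow> v \<in> pet_nbs u \<Longrightarrow> w \<in> pet_nbs v \<Longrightarrow> w \<notin> pet_nbs u"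
proof -
  have "\<forall>u<10. \<forall>v\<in>pet_nbs u. \<forall>w\<in>pet_nbs v. w \<notin> pet_nbs u"
    unfolding all_less_10 by (simp add: pet_nbs_simps)
  then show "u < 10 \<Longrightarrow> v \<in> pet_nbs u \<Longrightarrow> w \<in> pet_nbs v \<Longrightarrow> w \<notin> pet_nbs u" by blast
qed

text \<open>No 4-cycles. Together with \<open>pet_nbs_triangle\<close> this is girth five, the
  property of the target on which \<open>fold_cycle\<close> rests.\<close>

lemma pet_nbs_quad: "y < 10 \<Longrightarrow> a \<in> pet_nbs y \<Longrightarrow> b \<in> pet_nbs y \<Longrightarrow> a \<noteq> b \<Longrightarrow> z \<in> pet_nbs a \<Longrightarrow> z \<in> pet_nbs b \<Longrightarrow> z = y"
proof -
  have "\<forall>y<10. \<forall>a\<in>pet_nbs y. \<forall>b\<in>pet_nbs y. a \<noteq> b \<longrightarrow> (\<forall>z\<in>pet_nbs a. z \<in> pet_nbs b \<longrightarrow> z = y)"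
    unfolding all_less_10 by (simp add: pet_nbs_simps)
  then show "y < 10 \<Longrightarrow> a \<in> pet_nbs y \<Longrightarrow> b \<in> pet_nbs y \<Longrightarrow> a \<noteq> b \<Longrightarrow> z \<in> pet_nbs a \<Longrightarrow> z \<in> pet_nbs b \<Longrightarrow> z = y" by blast
qed

text \<open>The \<open>p\<close>-th entry lists all vertices as seen from the edge \<open>p\<close> with ends \<open>u, v\<close>: after these come the other neighbours
  \<open>u\<^sub>1, u\<^sub>2\<close> of \<open>u\<close> and \<open>v\<^sub>1, v\<^sub>2\<close> of \<open>v\<close>, and the common neighbours \<open>c\<^sub>1\<^sub>1, c\<^sub>1\<^sub>2, c\<^sub>2\<^sub>1, c\<^sub>2\<^sub>2\<close> of \<open>u\<^sub>i\<close> and \<open>v\<^sub>j\<close>.\<close>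

definition pet_frames :: "nat list list" where
  "pet_frames = [[0, 1, 4, 5, 2, 6, 3, 9, 7, 8],
    [1, 2, 0, 6, 3, 7, 4, 5, 8, 9], [2, 3, 1, 7, 4, 8, 0, 6, 9, 5],
    [3, 4, 2, 8, 0, 9, 1, 7, 5, 6], [4, 0, 3, 9, 1, 5, 2, 8, 6, 7],
    [0, 5, 1, 4, 7, 8, 2, 6, 9, 3], [1, 6, 0, 2, 8, 9, 5, 4, 3, 7],
    [2, 7, 1, 3, 5, 9, 0, 6, 8, 4], [3, 8, 2, 4, 6, 5, 1, 7, 9, 0],
    [4, 9, 3, 0, 7, 6, 2, 8, 5, 1], [5, 7, 0, 8, 2, 9, 1, 4, 3, 6],
    [6, 8, 1, 9, 3, 5, 2, 0, 4, 7], [7, 9, 2, 5, 4, 6, 3, 1, 0, 8],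
    [8, 5, 3, 6, 0, 7, 4, 2, 1, 9], [9, 6, 4, 7, 1, 8, 0, 3, 2, 5]]"

text \<open>The 15 index pairs are the edges of a Petersen graph on list positions, so a frame is an
  isomorphism onto the standard one. Having a frame for every edge expresses edge-transitivity and
  lets one argument serve all edges.\<close>

definition is_pet_frame :: "nat list \<Rightarrow> bool" where
  "is_pet_frame xs \<longleftrightarrow> length xs = 10 \<and> distinct xs \<and> (\<forall>x\<in>set xs. x < 10) \<and>
    (\<forall>(i, j)\<in>{(0,1),(0,2),(0,3),(1,4),(1,5),(2,6),(2,7),(3,8),(3,9),(4,6),(4,8),(5,7),(5,9),(6,9),(7,8)}.
      xs ! j \<in> pet_nbs (xs ! i))"

lemma pet_frames: "\<forall>xs\<in>set pet_frames. is_pet_frame xs"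
  unfolding pet_frames_def is_pet_frame_def by (simp add: pet_nbs_simps)

text \<open>The vertices \<open>a, u, v, b, c\<close> form a 5-cycle. If \<open>\<phi>\<close>
  collapsed \<open>au\<close> but not \<open>vb\<close>, then \<open>\<phi> c\<close> and
  \<open>\<phi> v\<close> would both be common neighbours of \<open>\<phi> u\<close> and
  \<open>\<phi> b\<close>, hence equal by girth five, and \<open>li\<close> at \<open>b\<close>
  would collapse \<open>vb\<close> after all. If both collapse, absence of triangles leaves only
  \<open>\<phi> u\<close> and \<open>\<phi> v\<close> for \<open>\<phi> c\<close>.\<close>

lemma fold_cycle:
  assumes lt: "u < 10" "v < 10" "a < 10" "b < 10" "c < 10"
   and phi_lt: "\<And>v. v < 10 \<Longrightarrow> \<phi> v < 10"
   and hom: "\<And>u v. u < 10 \<Longrightarrow> v \<in> pet_nbs u \<Longrightarrow> \<phi> u = \<phi> v \<or> \<phi> v \<in> pet_nbs (\<phi> u)"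
   and li: "\<And>u v w. u < 10 \<Longrightarrow> v \<in> pet_nbs u \<Longrightarrow> w \<in> pet_nbs u \<Longrightarrow> v \<noteq> w \<Longrightarrow> \<phi> v = \<phi> w \<Longrightarrow> \<phi> u = \<phi> v"
   and adj: "v \<in> pet_nbs u" "a \<in> pet_nbs u" "b \<in> pet_nbs v" "c \<in> pet_nbs a" "c \<in> pet_nbs b"
   and ne: "a \<noteq> v" "b \<noteq> u" "c \<noteq> u" "c \<noteq> v" "\<phi> u \<noteq> \<phi> v"
  shows "\<phi> a = \<phi> u \<and> \<phi> b = \<phi> v \<and> (\<phi> c = \<phi> u \<or> \<phi> c = \<phi> v) \<or> \<phi> a \<noteq> \<phi> u \<and> \<phi> b \<noteq> \<phi> v"
proof -
  have 1: "\<phi> a \<noteq> \<phi> v" "\<phi> b \<noteq> \<phi> u" using li[of u a v] li[of v b u] adj ne lt pet_nbs_sym by metis+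
  have uv: "\<phi> v \<in> pet_nbs (\<phi> u)" "\<phi> u \<in> pet_nbs (\<phi> v)" using hom adj ne lt pet_nbs_sym phi_lt by metis+
  consider "\<phi> a = \<phi> u" "\<phi> b = \<phi> v" | "\<phi> a = \<phi> u" "\<phi> b \<noteq> \<phi> v" | "\<phi> a \<noteq> \<phi> u" "\<phi> b = \<phi> v" | "\<phi> a \<noteq> \<phi> u" "\<phi> b \<noteq> \<phi> v" by blast
  then show ?thesis
  proof cases
    case 1
    then have "\<phi> c = \<phi> u \<or> \<phi> c \<in> pet_nbs (\<phi> u)" "\<phi> c = \<phi> v \<or> \<phi> c \<in> pet_nbs (\<phi> v)" using hom adj lt by metis+
    then show ?thesis using 1 uv pet_nbs_triangle phi_lt lt by metis
  next
    case 2
    have b: "\<phi> b \<in> pet_nbs (\<phi> v)" using hom 2 adj lt by metis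
    have c: "\<phi> c = \<phi> u \<or> \<phi> c \<in> pet_nbs (\<phi> u)" "\<phi> c = \<phi> b \<or> \<phi> c \<in> pet_nbs (\<phi> b)" using hom adj lt 2 by metis+
    have nub: "\<phi> b \<notin> pet_nbs (\<phi> u)" using pet_nbs_triangle uv b phi_lt lt by metis
    then have "\<phi> u \<notin> pet_nbs (\<phi> b)" using pet_nbs_sym phi_lt lt by metis
    then have "\<phi> c \<in> pet_nbs (\<phi> u)" "\<phi> c \<in> pet_nbs (\<phi> b)" using c nub 1 by metis+
    then have "\<phi> c = \<phi> v" using pet_nbs_quad[of "\<phi> v" "\<phi> u" "\<phi> b" "\<phi> c"] uv b 1 phi_lt lt by metis
    then have "\<phi> b = \<phi> v" using li[of b c v] adj ne lt pet_nbs_sym by metis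
    then show ?thesis using 2 by simp
  next
    case 3
    have b: "\<phi> a \<in> pet_nbs (\<phi> u)" using hom 3 adj lt by metis
    have c: "\<phi> c = \<phi> v \<or> \<phi> c \<in> pet_nbs (\<phi> v)" "\<phi> c = \<phi> a \<or> \<phi> c \<in> pet_nbs (\<phi> a)" using hom adj lt 3 by metis+
    have nub: "\<phi> a \<notin> pet_nbs (\<phi> v)" using pet_nbs_triangle uv b phi_lt lt by metis
    then have "\<phi> v \<notin> pet_nbs (\<phi> a)" using pet_nbs_sym phi_lt lt by metis
    then have "\<phi> c \<in> pet_nbs (\<phi> v)" "\<phi> c \<in> pet_nbs (\<phi> a)" using c nub 1 by metis+
    then have "\<phi> c = \<phi> u" using pet_nbs_quad[of "\<phi> u" "\<phi> v" "\<phi> a" "\<phi> c"] uv b 1 phi_lt lt by metis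
    then have "\<phi> a = \<phi> u" using li[of a c u] adj ne lt pet_nbs_sym by metis
    then show ?thesis using 3 by simp
  qed blast
qed

text \<open>If \<open>u, v\<close> are adjacent with \<open>\<phi> u \<noteq> \<phi> v\<close>, then either \<open>\<phi>\<close> takes only these two values, and the fibre of \<open>\<phi> u\<close>
  is odd, or the images of \<open>u\<close>, \<open>v\<close> and their neighbours are six different values, whereas even fibres allow at most five.\<close>

lemma even_fibres_const:
  assumes phi_lt: "\<And>v. v < 10 \<Longrightarrow> \<phi> v < 10"
   and hom: "\<And>u v. u < 10 \<Longrightarrow> v \<in> pet_nbs u \<Longrightarrow> \<phi> u = \<phi> v \<or> \<phi> v \<in> pet_nbs (\<phi> u)"
   and li: "\<And>u v w. u < 10 \<Longrightarrow> v \<in> pet_nbs u \<Longrightarrow> w \<in> pet_nbs u \<Longrightarrow> v \<noteq> w \<Longrightarrow> \<phi> v = \<phi> w \<Longrightarrow> \<phi> u = \<phi> v"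
   and ev: "\<And>w. w < 10 \<Longrightarrow> even (card {v. v < 10 \<and> \<phi> v = w})"
   and p: "p < 15"
  shows "\<phi> (fst (pet_ends p)) = \<phi> (snd (pet_ends p))"
proof (rule ccontr)
  assume ne: "\<phi> (fst (pet_ends p)) \<noteq> \<phi> (snd (pet_ends p))"
  have "\<forall>p<15. pet_frames ! p \<in> set pet_frames \<and> take 2 (pet_frames ! p) = [fst (pet_ends p), snd (pet_ends p)]"
    unfolding all_less_15 by (simp add: pet_frames_def pet_ends_simps)
  with pet_frames p have fr: "is_pet_frame (pet_frames ! p)" and tk: "take 2 (pet_frames ! p) = [fst (pet_ends p), snd (pet_ends p)]" by blast+
  have "length (pet_frames ! p) = 10" using fr by (simp add: is_pet_frame_def)
  then obtain u v u1 u2 v1 v2 c11 c12 c21 c22 where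
    xs: "pet_frames ! p = [u, v, u1, u2, v1, v2, c11, c12, c21, c22]"
    unfolding numeral_nat by (auto simp: length_Suc_conv)
  have uv: "u = fst (pet_ends p)" "v = snd (pet_ends p)" using tk unfolding xs by simp_all
  note fr' = fr[unfolded xs is_pet_frame_def, simplified]
  have dist: "distinct [u, v, u1, u2, v1, v2, c11, c12, c21, c22]" and
    lt': "\<forall>x\<in>set [u, v, u1, u2, v1, v2, c11, c12, c21, c22]. x < 10" and
    adj: "v \<in> pet_nbs u" "u1 \<in> pet_nbs u" "u2 \<in> pet_nbs u" "v1 \<in> pet_nbs v" "v2 \<in> pet_nbs v"
     "c11 \<in> pet_nbs u1" "c12 \<in> pet_nbs u1" "c21 \<in> pet_nbs u2" "c22 \<in> pet_nbs u2"
     "c11 \<in> pet_nbs v1" "c21 \<in> pet_nbs v1" "c12 \<in> pet_nbs v2" "c22 \<in> pet_nbs v2" "c22 \<in> pet_nbs c11" "c21 \<in> pet_nbs c12"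
    using fr' by simp_all
  have ne: "\<phi> u \<noteq> \<phi> v" using ne uv by simp
  have st: "set [u, v, u1, u2, v1, v2, c11, c12, c21, c22] = {..<10}"
  proof (rule card_subset_eq)
    show "set [u, v, u1, u2, v1, v2, c11, c12, c21, c22] \<subseteq> {..<10}" using lt' by blast
    show "card (set [u, v, u1, u2, v1, v2, c11, c12, c21, c22]) = card {..<10::nat}"
      unfolding distinct_card[OF dist] by simp
  qed simp
  from lt' have lt: "u < 10" "v < 10" "u1 < 10" "u2 < 10" "v1 < 10" "v2 < 10" "c11 < 10" "c12 < 10" "c21 < 10" "c22 < 10"
    by auto
  have ne':  "u1 \<noteq> v" "u2 \<noteq> v" "v1 \<noteq> u" "v2 \<noteq> u" "c11 \<noteq> u" "c12 \<noteq> u" "c21 \<noteq> u" "c22 \<noteq> u" "c11 \<noteq> v" "c12 \<noteq> v" "c21 \<noteq> v" "c22 \<noteq> v"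
    using dist by auto
  have f0: "\<phi> u1 = \<phi> u \<and> \<phi> v1 = \<phi> v \<and> (\<phi> c11 = \<phi> u \<or> \<phi> c11 = \<phi> v) \<or> \<phi> u1 \<noteq> \<phi> u \<and> \<phi> v1 \<noteq> \<phi> v"
    by (rule fold_cycle[where \<phi> = \<phi> and u = u and v = v and a = u1 and b = v1 and c = c11]) (fact adj lt ne ne' phi_lt hom li)+
  have f1: "\<phi> u1 = \<phi> u \<and> \<phi> v2 = \<phi> v \<and> (\<phi> c12 = \<phi> u \<or> \<phi> c12 = \<phi> v) \<or> \<phi> u1 \<noteq> \<phi> u \<and> \<phi> v2 \<noteq> \<phi> v"
    by (rule fold_cycle[where \<phi> = \<phi> and u = u and v = v and a = u1 and b = v2 and c = c12]) (fact adj lt ne ne' phi_lt hom li)+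
  have f2: "\<phi> u2 = \<phi> u \<and> \<phi> v1 = \<phi> v \<and> (\<phi> c21 = \<phi> u \<or> \<phi> c21 = \<phi> v) \<or> \<phi> u2 \<noteq> \<phi> u \<and> \<phi> v1 \<noteq> \<phi> v"
    by (rule fold_cycle[where \<phi> = \<phi> and u = u and v = v and a = u2 and b = v1 and c = c21]) (fact adj lt ne ne' phi_lt hom li)+
  have f3: "\<phi> u2 = \<phi> u \<and> \<phi> v2 = \<phi> v \<and> (\<phi> c22 = \<phi> u \<or> \<phi> c22 = \<phi> v) \<or> \<phi> u2 \<noteq> \<phi> u \<and> \<phi> v2 \<noteq> \<phi> v"
    by (rule fold_cycle[where \<phi> = \<phi> and u = u and v = v and a = u2 and b = v2 and c = c22]) (fact adj lt ne ne' phi_lt hom li)+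
  note 4 = f0 f1 f2 f3
  show False
  proof (cases "\<phi> u1 = \<phi> u")
    case True
    then have eq: "\<phi> u1 = \<phi> u" "\<phi> u2 = \<phi> u" "\<phi> v1 = \<phi> v" "\<phi> v2 = \<phi> v" and
      c: "\<phi> c11 = \<phi> u \<or> \<phi> c11 = \<phi> v" "\<phi> c12 = \<phi> u \<or> \<phi> c12 = \<phi> v" "\<phi> c21 = \<phi> u \<or> \<phi> c21 = \<phi> v" "\<phi> c22 = \<phi> u \<or> \<phi> c22 = \<phi> v"
      using 4 by metis+
    have sym: "v1 \<in> pet_nbs c11" "u1 \<in> pet_nbs c11" "v2 \<in> pet_nbs c12" "u1 \<in> pet_nbs c12"
      using adj lt pet_nbs_sym by blast+
    have d: "c22 \<noteq> v1" "c22 \<noteq> u1" "c21 \<noteq> v2" "c21 \<noteq> u1" using dist by auto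
    \<comment> \<open>The vertex \<open>c11\<close> is adjacent to \<open>c22\<close>,
      \<open>u1\<close> and \<open>v1\<close>, and \<open>\<phi> c22\<close> agrees with the image
      of \<open>u1\<close> or of \<open>v1\<close>; so \<open>li\<close> at \<open>c11\<close>
      identifies the images of \<open>c11\<close> and \<open>c22\<close>. The pair
      \<open>c12\<close>, \<open>c21\<close> is treated alike.\<close>
    have "\<phi> c22 = \<phi> v1 \<Longrightarrow> \<phi> c11 = \<phi> c22" "\<phi> c22 = \<phi> u1 \<Longrightarrow> \<phi> c11 = \<phi> c22"
      using li[of c11 c22 v1] li[of c11 c22 u1] lt adj sym d by simp_all
    then have c1: "\<phi> c11 = \<phi> c22" using c(4) eq by metis
    have "\<phi> c21 = \<phi> v2 \<Longrightarrow> \<phi> c12 = \<phi> c21" "\<phi> c21 = \<phi> u1 \<Longrightarrow> \<phi> c12 = \<phi> c21"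
      using li[of c12 c21 v2] li[of c12 c21 u1] lt adj sym d by simp_all
    then have c2: "\<phi> c12 = \<phi> c21" using c(3) eq by metis
    let ?xs = "[u, v, u1, u2, v1, v2, c11, c12, c21, c22]"
    have "{w. w < 10 \<and> \<phi> w = \<phi> u} = set (filter (\<lambda>w. \<phi> w = \<phi> u) ?xs)"
      unfolding set_filter st by simp
    then have "card {w. w < 10 \<and> \<phi> w = \<phi> u} = length (filter (\<lambda>w. \<phi> w = \<phi> u) ?xs)"
      using distinct_card[OF distinct_filter[OF dist]] by metis
    \<comment> \<open>The fibre consists of \<open>u\<close>, \<open>u1\<close>, \<open>u2\<close>
      and of both or none of each of the pairs \<open>c11\<close>, \<open>c22\<close> and
      \<open>c12\<close>, \<open>c21\<close>.\<close>
    also have "odd \<dots>" using eq ne c1 c2 by simp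
    finally show False using ev phi_lt lt by blast
  next
    case False
    then have nf: "\<phi> u1 \<noteq> \<phi> u" "\<phi> u2 \<noteq> \<phi> u" "\<phi> v1 \<noteq> \<phi> v" "\<phi> v2 \<noteq> \<phi> v" using 4 by metis+
    have a1: "\<phi> u1 \<in> pet_nbs (\<phi> u)" "\<phi> u2 \<in> pet_nbs (\<phi> u)" "\<phi> v1 \<in> pet_nbs (\<phi> v)" "\<phi> v2 \<in> pet_nbs (\<phi> v)" "\<phi> v \<in> pet_nbs (\<phi> u)"
      using hom[of u u1] hom[of u u2] hom[of v v1] hom[of v v2] hom[of u v] adj lt nf ne by auto
    have u_v: "u \<in> pet_nbs v" using adj pet_nbs_sym lt by blast
    have n: "\<phi> u1 \<noteq> \<phi> u2" "\<phi> v1 \<noteq> \<phi> v2" "\<phi> u1 \<noteq> \<phi> v" "\<phi> u2 \<noteq> \<phi> v" "\<phi> v1 \<noteq> \<phi> u" "\<phi> v2 \<noteq> \<phi> u"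
      using li[of u u1 u2] li[of v v1 v2] li[of u u1 v] li[of u u2 v] li[of v v1 u] li[of v v2 u] adj u_v lt nf ne dist by auto
    have n2: "\<phi> u1 \<noteq> \<phi> v1" "\<phi> u1 \<noteq> \<phi> v2" "\<phi> u2 \<noteq> \<phi> v1" "\<phi> u2 \<noteq> \<phi> v2"
      using a1 pet_nbs_triangle[of "\<phi> u" "\<phi> v"] phi_lt[OF lt(1)] by metis+
    let ?S = "{\<phi> u, \<phi> v, \<phi> u1, \<phi> u2, \<phi> v1, \<phi> v2}"
    have "2 \<le> card {v. v < 10 \<and> \<phi> v = w}" if "w \<in> ?S" for w
    proof -
      have "w < 10" using that phi_lt lt by auto
      then have "even (card {v. v < 10 \<and> \<phi> v = w})" by (rule ev)
      moreover have "{v. v < 10 \<and> \<phi> v = w} \<noteq> {}" using that lt by auto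
      then have "card {v. v < 10 \<and> \<phi> v = w} \<noteq> 0" by simp
      ultimately show ?thesis by presburger
    qed
    then have "(\<Sum>w\<in>?S. 2) \<le> (\<Sum>w\<in>?S. card {v. v < 10 \<and> \<phi> v = w})" by (rule sum_mono)
    also have "\<dots> = card (\<Union>w\<in>?S. {v. v < 10 \<and> \<phi> v = w})" by (rule card_UN_disjoint[symmetric]) auto
    also have "\<dots> \<le> card {..<10::nat}" by (rule card_mono) auto
    finally show False using n n2 nf ne by auto
  qed
qed

section \<open>Amalgams of cycle systems along single edges\<close>

text \<open>For two graphs sharing one edge this is the series connection of their cycle matroids: a
  cycle through the shared edge must use it on both sides. Parallel connection would ask for
  less.\<close>

definition amalgam :: "('i \<Rightarrow> 'e set) \<Rightarrow> ('i \<Rightarrow> 'e set set) \<Rightarrow> 'i set \<Rightarrow> 'e set set" where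
  "amalgam Ed \<X> A = {J. J \<subseteq> \<Union>(Ed ` A) \<and> (\<forall>i\<in>A. J \<inter> Ed i \<in> \<X> i)}"

text \<open>The shared edge \<open>s\<close> may lie in many earlier members, and bounding the
  intersection by a singleton instead of fixing it admits disjoint members too; disjoint unions of
  chains are thus covered.\<close>

inductive forest :: "('i \<Rightarrow> 'e set) \<Rightarrow> 'i set \<Rightarrow> bool" for Ed where
  empty: "forest Ed {}"
| insert: "forest Ed A \<Longrightarrow> i \<notin> A \<Longrightarrow> Ed i \<inter> \<Union>(Ed ` A) \<subseteq> {s} \<Longrightarrow> forest Ed (insert i A)"

text \<open>Exactly the freedom required for gluing: a member with prescribed behaviour at one
  shared edge can always be chosen.\<close>

definition flexible :: "'e set \<Rightarrow> 'e set set \<Rightarrow> bool" where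
  "flexible E \<X> \<longleftrightarrow> (\<forall>X\<in>\<X>. X \<subseteq> E) \<and> (\<forall>s. \<exists>X\<in>\<X>. s \<notin> X) \<and> (\<forall>s\<in>E. \<exists>X\<in>\<X>. s \<in> X)"

text \<open>The last clause is the double cover that replaces a fractional edge colouring; asking for one through every
  member makes the averaging argument apply to all members.\<close>

definition matching_system :: "nat \<Rightarrow> 'e set \<Rightarrow> 'e set set \<Rightarrow> bool" where
  "matching_system n E \<P> \<longleftrightarrow> (\<forall>K\<in>\<P>. K \<subseteq> E) \<and> (\<forall>h\<in>E. \<forall>e. \<exists>K\<in>\<P>. h \<in> K \<and> (e \<noteq> h \<longrightarrow> e \<notin> K)) \<and>
    (\<forall>e e'. \<exists>K\<in>\<P>. e \<notin> K \<and> e' \<notin> K) \<and>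
    (\<forall>K\<in>\<P>. \<exists>J. J 0 = K \<and> (\<forall>t<n. J t \<in> \<P>) \<and> (\<forall>h\<in>E. card {t. t < n \<and> h \<in> J t} = 2))"

lemma matching_systemD:
  assumes "matching_system n E \<P>"
  shows "K \<in> \<P> \<Longrightarrow> K \<subseteq> E" "h \<in> E \<Longrightarrow> \<exists>K\<in>\<P>. h \<in> K \<and> (e \<noteq> h \<longrightarrow> e \<notin> K)"
    "\<exists>K\<in>\<P>. e \<notin> K \<and> e' \<notin> K"
    "K \<in> \<P> \<Longrightarrow> \<exists>J. J 0 = K \<and> (\<forall>t<n. J t \<in> \<P>) \<and> (\<forall>h\<in>E. card {t. t < n \<and> h \<in> J t} = 2)"
  using assms unfolding matching_system_def by blast+



lemma amalgam_subset: "J \<in> amalgam Ed \<X> A \<Longrightarrow> J \<subseteq> \<Union>(Ed ` A)"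
  by (simp add: amalgam_def)

lemma amalgam_empty: "amalgam Ed \<X> {} = {{}}"
  by (auto simp: amalgam_def)

lemma amalgam_insertI:
  assumes J: "J \<in> amalgam Ed \<X> A" and K: "K \<in> \<X> i" "K \<subseteq> Ed i" and s: "Ed i \<inter> \<Union>(Ed ` A) \<subseteq> {s}"
    and eq: "s \<in> Ed i \<Longrightarrow> s \<in> \<Union>(Ed ` A) \<Longrightarrow> s \<in> J \<longleftrightarrow> s \<in> K"
  shows "J \<union> K \<in> amalgam Ed \<X> (insert i A)" "(J \<union> K) \<inter> Ed i = K" "(J \<union> K) \<inter> \<Union>(Ed ` A) = J"
proof -
  have s': "x = s" if "x \<in> Ed i" "x \<in> \<Union>(Ed ` A)" for x using s that by blast
  have 1: "J \<inter> Ed i = K \<inter> \<Union>(Ed ` A)"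
  proof (intro set_eqI iffI)
    fix x assume x: "x \<in> J \<inter> Ed i"
    then have "x \<in> \<Union>(Ed ` A)" using amalgam_subset[OF J] by blast
    then show "x \<in> K \<inter> \<Union>(Ed ` A)" using s' eq x by blast
  next
    fix x assume x: "x \<in> K \<inter> \<Union>(Ed ` A)"
    then have "x \<in> Ed i" using K by blast
    then show "x \<in> J \<inter> Ed i" using s' eq x by blast
  qed
  then show 2: "(J \<union> K) \<inter> Ed i = K" "(J \<union> K) \<inter> \<Union>(Ed ` A) = J" using amalgam_subset[OF J] K(2) by auto
  have "(J \<union> K) \<inter> Ed j = J \<inter> Ed j" if "j \<in> A" for j using 2(2) that by auto
  then show "J \<union> K \<in> amalgam Ed \<X> (insert i A)" using J K(1,2) 2 unfolding amalgam_def by auto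
qed

lemma amalgam_insertD:
  assumes "J \<in> amalgam Ed \<X> (insert i A)"
  shows "J \<inter> \<Union>(Ed ` A) \<in> amalgam Ed \<X> A" "J \<inter> Ed i \<in> \<X> i"
proof -
  have "J \<inter> \<Union> (Ed ` A) \<inter> Ed j = J \<inter> Ed j" if "j \<in> A" for j using that by auto
  then show "J \<inter> \<Union>(Ed ` A) \<in> amalgam Ed \<X> A" "J \<inter> Ed i \<in> \<X> i" using assms unfolding amalgam_def by auto
qed

text \<open>Serves to test continuity into a single member: its cycles are traces of cycles of the
  whole amalgam. Along the forest, each further member only has to agree at one edge, which
  flexibility permits.\<close>

lemma amalgam_extend:
  assumes "forest Ed A" "\<And>j. j \<in> A \<Longrightarrow> flexible (Ed j) (\<X> j)" "i \<in> A" "X \<in> \<X> i"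
  shows "\<exists>Y\<in>amalgam Ed \<X> A. Y \<inter> Ed i = X"
  using assms
proof (induction arbitrary: i X rule: forest.induct)
  case (insert A k s)
  have flk: "flexible (Ed k) (\<X> k)" using insert.prems by simp
  show ?case
  proof (cases "i = k")
    case False
    then obtain Y where Y: "Y \<in> amalgam Ed \<X> A" "Y \<inter> Ed i = X"
      using insert by blast
    obtain Z where Z: "Z \<in> \<X> k" "Z \<subseteq> Ed k" "s \<in> Ed k \<Longrightarrow> s \<in> Y \<longleftrightarrow> s \<in> Z"
      using flk unfolding flexible_def by metis
    note 1 = amalgam_insertI[OF Y(1) Z(1,2) insert.hyps(3) Z(3)]
    have "(Y \<union> Z) \<inter> Ed i = (Y \<union> Z) \<inter> \<Union>(Ed ` A) \<inter> Ed i" using insert.prems False by auto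
    then show ?thesis using 1 Y by auto
  next
    case True
    have Xk: "X \<subseteq> Ed k" using flk insert.prems True unfolding flexible_def by blast
    \<comment> \<open>The old part has to behave at \<open>s\<close> like the given
      \<open>X\<close>; the induction hypothesis is applied to an old member containing
      \<open>s\<close>.\<close>
    have "\<exists>Y\<in>amalgam Ed \<X> A. s \<in> \<Union>(Ed ` A) \<longrightarrow> (s \<in> Y \<longleftrightarrow> s \<in> X)"
    proof (cases "s \<in> \<Union>(Ed ` A)")
      case True
      then obtain j where j: "j \<in> A" "s \<in> Ed j" by blast
      then have "flexible (Ed j) (\<X> j)" using insert.prems by simp
      then obtain Z where "Z \<in> \<X> j" "s \<in> Z \<longleftrightarrow> s \<in> X"
        using j unfolding flexible_def by metis
      moreover obtain Y where "Y \<in> amalgam Ed \<X> A" "Y \<inter> Ed j = Z"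
        using insert.IH[OF _ j(1) calculation(1)] insert.prems by blast
      ultimately show ?thesis using j by blast
    next
      case False
      have "amalgam Ed \<X> A \<noteq> {}"
      proof (cases "A = {}")
        case False
        then obtain j where j: "j \<in> A" by blast
        then have "flexible (Ed j) (\<X> j)" using insert.prems by simp
        then obtain Z where "Z \<in> \<X> j" unfolding flexible_def by blast
        then show ?thesis using insert.IH[OF _ j] insert.prems by blast
      qed (simp add: amalgam_empty)
      then show ?thesis using False by blast
    qed
    then obtain Y where Y: "Y \<in> amalgam Ed \<X> A" "s \<in> \<Union>(Ed ` A) \<Longrightarrow> s \<in> Y \<longleftrightarrow> s \<in> X" by blast
    have "X \<in> \<X> k" using insert.prems True by simp
    from amalgam_insertI[OF Y(1) this Xk insert.hyps(3) Y(2)] show ?thesis using True by blast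
  qed
qed simp

text \<open>Aligns two double covers at a shared edge: both contain it exactly twice, so one cover
  can be renumbered to match the other. Index \<open>a\<close> stays fixed because it carries the
  prescribed set.\<close>

lemma matching_permutation:
  assumes "finite S" "X \<subseteq> S" "Y \<subseteq> S" "card X = card Y" "a \<in> S" "a \<in> X \<longleftrightarrow> a \<in> Y"
  obtains \<pi> where "bij_betw \<pi> S S" "\<pi> a = a" "\<And>t. t \<in> S \<Longrightarrow> t \<in> X \<longleftrightarrow> \<pi> t \<in> Y"
proof -
  let ?X = "X - {a}" and ?Y = "Y - {a}"
  let ?X' = "S - {a} - X" and ?Y' = "S - {a} - Y"
  have fin: "finite X" "finite Y" using assms finite_subset by blast+
  have c1: "card ?X = card ?Y" using assms fin by (simp add: card_Diff_singleton_if)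
  have "?X' = S - {a} - ?X" "?Y' = S - {a} - ?Y" by auto
  moreover have "?X \<subseteq> S - {a}" "?Y \<subseteq> S - {a}" using assms by auto
  ultimately have c2: "card ?X' = card ?Y'" using c1 assms fin by (simp add: card_Diff_subset)
  obtain g where g: "bij_betw g ?X ?Y" using c1 fin finite_same_card_bij by (metis finite_Diff)
  obtain h where h: "bij_betw h ?X' ?Y'" using c2 assms(1) finite_same_card_bij by (metis finite_Diff)
  define \<pi> where "\<pi> t = (if t = a then a else if t \<in> X then g t else h t)" for t
  have 1: "bij_betw \<pi> ?X ?Y" using g by (rule bij_betw_cong[THEN iffD1, rotated]) (auto simp: \<pi>_def)
  have 2: "bij_betw \<pi> ?X' ?Y'" using h by (rule bij_betw_cong[THEN iffD1, rotated]) (auto simp: \<pi>_def)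
  have 3: "bij_betw \<pi> {a} {a}" by (simp add: \<pi>_def bij_betw_def)
  have "bij_betw \<pi> (?X \<union> ?X' \<union> {a}) (?Y \<union> ?Y' \<union> {a})"
    by (intro bij_betw_combine 1 2 3) auto
  moreover have "?X \<union> ?X' \<union> {a} = S" "?Y \<union> ?Y' \<union> {a} = S" using assms by auto
  ultimately have "bij_betw \<pi> S S" by simp
  moreover have "\<pi> a = a" by (simp add: \<pi>_def)
  moreover have "t \<in> X \<longleftrightarrow> \<pi> t \<in> Y" if t: "t \<in> S" for t
  proof -
    consider "t = a" | "t \<in> ?X" | "t \<in> ?X'" using t by auto
    then show ?thesis
    proof cases
      case 1 then show ?thesis using assms by (simp add: \<pi>_def)
    next
      case 2 then show ?thesis using bij_betwE[OF 1] by blast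
    next
      case 3 then show ?thesis using bij_betwE[OF 2] by blast
    qed
  qed
  ultimately show thesis using that by blast
qed

text \<open>Each clause is inherited by choosing sets on the two sides that agree at
  \<open>s\<close>; for the double covers, one of them is first renumbered.\<close>

lemma matching_system_insert:
  assumes A: "matching_system n (\<Union>(Ed ` A)) (amalgam Ed \<P> A)" and i: "matching_system n (Ed i) (\<P> i)"
    and s: "Ed i \<inter> \<Union>(Ed ` A) \<subseteq> {s}" and n: "0 < n"
  shows "matching_system n (\<Union>(Ed ` insert i A)) (amalgam Ed \<P> (insert i A))"
proof -
  let ?U = "\<Union>(Ed ` A)" let ?F = "amalgam Ed \<P> A" let ?G = "amalgam Ed \<P> (insert i A)"
  have sub: "K \<subseteq> Ed i" if "K \<in> \<P> i" for K using matching_systemD(1)[OF i that] .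
  have glue: "J \<union> K \<in> ?G" if "J \<in> ?F" "K \<in> \<P> i" "s \<in> J \<longleftrightarrow> s \<in> K" for J K
    using amalgam_insertI(1)[OF that(1,2) sub[OF that(2)] s] that(3) by blast
  have stateA: "\<exists>J\<in>?F. s \<in> ?U \<longrightarrow> (s \<in> J \<longleftrightarrow> b)" for b
    using matching_systemD(2)[OF A, of s s] matching_systemD(3)[OF A, of s s] by blast
  have statei: "\<exists>K\<in>\<P> i. s \<in> Ed i \<longrightarrow> (s \<in> K \<longleftrightarrow> b)" for b
    using matching_systemD(2)[OF i, of s s] matching_systemD(3)[OF i, of s s] by blast
  have extA: "\<exists>K. K \<in> \<P> i \<and> J \<union> K \<in> ?G \<and> (J \<union> K) \<inter> ?U = J" if "J \<in> ?F" for J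
  proof -
    obtain K where K: "K \<in> \<P> i" "s \<in> Ed i \<longrightarrow> (s \<in> K \<longleftrightarrow> s \<in> J)" using statei by blast
    then show ?thesis using amalgam_insertI[OF that K(1) sub[OF K(1)] s] by blast
  qed
  have exti: "\<exists>J. J \<in> ?F \<and> J \<union> K \<in> ?G \<and> (J \<union> K) \<inter> Ed i = K" if "K \<in> \<P> i" for K
  proof -
    obtain J where J: "J \<in> ?F" "s \<in> ?U \<longrightarrow> (s \<in> J \<longleftrightarrow> s \<in> K)" using stateA by blast
    then show ?thesis using amalgam_insertI[OF J(1) that sub[OF that] s] by blast
  qed
  have P1: "\<exists>K\<in>?G. h \<in> K \<and> (e \<noteq> h \<longrightarrow> e \<notin> K)" if h: "h \<in> \<Union>(Ed ` insert i A)" for h e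
  proof -
    consider "h \<in> ?U" "e \<in> ?U" | "h \<in> Ed i" "e \<in> Ed i" | "h \<in> ?U" "h \<notin> Ed i" "e \<notin> ?U"
      | "h \<in> Ed i" "h \<notin> ?U" "e \<notin> Ed i" | "h \<in> ?U" "h \<in> Ed i" "e \<notin> ?U" "e \<notin> Ed i"
      using h by auto
    then show ?thesis
    proof cases
      case 1
      obtain J where J: "J \<in> ?F" "h \<in> J" "e \<noteq> h \<longrightarrow> e \<notin> J" using matching_systemD(2)[OF A 1(1)] by blast
      with extA[OF J(1)] 1 show ?thesis by blast
    next
      case 2
      obtain J where J: "J \<in> \<P> i" "h \<in> J" "e \<noteq> h \<longrightarrow> e \<notin> J" using matching_systemD(2)[OF i 2(1)] by blast
      with exti[OF J(1)] 2 show ?thesis by blast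
    next
      case 3
      obtain J where J: "J \<in> ?F" "h \<in> J" "s \<noteq> h \<longrightarrow> s \<notin> J" using matching_systemD(2)[OF A 3(1)] by blast
      \<comment> \<open>Here \<open>e\<close> and \<open>s\<close> must be avoided at once, which is
        why the third clause of \<open>matching_system\<close> speaks of two edges.\<close>
      obtain K where K: "K \<in> \<P> i" "s \<notin> K" "e \<notin> K" using matching_systemD(3)[OF i] by blast
      show ?thesis
      proof (cases "s = h")
        case True
        then have "J \<union> K \<in> ?G" using amalgam_insertI(1)[OF J(1) K(1) sub[OF K(1)] s] 3 by blast
        moreover have "e \<notin> J \<union> K" using 3 K amalgam_subset[OF J(1)] by auto
        ultimately show ?thesis using J(2) by (intro bexI[of _ "J \<union> K"]) auto
      next
        case False
        then have "J \<union> K \<in> ?G" using glue[OF J(1) K(1)] J K by blast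
        moreover have "e \<notin> J \<union> K" using 3 K amalgam_subset[OF J(1)] by auto
        ultimately show ?thesis using J(2) by (intro bexI[of _ "J \<union> K"]) auto
      qed
    next
      case 4
      obtain J where J: "J \<in> \<P> i" "h \<in> J" "s \<noteq> h \<longrightarrow> s \<notin> J" using matching_systemD(2)[OF i 4(1)] by blast
      obtain K where K: "K \<in> ?F" "s \<notin> K" "e \<notin> K" using matching_systemD(3)[OF A] by blast
      show ?thesis
      proof (cases "s = h")
        case True
        then have "K \<union> J \<in> ?G" using amalgam_insertI(1)[OF K(1) J(1) sub[OF J(1)] s] 4 by blast
        moreover have "e \<notin> K \<union> J" using 4 K sub[OF J(1)] by auto
        ultimately show ?thesis using J(2) by (intro bexI[of _ "K \<union> J"]) auto
      next
        case False
        then have "K \<union> J \<in> ?G" using glue[OF K(1) J(1)] J K by blast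
        moreover have "e \<notin> K \<union> J" using 4 K sub[OF J(1)] by auto
        ultimately show ?thesis using J(2) by (intro bexI[of _ "K \<union> J"]) auto
      qed
    next
      case 5
      obtain J where J: "J \<in> ?F" "h \<in> J" using matching_systemD(2)[OF A 5(1)] by blast
      obtain K where K: "K \<in> \<P> i" "J \<union> K \<in> ?G" using extA[OF J(1)] by blast
      have "e \<notin> J \<union> K" using 5 amalgam_subset[OF J(1)] sub[OF K(1)] by auto
      with K(2) J(2) show ?thesis by (intro bexI[of _ "J \<union> K"]) auto
    qed
  qed
  have P2: "\<exists>K\<in>?G. e \<notin> K \<and> e' \<notin> K" for e e'
  proof -
    consider "e \<in> ?U \<or> e \<notin> Ed i" "e' \<in> ?U \<or> e' \<notin> Ed i" | "e \<in> Ed i \<or> e \<notin> ?U" "e' \<in> Ed i \<or> e' \<notin> ?U"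
      | "e \<notin> ?U" "e' \<notin> Ed i" | "e \<notin> Ed i" "e' \<notin> ?U" by argo
    then show ?thesis
    proof cases
      case 1
      obtain J where J: "J \<in> ?F" "e \<notin> J" "e' \<notin> J" using matching_systemD(3)[OF A] by blast
      obtain K where K: "K \<in> \<P> i" "J \<union> K \<in> ?G" "(J \<union> K) \<inter> ?U = J" using extA[OF J(1)] by blast
      then have "e \<notin> J \<union> K" "e' \<notin> J \<union> K" using J 1 sub[OF K(1)] by auto
      with K(2) show ?thesis by (intro bexI[of _ "J \<union> K"]) auto
    next
      case 2
      obtain J where J: "J \<in> \<P> i" "e \<notin> J" "e' \<notin> J" using matching_systemD(3)[OF i] by blast
      obtain K where K: "K \<in> ?F" "K \<union> J \<in> ?G" "(K \<union> J) \<inter> Ed i = J" using exti[OF J(1)] by blast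
      then have "e \<notin> K \<union> J" "e' \<notin> K \<union> J" using J 2 amalgam_subset[OF K(1)] by auto
      with K(2) show ?thesis by (intro bexI[of _ "K \<union> J"]) auto
    next
      case 3
      obtain J where J: "J \<in> ?F" "e' \<notin> J" "s \<notin> J" using matching_systemD(3)[OF A] by blast
      obtain K where K: "K \<in> \<P> i" "e \<notin> K" "s \<notin> K" using matching_systemD(3)[OF i] by blast
      have "J \<union> K \<in> ?G" using glue[OF J(1) K(1)] J K by blast
      moreover have "e \<notin> J \<union> K" "e' \<notin> J \<union> K" using J K 3 amalgam_subset[OF J(1)] sub[OF K(1)] by auto
      ultimately show ?thesis by (intro bexI[of _ "J \<union> K"]) auto
    next
      case 4
      obtain J where J: "J \<in> ?F" "e \<notin> J" "s \<notin> J" using matching_systemD(3)[OF A] by blast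
      obtain K where K: "K \<in> \<P> i" "e' \<notin> K" "s \<notin> K" using matching_systemD(3)[OF i] by blast
      have "J \<union> K \<in> ?G" using glue[OF J(1) K(1)] J K by blast
      moreover have "e \<notin> J \<union> K" "e' \<notin> J \<union> K" using J K 4 amalgam_subset[OF J(1)] sub[OF K(1)] by auto
      ultimately show ?thesis by (intro bexI[of _ "J \<union> K"]) auto
    qed
  qed
  have DC: "\<exists>J. J 0 = K \<and> (\<forall>t<n. J t \<in> ?G) \<and> (\<forall>h\<in>\<Union>(Ed ` insert i A). card {t. t < n \<and> h \<in> J t} = 2)"
    if K: "K \<in> ?G" for K
  proof -
    obtain J1 where J1: "J1 0 = K \<inter> ?U" "\<forall>t<n. J1 t \<in> ?F" "\<forall>h\<in>?U. card {t. t < n \<and> h \<in> J1 t} = 2"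
      using matching_systemD(4)[OF A amalgam_insertD(1)[OF K]] by blast
    obtain J2 where J2: "J2 0 = K \<inter> Ed i" "\<forall>t<n. J2 t \<in> \<P> i" "\<forall>h\<in>Ed i. card {t. t < n \<and> h \<in> J2 t} = 2"
      using matching_systemD(4)[OF i amalgam_insertD(2)[OF K]] by blast
    \<comment> \<open>Agreement is needed at \<open>s\<close> only, and only if \<open>s\<close> is
      really shared; otherwise the identity will do.\<close>
    obtain \<pi> where pi: "bij_betw \<pi> {..<n} {..<n}" "\<pi> 0 = 0"
       "\<And>t. t < n \<Longrightarrow> s \<in> ?U \<Longrightarrow> s \<in> Ed i \<Longrightarrow> s \<in> J1 t \<longleftrightarrow> s \<in> J2 (\<pi> t)"
    proof (cases "s \<in> ?U \<and> s \<in> Ed i")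
      case True
      obtain \<pi> where "bij_betw \<pi> {..<n} {..<n}" "\<pi> 0 = 0"
         "\<And>t. t \<in> {..<n} \<Longrightarrow> t \<in> {t. t < n \<and> s \<in> J1 t} \<longleftrightarrow> \<pi> t \<in> {t. t < n \<and> s \<in> J2 t}"
        by (rule matching_permutation[of "{..<n}" "{t. t < n \<and> s \<in> J1 t}" "{t. t < n \<and> s \<in> J2 t}" 0])
           (use J1 J2 True n in auto)
      moreover from this have "\<pi> t < n" if "t < n" for t using that bij_betwE by blast
      ultimately show thesis using that by auto
    next
      case False
      then show thesis using that[of id] by auto
    qed
    have pin: "\<pi> t < n" if "t < n" for t using that pi(1) bij_betwE by blast
    define J where "J t = J1 t \<union> J2 (\<pi> t)" for t
    have g: "J t \<in> ?G" "J t \<inter> ?U = J1 t" "J t \<inter> Ed i = J2 (\<pi> t)" if "t < n" for t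
      using amalgam_insertI[OF J1(2)[rule_format, OF that] J2(2)[rule_format, OF pin[OF that]] sub s]
         J2(2) pin[OF that] pi(3)[OF that] unfolding J_def by blast+
    have "J 0 = K" using J1(1) J2(1) pi(2) amalgam_subset[OF K] by (auto simp: J_def)
    moreover have "card {t. t < n \<and> h \<in> J t} = 2" if "h \<in> \<Union>(Ed ` insert i A)" for h
    proof (cases "h \<in> ?U")
      case True
      then have "{t. t < n \<and> h \<in> J t} = {t. t < n \<and> h \<in> J1 t}" using g by blast
      then show ?thesis using bspec[OF J1(3) True] by simp
    next
      case False
      then have h: "h \<in> Ed i" using that by blast
      then have "{t. t < n \<and> h \<in> J t} = {t \<in> {..<n}. \<pi> t \<in> {t. t < n \<and> h \<in> J2 t}}" using g pin by blast
      moreover have "bij_betw \<pi> {t \<in> {..<n}. \<pi> t \<in> {t. t < n \<and> h \<in> J2 t}} {t. t < n \<and> h \<in> J2 t}"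
        by (rule bij_betw_subset[OF pi(1)]) (use pi(1)[unfolded bij_betw_def] in auto)
      ultimately show ?thesis using bspec[OF J2(3) h] bij_betw_same_card by metis
    qed
    ultimately show ?thesis using g(1) by blast
  qed
  show ?thesis unfolding matching_system_def
  proof (intro conjI ballI allI)
    show "K \<subseteq> \<Union>(Ed ` insert i A)" if "K \<in> ?G" for K using amalgam_subset[OF that] .
    show "\<exists>K\<in>?G. h \<in> K \<and> (e \<noteq> h \<longrightarrow> e \<notin> K)" if "h \<in> \<Union>(Ed ` insert i A)" for h e using P1[OF that] .
    show "\<exists>K\<in>?G. e \<notin> K \<and> e' \<notin> K" for e e' using P2 .
    show "\<exists>J. J 0 = K \<and> (\<forall>t<n. J t \<in> ?G) \<and> (\<forall>h\<in>\<Union>(Ed ` insert i A). card {t. t < n \<and> h \<in> J t} = 2)"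
      if "K \<in> ?G" for K using DC[OF that] .
  qed
qed

lemma matching_system_forest:
  assumes "forest Ed A" "\<And>i. i \<in> A \<Longrightarrow> matching_system n (Ed i) (\<P> i)" "0 < n"
  shows "matching_system n (\<Union>(Ed ` A)) (amalgam Ed \<P> A)"
  using assms
proof (induction rule: forest.induct)
  case empty
  show ?case by (auto simp: matching_system_def amalgam_empty)
next
  case (insert A i s)
  show ?case by (rule matching_system_insert) (use insert in auto)
qed

text \<open>Suppose \<open>D\<close> contains \<open>h\<close> only on the new side and
  \<open>h'\<close> only on the old side. Sets through \<open>h\<close> and \<open>h'\<close> that
  avoid a common edge \<open>s\<close> glue to one that meets \<open>D\<close> twice, contrary to
  the assumption. So \<open>D\<close> lies on one side, and induction applies on the old
  one.\<close>

lemma localize_forest: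
  assumes "forest Ed A" "\<And>i. i \<in> A \<Longrightarrow> matching_system n (Ed i) (\<P> i)" "0 < n"
    "D \<subseteq> \<Union>(Ed ` A)" "\<And>J. J \<in> amalgam Ed \<P> A \<Longrightarrow> card (D \<inter> J) = 1"
  shows "\<exists>i\<in>A. D \<subseteq> Ed i"
  using assms
proof (induction rule: forest.induct)
  case empty
  then show ?case by (simp add: amalgam_empty)
next
  case (insert A i s)
  have A: "matching_system n (\<Union>(Ed ` A)) (amalgam Ed \<P> A)"
    by (rule matching_system_forest) (use insert in auto)
  have i: "matching_system n (Ed i) (\<P> i)" using insert.prems by simp
  show ?case
  proof (cases "D \<subseteq> \<Union>(Ed ` A)")
    case True
    have "card (D \<inter> J) = 1" if "J \<in> amalgam Ed \<P> A" for J
    proof -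
      obtain K where K: "K \<in> \<P> i" "s \<in> Ed i \<longrightarrow> (s \<in> K \<longleftrightarrow> s \<in> J)"
        using matching_systemD(2)[OF i, of s s] matching_systemD(3)[OF i, of s s] by blast
      have "J \<union> K \<in> amalgam Ed \<P> (insert i A)" "(J \<union> K) \<inter> \<Union>(Ed ` A) = J"
        using amalgam_insertI[OF that K(1) matching_systemD(1)[OF i K(1)] insert.hyps(3)] K(2) by blast+
      moreover from this(2) have "D \<inter> (J \<union> K) = D \<inter> J" using True by blast
      ultimately show ?thesis using insert.prems(4) by metis
    qed
    then show ?thesis using insert True by blast
  next
    case False
    then obtain h where h: "h \<in> D" "h \<notin> \<Union>(Ed ` A)" by blast
    have "D \<subseteq> Ed i"
    proof
      fix h' assume h': "h' \<in> D"
      show "h' \<in> Ed i"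
      proof (rule ccontr)
        assume n: "h' \<notin> Ed i"
        have hi: "h \<in> Ed i" "h' \<in> \<Union>(Ed ` A)" using h h' n insert.prems(3) by auto
        obtain J where J: "J \<in> amalgam Ed \<P> A" "h' \<in> J" "s \<noteq> h' \<longrightarrow> s \<notin> J"
          using matching_systemD(2)[OF A hi(2)] by blast
        obtain K where K: "K \<in> \<P> i" "h \<in> K" "s \<noteq> h \<longrightarrow> s \<notin> K"
          using matching_systemD(2)[OF i hi(1)] by blast
        have "J \<union> K \<in> amalgam Ed \<P> (insert i A)"
          by (rule amalgam_insertI(1)[OF J(1) K(1) matching_systemD(1)[OF i K(1)] insert.hyps(3)]) (use J K h n in blast)
        then have "card (D \<inter> (J \<union> K)) = 1" using insert.prems by blast
        moreover have "h \<in> D \<inter> (J \<union> K)" "h' \<in> D \<inter> (J \<union> K)" "h \<noteq> h'" using h h' J K hi by auto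
        ultimately show False by (metis card_1_singletonE singletonD)
      qed
    qed
    then show ?thesis by blast
  qed
qed

lemma forest_overlap:
  assumes "forest Ed A" "i \<in> A" "j \<in> A" "i \<noteq> j" "a \<in> Ed i \<inter> Ed j" "b \<in> Ed i \<inter> Ed j"
  shows "a = b"
  using assms
proof (induction rule: forest.induct)
  case (insert A k s)
  consider "i \<in> A" "j \<in> A" | "i = k" "j \<in> A" | "i \<in> A" "j = k" using insert.prems by blast
  then show ?case
  proof cases
    case 1 then show ?thesis using insert by blast
  next
    case 2
    then have "a \<in> {s}" "b \<in> {s}" using insert by blast+
    then show ?thesis by simp
  next
    case 3
    then have "a \<in> {s}" "b \<in> {s}" using insert by blast+
    then show ?thesis by simp
  qed
qed simp

section \<open>Weighted Petersen graphs\<close>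

text \<open>For every colour \<open>c < 5\<close> all degrees are \<open>(33 - 4 * c) + 2 * (19 + 2 * c) = 71\<close>. Since \<open>19 + 2 * c\<close> is odd, the edges cannot
  be partitioned into 71 perfect matchings, and since all multiplicities lie between 17 and 33, no two classes of
  parallel edges fit into a third one.\<close>

definition edge_mult :: "nat \<Rightarrow> nat \<Rightarrow> nat" where
  "edge_mult c p = (if 5 \<le> p \<and> p < 10 then 33 - 4 * c else 19 + 2 * c)"

definition atom_edges :: "nat \<Rightarrow> (nat \<times> nat) set" where
  "atom_edges c = (SIGMA p:{..<15}. {..<edge_mult c p})"

definition atom_star :: "nat \<Rightarrow> nat \<Rightarrow> (nat \<times> nat) set" where
  "atom_star c v = (SIGMA p:pet_star v. {..<edge_mult c p})"

definition atom_cycles :: "nat \<Rightarrow> (nat \<times> nat) set set" where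
  "atom_cycles c = {C. C \<subseteq> atom_edges c \<and> (\<forall>v<10. even (card (C \<inter> atom_star c v)))}"

definition lift_matching :: "nat \<Rightarrow> (nat \<Rightarrow> nat) \<Rightarrow> (nat \<times> nat) set" where
  "lift_matching i g = (\<lambda>p. (p, g p)) ` pet_matching i"

definition atom_matchings :: "nat \<Rightarrow> (nat \<times> nat) set set" where
  "atom_matchings c = {lift_matching i g | i g. i < 6 \<and> (\<forall>p\<in>pet_matching i. g p < edge_mult c p)}"

lemma pet_star_subset: "pet_star v \<subseteq> {..<15}" by (auto simp: pet_star_def)

lemma finite_atom_edges [simp]: "finite (atom_edges c)" by (simp add: atom_edges_def)

lemma atom_star_subset: "atom_star c v \<subseteq> atom_edges c"
  using pet_star_subset by (auto simp: atom_edges_def atom_star_def)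

lemma finite_atom_star [simp]: "finite (atom_star c v)"
  using atom_star_subset finite_atom_edges finite_subset by blast

lemma edge_mult_bounds:
  assumes "c < 5" shows "3 \<le> edge_mult c p" "edge_mult c p \<le> 33" "17 \<le> edge_mult c p"
  using assms by (auto simp: edge_mult_def)

lemma sum_edge_mult_star:
  assumes "c < 5" "v < 10" shows "(\<Sum>p\<in>pet_star v. edge_mult c p) = 71"
proof -
  have "\<forall>v<10. (\<Sum>p\<in>pet_star v. edge_mult c p) = 71"
    unfolding all_less_10 using assms(1) by (simp add: pet_star_simps edge_mult_def)
  then show ?thesis using assms by blast
qed

lemma card_atom_star:
  assumes "c < 5" "v < 10" shows "card (atom_star c v) = 71"
proof -
  have "finite (pet_star v)" using pet_star_subset finite_subset by blast
  then show ?thesis using sum_edge_mult_star[OF assms] by (simp add: atom_star_def)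
qed

lemma lift_matching_inter_atom_star:
  assumes "i < 6" "v < 10" "\<forall>p\<in>pet_matching i. g p < edge_mult c p"
  shows "card (lift_matching i g \<inter> atom_star c v) = 1"
proof -
  obtain p where p: "pet_matching i \<inter> pet_star v = {p}" using pet_matching_star assms by blast
  have "lift_matching i g \<inter> atom_star c v = (\<lambda>p. (p, g p)) ` (pet_matching i \<inter> pet_star v)"
    using assms by (auto simp: lift_matching_def atom_star_def)
  then show ?thesis by (simp add: p)
qed

lemma atom_matchings_subset: "K \<in> atom_matchings c \<Longrightarrow> K \<subseteq> atom_edges c"
  using pet_matching_subset by (auto simp: atom_matchings_def lift_matching_def atom_edges_def)

lemma atom_matchings_star: "K \<in> atom_matchings c \<Longrightarrow> v < 10 \<Longrightarrow> card (K \<inter> atom_star c v) = 1"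
  using lift_matching_inter_atom_star by (auto simp: atom_matchings_def)

lemma atom_matchings_compl:
  assumes "c < 5" "K \<in> atom_matchings c" shows "atom_edges c - K \<in> atom_cycles c"
proof -
  have "even (card ((atom_edges c - K) \<inter> atom_star c v))" if "v < 10" for v
  proof -
    have "(atom_edges c - K) \<inter> atom_star c v = atom_star c v - (K \<inter> atom_star c v)" using atom_star_subset by auto
    then have "card ((atom_edges c - K) \<inter> atom_star c v) = card (atom_star c v) - card (K \<inter> atom_star c v)"
      by (simp add: card_Diff_subset)
    then show ?thesis using card_atom_star[OF assms(1) that] atom_matchings_star[OF assms(2) that] by simp
  qed
  then show ?thesis by (auto simp: atom_cycles_def)
qed

lemma fibre_function_exists:
  assumes "finite I" "finite S" "card S = (\<Sum>i\<in>I. n i)"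
  shows "\<exists>l. l ` S \<subseteq> I \<and> (\<forall>i\<in>I. card {t\<in>S. l t = i} = n i)"
  using assms
proof (induction I arbitrary: S rule: finite_induct)
  case (insert j I)
  then obtain X where X: "X \<subseteq> S" "card X = n j"
    by (metis obtain_subset_with_card_n le_add1 sum.insert)
  have finX: "finite X" using X(1) insert.prems(1) finite_subset by blast
  have "card (S - X) = (\<Sum>i\<in>I. n i)"
    using insert.prems(2) insert.hyps X(2) by (simp add: card_Diff_subset[OF finX X(1)])
  then obtain l where l: "l ` (S - X) \<subseteq> I" "\<forall>i\<in>I. card {t\<in>S-X. l t = i} = n i"
    using insert.IH[of "S - X"] insert.prems by auto
  let ?l = "\<lambda>t. if t \<in> X then j else l t"
  have "{t\<in>S. ?l t = j} = X" using X(1) l(1) insert.hyps by auto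
  moreover have "{t\<in>S. ?l t = i} = {t\<in>S-X. l t = i}" if "i \<in> I" for i using that insert.hyps by auto
  ultimately show ?case using l X insert.hyps by (intro exI[of _ ?l]) auto
qed simp

text \<open>The pinned value at \<open>s\<close> is what keeps a prescribed matching, or a
  prescribed parallel copy, at index 0 of a double cover.\<close>

lemma fibre_function:
  assumes "finite I" "finite S" "card S = (\<Sum>i\<in>I. n i)" "j \<in> I" "0 < n j" "s \<in> S"
  obtains l where "l ` S \<subseteq> I" "l s = j" "\<And>i. i \<in> I \<Longrightarrow> card {t\<in>S. l t = i} = n i"
proof -
  have sm: "(\<Sum>i\<in>I. n i) = n j + (\<Sum>i\<in>I-{j}. n i)" using assms by (simp add: sum.remove)
  have "n j - 1 \<le> card (S - {s})" using assms sm by (simp add: card_Diff_singleton_if)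
  then obtain X' where X': "X' \<subseteq> S - {s}" "card X' = n j - 1" by (metis obtain_subset_with_card_n)
  define X where "X = insert s X'"
  have finX': "finite X'" using X' assms(2) finite_subset by (metis finite_Diff)
  have "s \<notin> X'" using X' by blast
  then have X: "X \<subseteq> S" "card X = n j" using X' assms finX' by (auto simp: X_def)
  then have cX: "card (S - X) = (\<Sum>i\<in>I-{j}. n i)"
    using assms sm finX' by (subst card_Diff_subset) (auto simp: X_def)
  obtain l where l: "l ` (S - X) \<subseteq> I - {j}" "\<forall>i\<in>I-{j}. card {t\<in>S-X. l t = i} = n i"
    using fibre_function_exists[OF finite_Diff[OF assms(1)] finite_Diff[OF assms(2)] cX] by blast
  let ?l = "\<lambda>t. if t \<in> X then j else l t"
  have "{t\<in>S. ?l t = j} = X" using X(1) l(1) by auto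
  moreover have "{t\<in>S. ?l t = i} = {t\<in>S-X. l t = i}" if "i \<noteq> j" for i using that by auto
  ultimately have "card {t\<in>S. ?l t = i} = n i" if "i \<in> I" for i
    using that l X by (cases "i = j") auto
  moreover have "?l ` S \<subseteq> I" "?l s = j" using l assms by (auto simp: X_def)
  ultimately show thesis using that by blast
qed

text \<open>Two distributions in succession: first the 142 indices are dealt to the six perfect
  matchings of the Petersen graph, then for each edge \<open>p\<close> the indices using
  \<open>p\<close> are dealt to its parallel copies, two to each.\<close>

lemma atom_matchings_double_cover:
  fixes N :: nat
  assumes N: "N = 142" and c: "c < 5" and K: "K \<in> atom_matchings c"
  shows "\<exists>J. J 0 = K \<and> (\<forall>t<N. J t \<in> atom_matchings c) \<and> (\<forall>h\<in>atom_edges c. card {t. t < N \<and> h \<in> J t} = 2)"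
proof -
  obtain i0 g0 where i0: "i0 < 6" "\<forall>p\<in>pet_matching i0. g0 p < edge_mult c p" "K = lift_matching i0 g0"
    using K by (auto simp: atom_matchings_def)
  \<comment> \<open>Solves \<open>a + b = 2 * (33 - 4 * c)\<close> and
    \<open>2 * b = 2 * (19 + 2 * c)\<close> for the repetitions of matching 0 and of the others. For
    \<open>c < 5\<close> the subtraction is not truncated, and even \<open>a = 47 - 10 * c\<close>
    is positive, so that every matching can be put at index 0.\<close>
  define n :: "nat \<Rightarrow> nat" where "n i = (if i = 0 then 2 * (33 - 4 * c) - (19 + 2 * c) else 19 + 2 * c)" for i
  have "(\<Sum>i<6. n i) = N" using c N by (simp add: n_def eval_nat_numeral)
  then have cn: "card {..<N} = (\<Sum>i\<in>{..<6}. n i)" by simp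
  have ne: "i0 \<in> {..<6}" "0 < n i0" "(0::nat) \<in> {..<N}" using i0(1) c N by (auto simp: n_def)
  obtain l where l: "l ` {..<N} \<subseteq> {..<6}" "l 0 = i0" "\<And>i. i \<in> {..<6} \<Longrightarrow> card {t\<in>{..<N}. l t = i} = n i"
    by (rule fibre_function[OF finite_lessThan finite_lessThan cn ne]) blast
  define S where "S p = {t\<in>{..<N}. p \<in> pet_matching (l t)}" for p
  have cardS: "card (S p) = 2 * edge_mult c p" if p: "p < 15" for p
  proof -
    have "S p = (\<Union>i\<in>{i. i < 6 \<and> p \<in> pet_matching i}. {t\<in>{..<N}. l t = i})"
      using l(1) by (auto simp: S_def)
    then have "card (S p) = (\<Sum>i | i < 6 \<and> p \<in> pet_matching i. card {t\<in>{..<N}. l t = i})"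
      by (simp only:) (rule card_UN_disjoint, auto)
    also have "\<dots> = (\<Sum>i | i < 6 \<and> p \<in> pet_matching i. n i)" by (rule sum.cong) (use l(3) in auto)
    also have "\<dots> = 2 * edge_mult c p"
      unfolding n_def pet_matching_weight[OF p] using c by (auto simp: edge_mult_def)
    finally show ?thesis .
  qed
  \<comment> \<open>The \<open>2 * edge_mult c p\<close> indices in \<open>S p\<close> are to be
    shared evenly by the parallel copies of \<open>p\<close>; at index 0 the copy is dictated by
    \<open>K\<close>.\<close>
  define Q where "Q p g \<longleftrightarrow> g ` S p \<subseteq> {..<edge_mult c p} \<and> (0 \<in> S p \<longrightarrow> g 0 = g0 p) \<and>
    (\<forall>r<edge_mult c p. card {t\<in>S p. g t = r} = 2)" for p g
  have "\<exists>g. Q p g"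
    if p: "p < 15" for p
  proof -
    have cs: "card (S p) = (\<Sum>r\<in>{..<edge_mult c p}. 2)" using cardS[OF p] by simp
    have fin: "finite (S p)" by (simp add: S_def)
    show ?thesis
    proof (cases "0 \<in> S p")
      case True
      then have "p \<in> pet_matching i0" using l(2) by (simp add: S_def)
      then have "g0 p < edge_mult c p" using i0 by blast
      then obtain g where "g ` S p \<subseteq> {..<edge_mult c p}" "g 0 = g0 p" "\<And>r. r \<in> {..<edge_mult c p} \<Longrightarrow> card {t\<in>S p. g t = r} = 2"
        using fibre_function[OF _ fin cs _ _ True, of "g0 p"] by auto
      then show ?thesis unfolding Q_def by blast
    next
      case False
      then show ?thesis using fibre_function_exists[OF _ fin cs] unfolding Q_def by auto
    qed
  qed
  then have "\<forall>p. \<exists>g. p < 15 \<longrightarrow> Q p g" by blast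
  from choice[OF this] obtain g where "\<forall>p. p < 15 \<longrightarrow> Q p (g p)" by blast
  then have g: "g p ` S p \<subseteq> {..<edge_mult c p}" "0 \<in> S p \<Longrightarrow> g p 0 = g0 p"
    "r < edge_mult c p \<Longrightarrow> card {t\<in>S p. g p t = r} = 2" if "p < 15" for p r
    using that unfolding Q_def by blast+
  define J where "J t = lift_matching (l t) (\<lambda>p. g p t)" for t
  have lt: "l t < 6" if "t < N" for t using l(1) that by auto
  have lt15: "p < 15" if "p \<in> pet_matching (l t)" "t < N" for p t using pet_matching_subset[OF lt[OF that(2)]] that by auto
  have "J 0 = K"
    unfolding J_def i0(3) lift_matching_def l(2)
  proof (rule image_cong)
    fix p assume "p \<in> pet_matching i0"
    then have "0 \<in> S p" "p < 15" using l(2) lt15[of p 0] N by (auto simp: S_def)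
    then show "(p, g p 0) = (p, g0 p)" using g(2) by simp
  qed simp
  moreover have "J t \<in> atom_matchings c" if "t < N" for t
  proof -
    have "g p t < edge_mult c p" if "p \<in> pet_matching (l t)" for p
    proof -
      have "t \<in> S p" "p < 15" using that \<open>t < N\<close> lt15 by (auto simp: S_def)
      then show ?thesis using g(1)[of p] by auto
    qed
    then show ?thesis using lt[OF that] unfolding J_def atom_matchings_def by blast
  qed
  moreover have "card {t. t < N \<and> h \<in> J t} = 2" if h: "h \<in> atom_edges c" for h
  proof -
    obtain p r where h: "h = (p, r)" "p < 15" "r < edge_mult c p" using h by (auto simp: atom_edges_def)
    have "{t. t < N \<and> h \<in> J t} = {t\<in>S p. g p t = r}" by (auto simp: h J_def lift_matching_def S_def)
    then show ?thesis using g(3) h by simp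
  qed
  ultimately show ?thesis by (intro exI[of _ J]) simp
qed

lemma matching_system_atom_matchings:
  assumes c: "c < 5" shows "matching_system 142 (atom_edges c) (atom_matchings c)"
  unfolding matching_system_def
proof (intro conjI ballI allI)
  show "K \<subseteq> atom_edges c" if "K \<in> atom_matchings c" for K using atom_matchings_subset[OF that] .
  show "\<exists>J. J 0 = K \<and> (\<forall>t<142::nat. J t \<in> atom_matchings c) \<and> (\<forall>h\<in>atom_edges c. card {t. t < 142 \<and> h \<in> J t} = 2)"
    if "K \<in> atom_matchings c" for K using atom_matchings_double_cover[OF refl c that] .
next
  fix h e :: "nat \<times> nat" assume "h \<in> atom_edges c"
  then obtain p r where h: "h = (p, r)" "p < 15" "r < edge_mult c p" by (auto simp: atom_edges_def)
  obtain q s where e: "e = (q, s)" by force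
  obtain i where i: "i < 6" "p \<in> pet_matching i" using pet_matching_ex h by blast
  \<comment> \<open>Away from \<open>p\<close> the copy is 0 or 1, whichever differs from the copy
    number \<open>s\<close> of \<open>e\<close>; so \<open>e\<close> is missed unless it equals
    \<open>h\<close>.\<close>
  define g where "g p' = (if p' = p then r else if s = 0 then 1 else 0)" for p'
  have "g p' < edge_mult c p'" for p' using h(3) edge_mult_bounds(1)[OF c, of p'] by (simp add: g_def)
  then have "\<forall>p'\<in>pet_matching i. g p' < edge_mult c p'" by blast
  moreover have "h \<in> lift_matching i g" "e \<noteq> h \<longrightarrow> e \<notin> lift_matching i g" using i by (auto simp: h e lift_matching_def g_def split: if_splits)
  ultimately show "\<exists>K\<in>atom_matchings c. h \<in> K \<and> (e \<noteq> h \<longrightarrow> e \<notin> K)" using i unfolding atom_matchings_def by blast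
next
  fix e e' :: "nat \<times> nat"
  \<comment> \<open>Every class has at least three parallel edges, so some copy number differs from
    those of both \<open>e\<close> and \<open>e'\<close>.\<close>
  have "\<not> {..<3} \<subseteq> {snd e, snd e'}"
  proof
    assume "{..<3} \<subseteq> {snd e, snd e'}"
    from card_mono[OF _ this] show False by (simp add: card_insert_if split: if_splits)
  qed
  then obtain r where r: "r < 3" "r \<noteq> snd e" "r \<noteq> snd e'" by blast
  have "r < edge_mult c p" for p using r(1) edge_mult_bounds(1)[OF c, of p] by simp
  then have "lift_matching 0 (\<lambda>_. r) \<in> atom_matchings c"
    unfolding atom_matchings_def by (intro CollectI exI[of _ 0] exI[of _ "\<lambda>_. r"]) auto
  moreover have "e \<notin> lift_matching 0 (\<lambda>_. r)" "e' \<notin> lift_matching 0 (\<lambda>_. r)" using r by (auto simp: lift_matching_def)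
  ultimately show "\<exists>K\<in>atom_matchings c. e \<notin> K \<and> e' \<notin> K" by blast
qed

lemma flexible_atom_cycles:
  assumes c: "c < 5" shows "flexible (atom_edges c) (atom_cycles c)"
  unfolding flexible_def
proof (intro conjI ballI allI)
  show "X \<subseteq> atom_edges c" if "X \<in> atom_cycles c" for X using that by (simp add: atom_cycles_def)
  show "\<exists>X\<in>atom_cycles c. s \<notin> X" for s by (intro bexI[of _ "{}"]) (auto simp: atom_cycles_def)
  show "\<exists>X\<in>atom_cycles c. s \<in> X" if "s \<in> atom_edges c" for s
    using matching_systemD(3)[OF matching_system_atom_matchings[OF c], of s s] atom_matchings_compl[OF c] that by blast
qed

section \<open>Cycle-continuous maps out of a single atom\<close>

definition cc_into :: "nat \<Rightarrow> 'e set \<Rightarrow> 'e set set \<Rightarrow> (nat \<times> nat \<Rightarrow> 'e) \<Rightarrow> bool" where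
  "cc_into c U \<C> f \<longleftrightarrow> f ` atom_edges c \<subseteq> U \<and> (\<forall>C\<in>\<C>. {x \<in> atom_edges c. f x \<in> C} \<in> atom_cycles c)"

lemma cc_star_even:
  assumes "cc_into c U \<C> f" "C \<in> \<C>" "v < 10"
  shows "even (card {x \<in> atom_star c v. f x \<in> C})"
proof -
  have "{x \<in> atom_edges c. f x \<in> C} \<inter> atom_star c v = {x \<in> atom_star c v. f x \<in> C}" using atom_star_subset by auto
  then show ?thesis using assms unfolding cc_into_def atom_cycles_def by fastforce
qed

lemma cc_star_one:
  assumes c: "c < 5" and P: "matching_system 142 U \<P>" and PC: "\<forall>J\<in>\<P>. U - J \<in> \<C>"
    and f: "cc_into c U \<C> f" and v: "v < 10" and J: "J \<in> \<P>"
  shows "card {x \<in> atom_star c v. f x \<in> J} = 1"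
proof -
  have fU: "f x \<in> U" if "x \<in> atom_star c v" for x using f that atom_star_subset unfolding cc_into_def by blast
  have odd: "odd (card {x \<in> atom_star c v. f x \<in> J})" if "J \<in> \<P>" for J
  proof -
    have "{x \<in> atom_star c v. f x \<in> J} = atom_star c v - {x \<in> atom_star c v. f x \<in> U - J}" using fU by auto
    then have "card {x \<in> atom_star c v. f x \<in> J} = 71 - card {x \<in> atom_star c v. f x \<in> U - J}"
      using card_atom_star[OF c v] by (simp add: card_Diff_subset)
    moreover have "card {x \<in> atom_star c v. f x \<in> U - J} \<le> 71"
      using card_mono[OF finite_atom_star, of "{x \<in> atom_star c v. f x \<in> U - J}" c v] card_atom_star[OF c v] by auto
    moreover have "even (card {x \<in> atom_star c v. f x \<in> U - J})" by (rule cc_star_even[OF f bspec[OF PC that] v])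
    ultimately show ?thesis by presburger
  qed
  obtain n where n: "n = (142::nat)" by blast
  obtain Js where Js: "Js 0 = J" "\<forall>t<n. Js t \<in> \<P>" "\<forall>h\<in>U. card {t. t < n \<and> h \<in> Js t} = 2"
    using matching_systemD(4)[OF P[folded n] J] by blast
  define a where "a t = card {x \<in> atom_star c v. f x \<in> Js t}" for t
  have "(\<Sum>t<n. a t) = (\<Sum>t<n. \<Sum>x\<in>atom_star c v. of_bool (f x \<in> Js t))"
    unfolding a_def by (simp add: of_bool_def sum.If_cases Int_def)
  also have "\<dots> = (\<Sum>x\<in>atom_star c v. \<Sum>t<n. of_bool (f x \<in> Js t))" by (rule sum.swap)
  also have "\<dots> = (\<Sum>x\<in>atom_star c v. card {t. t < n \<and> f x \<in> Js t})"
    by (simp add: of_bool_def sum.If_cases Int_def)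
  also have "\<dots> = (\<Sum>x\<in>atom_star c v. 2)" by (rule sum.cong) (use Js(3) fU in auto)
  also have "\<dots> = 142" using card_atom_star[OF c v] by simp
  finally have sm: "(\<Sum>t<n. a t) = 142" .
  have ge: "1 \<le> a t" if "t < n" for t using odd[OF Js(2)[rule_format, OF that]] unfolding a_def
    by (metis odd_pos Suc_leI One_nat_def)
  have "a 0 = 1"
  proof (rule ccontr)
    assume "a 0 \<noteq> 1"
    then have "1 < a 0" using ge[of 0] n by simp
    then have "(\<Sum>t<n. 1) < (\<Sum>t<n. a t)"
      using ge n by (intro sum_strict_mono_ex1) auto
    then show False using sm n by simp
  qed
  then show ?thesis by (simp add: a_def Js(1))
qed

text \<open>If two edges of a star had the same image, a member of \<open>\<P>\<close> through this
  image would pull back to both of them, against \<open>cc_star_one\<close>.\<close>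

lemma cc_star_inj:
  assumes c: "c < 5" and P: "matching_system 142 U \<P>" and PC: "\<forall>J\<in>\<P>. U - J \<in> \<C>"
    and f: "cc_into c U \<C> f" and v: "v < 10"
  shows "inj_on f (atom_star c v)"
proof (rule inj_onI)
  fix x y assume x: "x \<in> atom_star c v" and y: "y \<in> atom_star c v" and eq: "f x = f y"
  have "f x \<in> U" using f x atom_star_subset unfolding cc_into_def by blast
  then obtain J where J: "J \<in> \<P>" "f x \<in> J" using matching_systemD(2)[OF P] by blast
  obtain z where "{x \<in> atom_star c v. f x \<in> J} = {z}"
    using cc_star_one[OF c P PC f v J(1)] by (metis card_1_singletonE)
  moreover have "x \<in> {x \<in> atom_star c v. f x \<in> J}" "y \<in> {x \<in> atom_star c v. f x \<in> J}" using x y J eq by auto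
  ultimately show "x = y" by (metis singletonD)
qed

lemma card_image_inter:
  assumes "inj_on f S" shows "card (f ` S \<inter> J) = card {x \<in> S. f x \<in> J}"
proof -
  have "f ` S \<inter> J = f ` {x \<in> S. f x \<in> J}" by auto
  moreover have "inj_on f {x \<in> S. f x \<in> J}" using assms by (rule inj_on_subset) auto
  ultimately show ?thesis by (simp add: card_image)
qed

text \<open>The nine equations follow a spanning tree rooted at 0; \<open>R\<close> is any vertex
  function invariant along edges.\<close>

lemma pet_nbs_connected:
  assumes "\<And>u v. u < 10 \<Longrightarrow> v \<in> pet_nbs u \<Longrightarrow> R u = R v" "w < 10"
  shows "R w = R 0"
proof -
  have "R 1 = R 0" "R 4 = R 0" "R 5 = R 0" "R 2 = R 1" "R 6 = R 1" "R 3 = R 2" "R 7 = R 2" "R 8 = R 3" "R 9 = R 4"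
    by (rule assms(1); simp add: pet_nbs_simps)+
  then have "\<forall>w<10. R w = R 0" unfolding all_less_10 by simp
  then show ?thesis using assms(2) by blast
qed

text \<open>By \<open>localize_forest\<close> the image of each star lies in one member. Adjacent
  stars share at least two parallel edges, whose images differ by injectivity, while different
  members overlap in at most one edge; hence adjacent stars choose the same member. This is where
  parallel edges are indispensable.\<close>

lemma cc_single_atom:
  assumes c: "c < 5" and A: "forest Ed A"
    and P: "\<And>i. i \<in> A \<Longrightarrow> matching_system 142 (Ed i) (\<P> i)" and PC: "\<And>i K. i \<in> A \<Longrightarrow> K \<in> \<P> i \<Longrightarrow> Ed i - K \<in> \<C> i"
    and f: "cc_into c (\<Union>(Ed ` A)) (amalgam Ed \<C> A) f"
  shows "\<exists>i\<in>A. f ` atom_edges c \<subseteq> Ed i"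
proof -
  let ?U = "\<Union>(Ed ` A)"
  have P': "matching_system 142 ?U (amalgam Ed \<P> A)" by (rule matching_system_forest[OF A P]) auto
  have PC': "\<forall>J\<in>amalgam Ed \<P> A. ?U - J \<in> amalgam Ed \<C> A"
  proof
    fix J assume that: "J \<in> amalgam Ed \<P> A"
    have "(?U - J) \<inter> Ed i = Ed i - (J \<inter> Ed i)" if "i \<in> A" for i using that by blast
    then show "?U - J \<in> amalgam Ed \<C> A" using that PC unfolding amalgam_def by auto
  qed
  note one = cc_star_one[OF c P' PC' f] and inj = cc_star_inj[OF c P' PC' f]
  have "\<exists>i\<in>A. f ` atom_star c v \<subseteq> Ed i" if v: "v < 10" for v
  proof (rule localize_forest[OF A P])
    show "f ` atom_star c v \<subseteq> ?U" using f atom_star_subset unfolding cc_into_def by blast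
    show "card (f ` atom_star c v \<inter> J) = 1" if "J \<in> amalgam Ed \<P> A" for J
      using one[OF v that] card_image_inter[OF inj[OF v]] by simp
  qed auto
  then obtain X where X: "\<And>v. v < 10 \<Longrightarrow> X v \<in> A" "\<And>v. v < 10 \<Longrightarrow> f ` atom_star c v \<subseteq> Ed (X v)" by metis
  have "X u = X v" if u: "u < 10" and v: "v \<in> pet_nbs u" for u v
  proof (rule ccontr)
    assume ne: "X u \<noteq> X v"
    have v10: "v < 10" using pet_nbs_less u v by blast
    have "u \<noteq> v" using pet_nbs_irrefl u v by blast
    then obtain p where p: "pet_star u \<inter> pet_star v = {p}" using pet_nbs_star(1)[OF u v10 _ v] by blast
    have m: "0 < edge_mult c p" "1 < edge_mult c p" using edge_mult_bounds(1)[OF c, of p] by auto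
    have mem: "(p,0) \<in> atom_star c u" "(p,1) \<in> atom_star c u" "(p,0) \<in> atom_star c v" "(p,1) \<in> atom_star c v"
      using p m by (auto simp: atom_star_def)
    then have "f (p,0) \<noteq> f (p,1)" using inj[OF u] by (auto dest: inj_onD)
    moreover have "f (p,0) \<in> Ed (X u) \<inter> Ed (X v)" "f (p,1) \<in> Ed (X u) \<inter> Ed (X v)"
      using mem X(2)[OF u] X(2)[OF v10] by auto
    ultimately show False using forest_overlap[OF A X(1)[OF u] X(1)[OF v10] ne] by blast
  qed
  then have X0: "X w = X 0" if "w < 10" for w using pet_nbs_connected[of X w] that by blast
  have "f x \<in> Ed (X 0)" if x: "x \<in> atom_edges c" for x
  proof -
    obtain p r where pr: "x = (p,r)" "p < 15" "r < edge_mult c p" using x by (auto simp: atom_edges_def)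
    have "p \<in> pet_star (fst (pet_ends p))" using pr by (simp add: pet_star_def incident_def)
    then have "x \<in> atom_star c (fst (pet_ends p))" using pr by (simp add: atom_star_def)
    then show ?thesis using X(2)[OF pet_ends_less(1)[OF pr(2)]] X0[OF pet_ends_less(1)[OF pr(2)]] by auto
  qed
  then have "f ` atom_edges c \<subseteq> Ed (X 0)" by blast
  moreover have "X 0 \<in> A" by (rule X(1)) simp
  ultimately show ?thesis by blast
qed

lemma pet_star_unique_ends:
  assumes "p \<in> pet_star u" "p \<in> pet_star v" "u \<noteq> v" "p \<in> pet_star w" shows "w = u \<or> w = v"
  using assms by (auto simp: pet_star_def incident_def)

lemma pet_star_one_spoke:
  assumes "w < 10" "p \<in> pet_star w" "q \<in> pet_star w" "5 \<le> p" "p < 10" "5 \<le> q" "q < 10" shows "p = q"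
proof -
  have "\<forall>w<10. \<forall>p\<in>pet_star w. \<forall>q\<in>pet_star w. 5 \<le> p \<and> p < 10 \<and> 5 \<le> q \<and> q < 10 \<longrightarrow> p = q"
    unfolding all_less_10 by (simp add: pet_star_simps)
  then show ?thesis using assms by blast
qed

text \<open>The image \<open>D\<close> of the star meets every lifted matching once and every cycle
  evenly. The first property makes \<open>D\<close> a union of complete parallel classes, so that
  \<open>pet_star_char\<close> can be applied to the set \<open>d\<close> of these classes.\<close>

lemma cc_star_to_star:
  assumes c: "c < 5" and c': "c' < 5" and f: "cc_into c (atom_edges c') (atom_cycles c') f" and v: "v < 10"
  shows "\<exists>w<10. f ` atom_star c v = atom_star c' w"
proof -
  define D where "D = f ` atom_star c v"
  have PC: "\<forall>J\<in>atom_matchings c'. atom_edges c' - J \<in> atom_cycles c'" using atom_matchings_compl[OF c'] by blast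
  note one = cc_star_one[OF c matching_system_atom_matchings[OF c'] PC f v]
  note inj = cc_star_inj[OF c matching_system_atom_matchings[OF c'] PC f v]
  have D1: "card (D \<inter> K) = 1" if "K \<in> atom_matchings c'" for K
    unfolding D_def using one[OF that] card_image_inter[OF inj] by simp
  have D2: "even (card (D \<inter> C))" if "C \<in> atom_cycles c'" for C
    unfolding D_def using cc_star_even[OF f that v] card_image_inter[OF inj] by simp
  have DU: "D \<subseteq> atom_edges c'" using f atom_star_subset unfolding D_def cc_into_def by blast
  define d where "d p \<longleftrightarrow> (\<exists>r. (p,r) \<in> D)" for p
  have pos: "0 < edge_mult c' p" for p using edge_mult_bounds(1)[OF c', of p] by simp
  have lift_matching_atom_matchings: "lift_matching i g \<in> atom_matchings c'" if "i < 6" "\<And>p. p \<in> pet_matching i \<Longrightarrow> g p < edge_mult c' p" for i g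
    using that unfolding atom_matchings_def by blast
  have 1: "\<exists>p\<in>pet_matching i. d p" if "i < 6" for i
  proof -
    have "card (D \<inter> lift_matching i (\<lambda>_. 0)) = 1" by (rule D1, rule lift_matching_atom_matchings) (use that pos in auto)
    then have "D \<inter> lift_matching i (\<lambda>_. 0) \<noteq> {}" by (metis card.empty zero_neq_one)
    then show ?thesis by (auto simp: lift_matching_def d_def)
  qed
  have 2: "p = q" if i: "i < 6" "p \<in> pet_matching i" "q \<in> pet_matching i" "d p" "d q" for i p q
  proof (rule ccontr)
    assume ne: "p \<noteq> q"
    obtain r s where rs: "(p,r) \<in> D" "(q,s) \<in> D" using i unfolding d_def by blast
    let ?g = "\<lambda>x. if x = p then r else if x = q then s else 0"
    have "r < edge_mult c' p" "s < edge_mult c' q" using rs DU by (auto simp: atom_edges_def)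
    then have "card (D \<inter> lift_matching i ?g) = 1" using pos i by (intro D1 lift_matching_atom_matchings) auto
    moreover have "(p,r) \<in> D \<inter> lift_matching i ?g" "(q,s) \<in> D \<inter> lift_matching i ?g" using rs i ne by (auto simp: lift_matching_def)
    ultimately show False using ne by (metis card_1_singletonE singletonD prod.inject)
  qed
  \<comment> \<open>A lifted matching through the copy \<open>(p, r)\<close> meets \<open>D\<close>
    somewhere, and by 2 it cannot do so in a class other than \<open>p\<close>.\<close>
  have closed: "(p,r) \<in> D" if p: "p < 15" "d p" "r < edge_mult c' p" for p r
  proof -
    obtain i where i: "i < 6" "p \<in> pet_matching i" using pet_matching_ex p by blast
    let ?g = "\<lambda>x. if x = p then r else 0"
    have "card (D \<inter> lift_matching i ?g) = 1" using pos p i by (intro D1 lift_matching_atom_matchings) auto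
    then have "D \<inter> lift_matching i ?g \<noteq> {}" by (metis card.empty zero_neq_one)
    then obtain q where q: "q \<in> pet_matching i" "(q, ?g q) \<in> D" by (auto simp: lift_matching_def)
    then have "q = p" using 2[OF i(1) q(1) i(2)] p unfolding d_def by blast
    then show ?thesis using q by simp
  qed
  have 3: "even (card {p\<in>Z. d p})" if Z: "Z \<in> set pet_some_cycles" for Z
  proof -
    let ?C = "(\<lambda>p. (p, 0::nat)) ` Z"
    have inj0: "inj_on (\<lambda>p. (p, 0::nat)) S" for S :: "nat set" by (simp add: inj_on_def)
    have "?C \<inter> atom_star c' v = (\<lambda>p. (p, 0)) ` (Z \<inter> pet_star v)" for v using pos by (auto simp: atom_star_def)
    then have "?C \<in> atom_cycles c'" using pet_some_cycles[OF Z] pos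
      by (auto simp: atom_cycles_def atom_edges_def card_image[OF inj0])
    then have "even (card (D \<inter> ?C))" by (rule D2)
    moreover have "D \<inter> ?C = (\<lambda>p. (p, 0)) ` {p\<in>Z. d p}"
      using closed pos pet_some_cycles(1)[OF Z] by (auto simp: d_def)
    ultimately show ?thesis by (simp add: card_image[OF inj0])
  qed
  have "\<exists>w<10. \<forall>p<15. d p \<longleftrightarrow> p \<in> pet_star w"
    by (rule pet_star_char) (erule 1, rule 2, assumption+, erule 3)
  then obtain w where w: "w < 10" "\<forall>p<15. d p \<longleftrightarrow> p \<in> pet_star w" by blast
  have "D = atom_star c' w"
  proof (intro set_eqI iffI)
    fix x assume x: "x \<in> D"
    then obtain p r where "x = (p,r)" "p < 15" "r < edge_mult c' p" using DU by (auto simp: atom_edges_def)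
    then show "x \<in> atom_star c' w" using w x unfolding d_def atom_star_def by blast
  next
    fix x assume "x \<in> atom_star c' w"
    then obtain p r where "x = (p,r)" "p \<in> pet_star w" "r < edge_mult c' p" by (auto simp: atom_star_def)
    then show "x \<in> D" using closed w pet_star_subset[of w] by auto
  qed
  then show ?thesis using w D_def by blast
qed

text \<open>For adjacent \<open>w, w'\<close> the preimage of an edge \<open>ww'\<close> is a matching that covers exactly the fibres of \<open>w\<close> and \<open>w'\<close>, so all
  fibres of \<open>\<phi>\<close> have the same parity. If they are odd, \<open>\<phi>\<close> is bijective and multiplicities agree. If they are even, \<open>\<phi>\<close> is
  constant, which would partition the edges into 71 perfect matchings.\<close>

lemma cc_same_colour:
  assumes c: "c < 5" and c': "c' < 5" and f: "cc_into c (atom_edges c') (atom_cycles c') f"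
  shows "c = c'"
proof -
  have PC: "\<forall>J\<in>atom_matchings c'. atom_edges c' - J \<in> atom_cycles c'" using atom_matchings_compl[OF c'] by blast
  note inj = cc_star_inj[OF c matching_system_atom_matchings[OF c'] PC f]
  have fibre1: "{z \<in> atom_star c v. f z = h} = {y}" if "v < 10" "y \<in> atom_star c v" "f y = h" for v y h
    using inj_onD[OF inj[OF that(1)]] that by blast
  have "\<forall>v. \<exists>w. v < 10 \<longrightarrow> w < 10 \<and> f ` atom_star c v = atom_star c' w" using cc_star_to_star[OF c c' f] by blast
  from choice[OF this] obtain \<phi> where phi: "\<And>v. v < 10 \<Longrightarrow> \<phi> v < 10" "\<And>v. v < 10 \<Longrightarrow> f ` atom_star c v = atom_star c' (\<phi> v)"
    by blast
  have pos: "0 < edge_mult c p" "0 < edge_mult c' p" for p using edge_mult_bounds(1)[OF c, of p] edge_mult_bounds(1)[OF c', of p] by auto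
  have class_map: "f ` ({p} \<times> {..<edge_mult c p}) \<subseteq> {q} \<times> {..<edge_mult c' q}"
    if "u < 10" "v < 10" "p \<in> pet_star u \<inter> pet_star v" "pet_star (\<phi> u) \<inter> pet_star (\<phi> v) \<subseteq> {q}" for u v p q
  proof -
    have "f ` ({p} \<times> {..<edge_mult c p}) \<subseteq> f ` atom_star c u \<inter> f ` atom_star c v"
      using that by (auto simp: atom_star_def)
    also have "\<dots> = atom_star c' (\<phi> u) \<inter> atom_star c' (\<phi> v)" using phi that by simp
    also have "\<dots> \<subseteq> {q} \<times> {..<edge_mult c' q}" using that(4) by (auto simp: atom_star_def)
    finally show ?thesis .
  qed
  have edge: "\<exists>p. p < 15 \<and> pet_star u \<inter> pet_star v = {p}" if u: "u < 10" "v \<in> pet_nbs u" for u v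
  proof -
    have "u \<noteq> v" using u pet_nbs_irrefl by blast
    then obtain p where "pet_star u \<inter> pet_star v = {p}" using pet_nbs_star(1)[OF u(1) pet_nbs_less[OF u]] u by blast
    then show ?thesis using pet_star_subset[of u] by auto
  qed
  have hom: "\<phi> u = \<phi> v \<or> \<phi> v \<in> pet_nbs (\<phi> u)" if u: "u < 10" "v \<in> pet_nbs u" for u v
  proof (rule ccontr)
    assume n: "\<not> ?thesis"
    have v: "v < 10" using pet_nbs_less u by blast
    obtain p where p: "pet_star u \<inter> pet_star v = {p}" using edge u by blast
    have e: "pet_star (\<phi> u) \<inter> pet_star (\<phi> v) = {}" using pet_nbs_star(2)[OF phi(1)[OF u(1)] phi(1)[OF v]] n by blast
    \<comment> \<open>Disjointness of the two target stars makes \<open>class_map\<close> applicable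
      with every \<open>q\<close>, which puts one image into two different parallel classes.\<close>
    have "f ` ({p} \<times> {..<edge_mult c p}) \<subseteq> {q} \<times> {..<edge_mult c' q}" for q using class_map[OF u(1) v, of p q] p e by blast
    then have "f (p,0) \<in> {0} \<times> {..<edge_mult c' 0}" "f (p,0) \<in> {1} \<times> {..<edge_mult c' 1}" using pos(1)[of p] by blast+
    then show False by auto
  qed
  have li: "\<phi> u = \<phi> v" if u: "u < 10" "v \<in> pet_nbs u" "w \<in> pet_nbs u" "v \<noteq> w" "\<phi> v = \<phi> w" for u v w
  proof (rule ccontr)
    assume ne: "\<phi> u \<noteq> \<phi> v"
    have vw: "v < 10" "w < 10" using pet_nbs_less u by blast+
    have uvw: "u \<noteq> v" "u \<noteq> w" using pet_nbs_irrefl u by blast+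
    obtain p where p: "pet_star u \<inter> pet_star v = {p}" using edge u by blast
    obtain p' where p': "pet_star u \<inter> pet_star w = {p'}" using edge u by blast
    have pp': "p \<noteq> p'" using pet_star_unique_ends[of p u v w] p p' uvw u by blast
    obtain q where q: "pet_star (\<phi> u) \<inter> pet_star (\<phi> v) = {q}" using hom[OF u(1,2)] edge[OF phi(1)[OF u(1)]] ne by blast
    let ?S = "{p} \<times> {..<edge_mult c p} \<union> {p'} \<times> {..<edge_mult c p'}"
    have "f ` ?S \<subseteq> {q} \<times> {..<edge_mult c' q}"
      using class_map[OF u(1) vw(1), of p q] class_map[OF u(1) vw(2), of p' q] p p' q u(5) by auto
    then have "card (f ` ?S) \<le> card ({q} \<times> {..<edge_mult c' q})" by (rule card_mono[rotated]) simp
    moreover have "?S \<subseteq> atom_star c u" using p p' by (auto simp: atom_star_def)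
    then have "card (f ` ?S) = card ?S" using inj_on_subset[OF inj[OF u(1)]] card_image by blast
    moreover have "card ?S = edge_mult c p + edge_mult c p'" using pp' by (subst card_Un_disjoint) auto
    ultimately have "edge_mult c p + edge_mult c p' \<le> edge_mult c' q" by simp
    then show False using edge_mult_bounds(3)[OF c, of p] edge_mult_bounds(3)[OF c, of p'] edge_mult_bounds(2)[OF c', of q] by simp
  qed
  let ?k = "\<lambda>w. card {v. v < 10 \<and> \<phi> v = w}"
  have parity: "even (?k w) \<longleftrightarrow> even (?k w')" if w: "w < 10" "w' \<in> pet_nbs w" for w w'
  proof -
    obtain q where q: "q < 15" "pet_star w \<inter> pet_star w' = {q}" using edge w by blast
    have ww': "w \<noteq> w'" using pet_nbs_irrefl w by blast
    define F where "F = {x \<in> atom_edges c. f x = (q, 0)}"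
    have finF: "finite F" by (simp add: F_def)
    have "card {v. v < 10 \<and> x \<in> atom_star c v} = 2" if xF: "x \<in> F" for x
    proof -
      obtain p r where x: "x = (p,r)" "p < 15" "r < edge_mult c p" using xF by (auto simp: F_def atom_edges_def)
      have "{v. v < 10 \<and> x \<in> atom_star c v} = {fst (pet_ends p), snd (pet_ends p)}"
        using x pet_ends_less[OF x(2)] by (auto simp: atom_star_def pet_star_def incident_def)
      then show ?thesis using pet_ends_less(3)[OF x(2)] by simp
    qed
    then have "2 * card F = (\<Sum>x\<in>F. card {v. v < 10 \<and> x \<in> atom_star c v})" by simp
    also have "\<dots> = (\<Sum>x\<in>F. \<Sum>v\<in>{v. v < 10}. of_bool (x \<in> atom_star c v))"
      by (simp add: of_bool_def sum.If_cases Int_def)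
    also have "\<dots> = (\<Sum>v\<in>{v. v < 10}. \<Sum>x\<in>F. of_bool (x \<in> atom_star c v))" by (rule sum.swap)
    also have "\<dots> = (\<Sum>v\<in>{v. v < 10}. card {x \<in> F. x \<in> atom_star c v})"
      using finF by (simp add: of_bool_def sum.If_cases Int_def)
    also have "\<dots> = (\<Sum>v\<in>{v. v < 10}. of_bool (\<phi> v = w \<or> \<phi> v = w'))"
    proof (rule sum.cong)
      fix v :: nat assume "v \<in> {v. v < 10}"
      then have v: "v < 10" by simp
      have "{x \<in> F. x \<in> atom_star c v} = {x \<in> atom_star c v. f x = (q,0)}" using atom_star_subset by (auto simp: F_def)
      moreover have "card {x \<in> atom_star c v. f x = (q,0)} = of_bool (\<phi> v = w \<or> \<phi> v = w')"
      proof (cases "\<phi> v = w \<or> \<phi> v = w'")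
        case True
        then have "q \<in> pet_star (\<phi> v)" using q by auto
        then have "(q,0) \<in> f ` atom_star c v" using phi(2)[OF v] pos by (auto simp: atom_star_def)
        then obtain x where "x \<in> atom_star c v" "f x = (q,0)" by force
          then have "{x \<in> atom_star c v. f x = (q,0)} = {x}" using fibre1[OF v] by blast
        then show ?thesis using True by simp
      next
        case False
        have "q \<notin> pet_star (\<phi> v)" using pet_star_unique_ends[of q w w' "\<phi> v"] q ww' False by auto
        then have "(q,0) \<notin> f ` atom_star c v" using phi(2)[OF v] by (auto simp: atom_star_def)
        then have "{x \<in> atom_star c v. f x = (q,0)} = {}" by force
        then show ?thesis using False by simp
      qed
      ultimately show "card {x \<in> F. x \<in> atom_star c v} = of_bool (\<phi> v = w \<or> \<phi> v = w')" by simp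
    qed simp
    also have "\<dots> = card {v. v < 10 \<and> (\<phi> v = w \<or> \<phi> v = w')}"
      by (simp add: of_bool_def sum.If_cases Int_def)
    also have "{v. v < 10 \<and> (\<phi> v = w \<or> \<phi> v = w')} = {v. v < 10 \<and> \<phi> v = w} \<union> {v. v < 10 \<and> \<phi> v = w'}" by auto
    also have "card \<dots> = ?k w + ?k w'" by (rule card_Un_disjoint) (use ww' in auto)
    finally have "?k w + ?k w' = 2 * card F" by simp
    then show ?thesis by presburger
  qed
  have same: "even (?k w) \<longleftrightarrow> even (?k 0)" if "w < 10" for w
    using pet_nbs_connected[of "\<lambda>w. even (?k w)", OF parity that] .
  show ?thesis
  proof (cases "even (?k 0)")
    case True
    have const0: "\<phi> (fst (pet_ends p)) = \<phi> (snd (pet_ends p))" if "p < 15" for p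
    proof (rule even_fibres_const[of \<phi>])
      show "\<phi> v < 10" if "v < 10" for v using phi(1)[OF that] .
      show "\<phi> u = \<phi> v \<or> \<phi> v \<in> pet_nbs (\<phi> u)" if "u < 10" "v \<in> pet_nbs u" for u v using hom[OF that] .
      show "\<phi> u = \<phi> v" if "u < 10" "v \<in> pet_nbs u" "w \<in> pet_nbs u" "v \<noteq> w" "\<phi> v = \<phi> w" for u v w using li[OF that] .
      show "even (?k w)" if "w < 10" for w using same[OF that] True by simp
      show "p < 15" using that .
    qed
    have "\<phi> u = \<phi> v" if u: "u < 10" "v \<in> pet_nbs u" for u v
    proof -
      obtain p where p: "p < 15" "pet_star u \<inter> pet_star v = {p}" using edge u by blast
      have "u \<noteq> v" using pet_nbs_irrefl u by blast
      moreover have "p \<in> pet_star u" "p \<in> pet_star v" using p(2) by blast+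
      then have "u \<in> {fst (pet_ends p), snd (pet_ends p)}" "v \<in> {fst (pet_ends p), snd (pet_ends p)}" by (simp_all add: pet_star_def incident_def)
      ultimately have "{u, v} = {fst (pet_ends p), snd (pet_ends p)}" by blast
      then have "u = fst (pet_ends p) \<and> v = snd (pet_ends p) \<or> u = snd (pet_ends p) \<and> v = fst (pet_ends p)"
        by (simp only: doubleton_eq_iff)
      then show ?thesis using const0[OF p(1)] by metis
    qed
    then have const: "\<phi> v = \<phi> 0" if "v < 10" for v using pet_nbs_connected[of \<phi>] that by blast
    \<comment> \<open>As all stars have the same image star, each edge \<open>h\<close> of it has
      exactly one preimage in every star. Its preimage is a perfect matching, with
      \<open>x h p\<close> edges in class \<open>p\<close>.\<close>
    define x where "x h p = card {r. r < edge_mult c p \<and> f (p,r) = h}" for h p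
    have ev: "even (x h 3 + x h 12 + x h 13)" if h: "h \<in> atom_star c' (\<phi> 0)" for h
    proof (rule pet_matching_parity)
      fix v :: nat assume v: "v < 10"
      have "h \<in> f ` atom_star c v" using phi(2)[OF v] const[OF v] h by simp
      then obtain y where "y \<in> atom_star c v" "f y = h" by blast
      then have "{y \<in> atom_star c v. f y = h} = {y}" using fibre1[OF v] by blast
      then have "card {y \<in> atom_star c v. f y = h} = 1" by simp
      moreover have "{y \<in> atom_star c v. f y = h} = (SIGMA p:pet_star v. {r. r < edge_mult c p \<and> f (p,r) = h})"
        by (auto simp: atom_star_def)
      moreover have "finite (pet_star v)" using pet_star_subset finite_subset by blast
      ultimately show "(\<Sum>p\<in>pet_star v. x h p) = 1" unfolding x_def by simp
    qed
    have sm: "(\<Sum>h\<in>atom_star c' (\<phi> 0). x h p) = edge_mult c p" if p: "p < 15" for p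
    proof -
      have v: "fst (pet_ends p) < 10" using pet_ends_less[OF p] by simp
      have ps: "p \<in> pet_star (fst (pet_ends p))" using p by (simp add: pet_star_def incident_def)
      have "f (p,r) \<in> atom_star c' (\<phi> 0)" if "r < edge_mult c p" for r
      proof -
        have "(p,r) \<in> atom_star c (fst (pet_ends p))" using ps that by (simp add: atom_star_def)
        then have "f (p,r) \<in> f ` atom_star c (fst (pet_ends p))" by (rule imageI)
        then show ?thesis using phi(2)[OF v] const[OF v] by simp
      qed
      then have "{..<edge_mult c p} = (\<Union>h\<in>atom_star c' (\<phi> 0). {r. r < edge_mult c p \<and> f (p,r) = h})" by auto
      then have "card {..<edge_mult c p} = card (\<Union>h\<in>atom_star c' (\<phi> 0). {r. r < edge_mult c p \<and> f (p,r) = h})" by (rule arg_cong)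
      also have "\<dots> = (\<Sum>h\<in>atom_star c' (\<phi> 0). x h p)"
        unfolding x_def by (rule card_UN_disjoint) auto
      finally show ?thesis by simp
    qed
    \<comment> \<open>Summation over \<open>h\<close> exhausts the classes 3, 12 and 13. None of
      them is a spoke, so they have \<open>57 + 6 * c\<close> edges together, an odd number.\<close>
    have "edge_mult c 3 + edge_mult c 12 + edge_mult c 13 = (\<Sum>h\<in>atom_star c' (\<phi> 0). x h 3 + x h 12 + x h 13)"
      using sm[of 3] sm[of 12] sm[of 13] by (simp add: sum.distrib)
    also have "even \<dots>" by (rule dvd_sum) (rule ev)
    finally have "even (57 + 6 * c)" by (simp add: edge_mult_def)
    then have False by presburger
    then show ?thesis ..
  next
    case False
    have "\<exists>v. v < 10 \<and> \<phi> v = w" if "w < 10" for w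
    proof (rule ccontr)
      assume "\<not> ?thesis"
      then have "{v. v < 10 \<and> \<phi> v = w} = {}" by blast
      then show False using same[OF that] False by (metis card.empty even_zero)
    qed
    then have "\<phi> ` {..<10} = {..<10}" using phi(1) by auto
    then have injphi: "inj_on \<phi> {..<10}" by (intro eq_card_imp_inj_on) auto
    \<comment> \<open>The three classes at vertex 0 inject into three different classes at
      \<open>\<phi> 0\<close>; both triples have 71 edges, so all three inequalities become
      equalities.\<close>
    have q: "\<exists>q. pet_star (\<phi> 0) \<inter> pet_star (\<phi> v) = {q} \<and> edge_mult c p \<le> edge_mult c' q" if v: "v \<in> pet_nbs 0" "p \<in> pet_star 0 \<inter> pet_star v" for v p
    proof -
      have v10: "v < 10" using pet_nbs_less[of 0] v by simp
      have "v \<noteq> 0" using pet_nbs_irrefl[of 0] v by (metis zero_less_numeral)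
      then have ne: "\<phi> 0 \<noteq> \<phi> v" using inj_onD[OF injphi, of 0 v] v10 by auto
      obtain q where q: "pet_star (\<phi> 0) \<inter> pet_star (\<phi> v) = {q}" using hom[of 0 v] v ne edge[of "\<phi> 0"] phi(1)[of 0] by auto
      have sub: "f ` ({p} \<times> {..<edge_mult c p}) \<subseteq> {q} \<times> {..<edge_mult c' q}"
        using class_map[of 0 v p q] v10 v q by auto
      have "inj_on f ({p} \<times> {..<edge_mult c p})"
        by (rule inj_on_subset[OF inj[of 0]]) (use v in \<open>auto simp: atom_star_def\<close>)
      then have "card ({p} \<times> {..<edge_mult c p}) \<le> card ({q} \<times> {..<edge_mult c' q})"
        by (rule card_inj_on_le) (use sub in auto)
      then show ?thesis using q by auto
    qed
    obtain q5 where q5: "pet_star (\<phi> 0) \<inter> pet_star (\<phi> 5) = {q5}" "edge_mult c 5 \<le> edge_mult c' q5"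
      using q[of 5 5] by (auto simp: pet_nbs_simps pet_star_simps)
    obtain q1 where q1: "pet_star (\<phi> 0) \<inter> pet_star (\<phi> 1) = {q1}" "edge_mult c 0 \<le> edge_mult c' q1"
      using q[of 1 0] by (auto simp: pet_nbs_simps pet_star_simps)
    obtain q4 where q4: "pet_star (\<phi> 0) \<inter> pet_star (\<phi> 4) = {q4}" "edge_mult c 4 \<le> edge_mult c' q4"
      using q[of 4 4] by (auto simp: pet_nbs_simps pet_star_simps)
    have phine: "\<phi> 0 \<noteq> \<phi> 5" "\<phi> 0 \<noteq> \<phi> 1" "\<phi> 0 \<noteq> \<phi> 4" "\<phi> 1 \<noteq> \<phi> 5" "\<phi> 1 \<noteq> \<phi> 4" "\<phi> 4 \<noteq> \<phi> 5"
      using inj_on_eq_iff[OF injphi] by simp_all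
    have m: "q1 \<in> pet_star (\<phi> 0)" "q1 \<in> pet_star (\<phi> 1)" "q4 \<in> pet_star (\<phi> 0)" "q4 \<in> pet_star (\<phi> 4)" "q5 \<in> pet_star (\<phi> 0)" "q5 \<in> pet_star (\<phi> 5)"
      using q1(1) q4(1) q5(1) by blast+
    have qne: "q1 \<noteq> q5" "q1 \<noteq> q4" "q4 \<noteq> q5"
      using pet_star_unique_ends[OF m(1,2) phine(2), of "\<phi> 5"] pet_star_unique_ends[OF m(1,2) phine(2), of "\<phi> 4"]
        pet_star_unique_ends[OF m(3,4) phine(3), of "\<phi> 5"] m phine by metis+
    have "(\<Sum>q\<in>{q1,q4,q5}. edge_mult c' q) \<le> (\<Sum>q\<in>pet_star (\<phi> 0). edge_mult c' q)"
      by (rule sum_mono2) (use m finite_subset[OF pet_star_subset] in auto)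
    then have le: "edge_mult c' q1 + edge_mult c' q4 + edge_mult c' q5 \<le> 71"
      using sum_edge_mult_star[OF c' phi(1)[of 0]] qne by simp
    have eq71: "edge_mult c 0 + edge_mult c 4 + edge_mult c 5 = 71"
      using sum_edge_mult_star[OF c, of 0] by (simp add: pet_star_simps)
    have eq: "edge_mult c 0 = edge_mult c' q1" "edge_mult c 4 = edge_mult c' q4" using le eq71 q1(2) q4(2) q5(2) by linarith+
    \<comment> \<open>The edges 0 and 4 are not spokes, and at most one of their images is. The
      other image has multiplicity \<open>19 + 2 * c'\<close>, which must equal
      \<open>19 + 2 * c\<close>.\<close>
    have "\<not> (5 \<le> q1 \<and> q1 < 10 \<and> 5 \<le> q4 \<and> q4 < 10)"
      using pet_star_one_spoke[of "\<phi> 0" q1 q4] qne q1(1) q4(1) phi(1)[of 0] by auto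
    then show ?thesis using eq by (auto simp: edge_mult_def split: if_splits)
  qed
qed

section \<open>Placed atoms\<close>

type_synonym atom = "(nat \<times> nat) \<times> (nat \<times> nat \<times> nat) \<times> nat"

type_synonym ename = "(nat \<times> nat) + (nat \<times> nat \<times> nat) + atom \<times> nat \<times> nat"

definition y_node :: "atom \<Rightarrow> nat \<times> nat" where "y_node i = fst i"
definition u_node :: "atom \<Rightarrow> nat \<times> nat \<times> nat" where "u_node i = fst (snd i)"
definition colour :: "atom \<Rightarrow> nat" where "colour i = snd (snd i)"

text \<open>An atom \<open>(y, u, c)\<close> is a copy of the weighted Petersen graph of colour \<open>c\<close> whose edges \<open>(0, 0)\<close> and \<open>(1, 0)\<close> are
  shared with all other atoms with the same \<open>y\<close> and the same \<open>u\<close>, respectively.\<close>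

definition edge_name :: "atom \<Rightarrow> nat \<times> nat \<Rightarrow> ename" where
  "edge_name i x = (if x = (0,0) then Inl (y_node i) else if x = (1,0) then Inr (Inl (u_node i)) else Inr (Inr (i, x)))"

definition placed_edges :: "atom \<Rightarrow> ename set" where "placed_edges i = edge_name i ` atom_edges (colour i)"
definition placed_cycles :: "atom \<Rightarrow> ename set set" where "placed_cycles i = (`) (edge_name i) ` atom_cycles (colour i)"
definition placed_matchings :: "atom \<Rightarrow> ename set set" where "placed_matchings i = (`) (edge_name i) ` atom_matchings (colour i)"

abbreviation sys_edges :: "atom set \<Rightarrow> ename set" where "sys_edges A \<equiv> \<Union>(placed_edges ` A)"
abbreviation sys_cycles :: "atom set \<Rightarrow> ename set set" where "sys_cycles A \<equiv> amalgam placed_edges placed_cycles A"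

definition sys_cc :: "atom set \<Rightarrow> atom set \<Rightarrow> (ename \<Rightarrow> ename) \<Rightarrow> bool" where
  "sys_cc A B f \<longleftrightarrow> f ` sys_edges A \<subseteq> sys_edges B \<and> (\<forall>C\<in>sys_cycles B. {x \<in> sys_edges A. f x \<in> C} \<in> sys_cycles A)"

lemma inj_edge_name: "inj (edge_name i)"
  by (auto simp: inj_def edge_name_def split: if_splits)

lemma edge_name_eq_iff [simp]: "edge_name i x = edge_name i y \<longleftrightarrow> x = y"
  using inj_edge_name by (simp add: inj_eq)

lemma matching_system_image:
  assumes g: "inj g" and P: "matching_system n E \<P>" shows "matching_system n (g ` E) ((`) g ` \<P>)"
  unfolding matching_system_def
proof (intro conjI ballI allI)
  show "K \<subseteq> g ` E" if "K \<in> (`) g ` \<P>" for K using that matching_systemD(1)[OF P] by blast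
next
  fix h e assume "h \<in> g ` E"
  then obtain h' where h: "h = g h'" "h' \<in> E" by blast
  show "\<exists>K\<in>(`) g ` \<P>. h \<in> K \<and> (e \<noteq> h \<longrightarrow> e \<notin> K)"
  proof (cases "e \<in> range g")
    case True
    then obtain e' where e: "e = g e'" by blast
    obtain K where "K \<in> \<P>" "h' \<in> K" "e' \<noteq> h' \<longrightarrow> e' \<notin> K" using matching_systemD(2)[OF P h(2)] by blast
    then show ?thesis using h e inj_image_mem_iff[OF g] by auto
  next
    case False
    obtain K where "K \<in> \<P>" "h' \<in> K" using matching_systemD(2)[OF P h(2)] by blast
    then show ?thesis using False h by auto
  qed
next
  fix e e'
  obtain a b where ab: "e \<in> range g \<longrightarrow> e = g a" "e' \<in> range g \<longrightarrow> e' = g b" by blast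
  obtain K where K: "K \<in> \<P>" "a \<notin> K" "b \<notin> K" using matching_systemD(3)[OF P] by blast
  then have "e \<notin> g ` K" "e' \<notin> g ` K" using ab injD[OF g] by blast+
  then show "\<exists>K\<in>(`) g ` \<P>. e \<notin> K \<and> e' \<notin> K" using K by blast
next
  fix K assume "K \<in> (`) g ` \<P>"
  then obtain K' where K': "K = g ` K'" "K' \<in> \<P>" by blast
  obtain J where J: "J 0 = K'" "\<forall>t<n. J t \<in> \<P>" "\<forall>h\<in>E. card {t. t < n \<and> h \<in> J t} = 2"
    using matching_systemD(4)[OF P K'(2)] by blast
  show "\<exists>J. J 0 = K \<and> (\<forall>t<n. J t \<in> (`) g ` \<P>) \<and> (\<forall>h\<in>g ` E. card {t. t < n \<and> h \<in> J t} = 2)"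
    by (rule exI[of _ "\<lambda>t. g ` J t"]) (use J K' inj_image_mem_iff[OF g] in auto)
qed

lemma flexible_image:
  assumes g: "inj g" and P: "flexible E \<X>" shows "flexible (g ` E) ((`) g ` \<X>)"
proof -
  have "\<exists>X\<in>(`) g ` \<X>. s \<notin> X" for s
  proof (cases "s \<in> range g")
    case True
    then obtain s' where s: "s = g s'" by blast
    obtain X where "X \<in> \<X>" "s' \<notin> X" using P unfolding flexible_def by blast
    then show ?thesis using s inj_image_mem_iff[OF g] by auto
  next
    case False
    obtain X where "X \<in> \<X>" using P unfolding flexible_def by blast
    then show ?thesis using False by auto
  qed
  moreover have "\<exists>X\<in>(`) g ` \<X>. s \<in> X" if s: "s \<in> g ` E" for s
  proof -
    obtain s' where s': "s = g s'" "s' \<in> E" using s by blast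
    then obtain X where "X \<in> \<X>" "s' \<in> X" using P unfolding flexible_def by blast
    then show ?thesis using s' by blast
  qed
  moreover have "X \<subseteq> g ` E" if "X \<in> (`) g ` \<X>" for X using that P unfolding flexible_def by blast
  ultimately show ?thesis unfolding flexible_def by blast
qed

lemma matching_system_placed: "colour i < 5 \<Longrightarrow> matching_system 142 (placed_edges i) (placed_matchings i)"
  unfolding placed_edges_def placed_matchings_def by (intro matching_system_image inj_edge_name matching_system_atom_matchings)

lemma flexible_placed_cycles: "colour i < 5 \<Longrightarrow> flexible (placed_edges i) (placed_cycles i)"
  unfolding placed_edges_def placed_cycles_def by (intro flexible_image inj_edge_name flexible_atom_cycles)

lemma placed_matchings_compl:
  assumes "colour i < 5" "K \<in> placed_matchings i" shows "placed_edges i - K \<in> placed_cycles i"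
proof -
  obtain K' where K: "K = edge_name i ` K'" "K' \<in> atom_matchings (colour i)" using assms by (auto simp: placed_matchings_def)
  then have "placed_edges i - K = edge_name i ` (atom_edges (colour i) - K')" by (simp add: placed_edges_def image_set_diff[OF inj_edge_name])
  then show ?thesis using atom_matchings_compl[OF assms(1) K(2)] by (simp add: placed_cycles_def)
qed

text \<open>Restricted to the atom \<open>i\<close>, the map lands in one atom \<open>j\<close> by
  \<open>cc_single_atom\<close>. It is continuous into \<open>j\<close> alone because each cycle of
  \<open>j\<close> extends to the whole amalgam; then \<open>cc_same_colour\<close> compares the
  colours.\<close>

lemma sys_cc_atom:
  assumes B: "forest placed_edges B" "\<forall>j\<in>B. colour j < 5" and f: "sys_cc A B f" and i: "i \<in> A" "colour i < 5"
  shows "\<exists>j\<in>B. colour j = colour i \<and> f ` placed_edges i \<subseteq> placed_edges j"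
proof -
  define g where "g = f \<circ> edge_name i"
  have g: "cc_into (colour i) (sys_edges B) (sys_cycles B) g"
    unfolding cc_into_def
  proof (intro conjI ballI)
    have "f ` placed_edges i \<subseteq> sys_edges B" using f i unfolding sys_cc_def by blast
    then show "g ` atom_edges (colour i) \<subseteq> sys_edges B" unfolding g_def placed_edges_def by (simp add: image_comp)
    fix C assume "C \<in> sys_cycles B"
    then have "{x \<in> sys_edges A. f x \<in> C} \<in> sys_cycles A" using f unfolding sys_cc_def by blast
    then have "{x \<in> sys_edges A. f x \<in> C} \<inter> placed_edges i \<in> placed_cycles i" using i unfolding amalgam_def by blast
    then obtain X where X: "{x \<in> sys_edges A. f x \<in> C} \<inter> placed_edges i = edge_name i ` X" "X \<in> atom_cycles (colour i)" by (auto simp: placed_cycles_def)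
    have "{x \<in> sys_edges A. f x \<in> C} \<inter> placed_edges i = edge_name i ` {x \<in> atom_edges (colour i). g x \<in> C}"
      using i by (auto simp: placed_edges_def g_def)
    from this[symmetric] X(1) have "edge_name i ` {x \<in> atom_edges (colour i). g x \<in> C} = edge_name i ` X" by (rule trans)
    then have "{x \<in> atom_edges (colour i). g x \<in> C} = X" by (simp only: inj_image_eq_iff[OF inj_edge_name])
    then show "{x \<in> atom_edges (colour i). g x \<in> C} \<in> atom_cycles (colour i)" using X by simp
  qed
  have "\<exists>j\<in>B. g ` atom_edges (colour i) \<subseteq> placed_edges j"
    by (rule cc_single_atom[OF i(2) B(1) _ _ g, of placed_matchings]) (use B matching_system_placed placed_matchings_compl in auto)
  then obtain j where j: "j \<in> B" "g ` atom_edges (colour i) \<subseteq> placed_edges j" by blast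
  have cj: "colour j < 5" using B j by blast
  define h where "h = inv (edge_name j) \<circ> g"
  have nh: "edge_name j (h x) = g x" if "x \<in> atom_edges (colour i)" for x
  proof -
    have "g x \<in> range (edge_name j)" using j(2) that by (auto simp: placed_edges_def)
    then show ?thesis by (simp add: h_def f_inv_into_f)
  qed
  have "cc_into (colour i) (atom_edges (colour j)) (atom_cycles (colour j)) h"
    unfolding cc_into_def
  proof (intro conjI ballI)
    show "h ` atom_edges (colour i) \<subseteq> atom_edges (colour j)"
    proof
      fix y assume "y \<in> h ` atom_edges (colour i)"
      then obtain x where x: "x \<in> atom_edges (colour i)" "y = h x" by blast
      then have "edge_name j y \<in> edge_name j ` atom_edges (colour j)" using nh j by (auto simp: placed_edges_def)
      then show "y \<in> atom_edges (colour j)" by auto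
    qed
    fix C assume "C \<in> atom_cycles (colour j)"
    then have "edge_name j ` C \<in> placed_cycles j" by (simp add: placed_cycles_def)
    then obtain Y where Y: "Y \<in> sys_cycles B" "Y \<inter> placed_edges j = edge_name j ` C"
      using amalgam_extend[OF B(1) _ j(1)] flexible_placed_cycles B(2) by blast
    have "{x \<in> atom_edges (colour i). g x \<in> Y} = {x \<in> atom_edges (colour i). h x \<in> C}"
    proof (intro Collect_cong conj_cong refl)
      fix x assume x: "x \<in> atom_edges (colour i)"
      then have "g x \<in> Y \<longleftrightarrow> g x \<in> edge_name j ` C" using Y(2) j(2) by blast
      also have "\<dots> \<longleftrightarrow> h x \<in> C" using nh[OF x, symmetric] by auto
      finally show "g x \<in> Y \<longleftrightarrow> h x \<in> C" .
    qed
    then show "{x \<in> atom_edges (colour i). h x \<in> C} \<in> atom_cycles (colour i)"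
      using g Y(1) unfolding cc_into_def by auto
  qed
  then have "colour i = colour j" by (rule cc_same_colour[OF i(2) cj])
  moreover have "f ` placed_edges i \<subseteq> placed_edges j" using j(2) by (simp add: g_def placed_edges_def image_comp)
  ultimately show ?thesis using j by auto
qed

text \<open>Deliberately forgets through which of its two shared edges an atom is attached, since a
  cycle-continuous map is not known to preserve this.\<close>

definition linked :: "atom \<Rightarrow> atom \<Rightarrow> bool" where
  "linked i j \<longleftrightarrow> i = j \<or> y_node i = y_node j \<or> u_node i = u_node j"

text \<open>A shared edge of \<open>i\<close> and \<open>j\<close> is mapped into both target atoms,
  which therefore overlap.\<close>

lemma sys_cc_hom:
  assumes B: "forest placed_edges B" "\<forall>j\<in>B. colour j < 5" and A: "\<forall>i\<in>A. colour i < 5" and f: "sys_cc A B f"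
  shows "\<exists>\<theta>. (\<forall>i\<in>A. \<theta> i \<in> B \<and> colour (\<theta> i) = colour i) \<and> (\<forall>i\<in>A. \<forall>j\<in>A. linked i j \<longrightarrow> linked (\<theta> i) (\<theta> j))"
proof -
  have "\<forall>i. \<exists>j. i \<in> A \<longrightarrow> j \<in> B \<and> colour j = colour i \<and> f ` placed_edges i \<subseteq> placed_edges j"
    using sys_cc_atom[OF B f] A by blast
  from choice[OF this] obtain \<theta> where th: "\<And>i. i \<in> A \<Longrightarrow> \<theta> i \<in> B \<and> colour (\<theta> i) = colour i \<and> f ` placed_edges i \<subseteq> placed_edges (\<theta> i)" by blast
  have overlap: "linked k l" if "a \<in> placed_edges k" "a \<in> placed_edges l" for a k l
    using that by (auto simp: placed_edges_def edge_name_def linked_def split: if_splits)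
  have mem: "(0,0) \<in> atom_edges c" "(1,0) \<in> atom_edges c" if "c < 5" for c
    using edge_mult_bounds(1)[OF that, of 0] edge_mult_bounds(1)[OF that, of 1] by (auto simp: atom_edges_def)
  have "linked (\<theta> i) (\<theta> j)" if ij: "i \<in> A" "j \<in> A" "linked i j" for i j
  proof -
    have ne: "Inl (y_node i) \<in> placed_edges i" "Inl (y_node j) \<in> placed_edges j" "Inr (Inl (u_node i)) \<in> placed_edges i" "Inr (Inl (u_node j)) \<in> placed_edges j"
      using mem[of "colour i"] mem[of "colour j"] A ij unfolding placed_edges_def image_iff by (force simp: edge_name_def)+
    have "\<exists>a. a \<in> placed_edges i \<and> a \<in> placed_edges j" using ij(3) ne unfolding linked_def by metis
    then obtain a where "a \<in> placed_edges i" "a \<in> placed_edges j" by blast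
    then have "f a \<in> placed_edges (\<theta> i)" "f a \<in> placed_edges (\<theta> j)" using th ij by blast+
    then show ?thesis by (rule overlap)
  qed
  then show ?thesis using th by blast
qed

text \<open>Here the two kinds of shared edges must be respected: \<open>Y\<close> and
  \<open>M\<close> say consistently where they go, and all other edges are copied along
  \<open>\<theta>\<close>. On each atom the result is a relabelling, under which cycles pull back to
  cycles.\<close>

lemma hom_sys_cc:
  assumes th: "\<And>i. i \<in> A \<Longrightarrow> \<theta> i \<in> B \<and> colour (\<theta> i) = colour i \<and> y_node (\<theta> i) = Y (y_node i) \<and> u_node (\<theta> i) = M (u_node i)"
  shows "\<exists>f. sys_cc A B f"
proof -
  define f :: "ename \<Rightarrow> ename" where
    "f e = (case e of Inl y \<Rightarrow> Inl (Y y) | Inr (Inl u) \<Rightarrow> Inr (Inl (M u)) | Inr (Inr (i, x)) \<Rightarrow> Inr (Inr (\<theta> i, x)))" for e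
  have fn: "f (edge_name i x) = edge_name (\<theta> i) x" if "i \<in> A" for i x
    using th[OF that] by (simp add: f_def edge_name_def)
  have "f ` sys_edges A \<subseteq> sys_edges B"
    using fn th by (auto simp: placed_edges_def image_iff) (metis surj_pair)
  moreover have "{x \<in> sys_edges A. f x \<in> C} \<in> sys_cycles A" if C: "C \<in> sys_cycles B" for C
    unfolding amalgam_def
  proof (intro CollectI conjI ballI)
    fix i assume i: "i \<in> A"
    have "C \<inter> placed_edges (\<theta> i) \<in> placed_cycles (\<theta> i)" using C th[OF i] unfolding amalgam_def by blast
    then obtain X where X: "C \<inter> placed_edges (\<theta> i) = edge_name (\<theta> i) ` X" "X \<in> atom_cycles (colour i)" using th[OF i] by (auto simp: placed_cycles_def)
    have Xs: "X \<subseteq> atom_edges (colour i)" using X(2) by (simp add: atom_cycles_def)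
    have "edge_name (\<theta> i) x \<in> C \<longleftrightarrow> x \<in> X" if "x \<in> atom_edges (colour i)" for x
    proof -
      have "edge_name (\<theta> i) x \<in> placed_edges (\<theta> i)" using that th[OF i] by (simp add: placed_edges_def)
      then have "edge_name (\<theta> i) x \<in> C \<longleftrightarrow> edge_name (\<theta> i) x \<in> edge_name (\<theta> i) ` X" using X(1) by blast
      then show ?thesis by auto
    qed
    then have "{x \<in> atom_edges (colour i). f (edge_name i x) \<in> C} = X"
      using Xs unfolding fn[OF i] by blast
    moreover have "{x \<in> sys_edges A. f x \<in> C} \<inter> placed_edges i = edge_name i ` {x \<in> atom_edges (colour i). f (edge_name i x) \<in> C}"
      using i by (auto simp: placed_edges_def)
    ultimately show "{x \<in> sys_edges A. f x \<in> C} \<inter> placed_edges i \<in> placed_cycles i" using X(2) by (simp add: placed_cycles_def)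
  qed blast
  ultimately show ?thesis unfolding sys_cc_def by blast
qed

section \<open>Amalgams are graphic\<close>

definition graphic :: "'e set \<Rightarrow> 'e set set \<Rightarrow> bool" where
  "graphic E \<C> \<longleftrightarrow> (\<exists>G :: (nat, 'e) multigraph. finite_multigraph G \<and> edges G = E \<and> (\<forall>C. is_cycle G C \<longleftrightarrow> C \<in> \<C>))"

lemma graphic_empty: "graphic {} {{}}"
proof -
  let ?G = "\<lparr>verts = {}, edges = {}, ends = \<lambda>_. {#}\<rparr> :: (nat, 'a) multigraph"
  have "finite_multigraph ?G" "\<forall>C. is_cycle ?G C \<longleftrightarrow> C \<in> {{}}"
    by (auto simp: finite_multigraph_def is_cycle_def)
  then show ?thesis unfolding graphic_def by (intro exI[of _ ?G]) simp
qed

lemma graphic_image: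
  assumes g: "inj_on g E" and G: "graphic E \<C>" shows "graphic (g ` E) ((`) g ` \<C>)"
proof -
  obtain G :: "(nat, 'a) multigraph" where G: "finite_multigraph G" "edges G = E" "\<And>C. is_cycle G C \<longleftrightarrow> C \<in> \<C>"
    using G unfolding graphic_def by blast
  let ?G = "\<lparr>verts = verts G, edges = g ` E, ends = ends G \<circ> inv_into E g\<rparr> :: (nat, 'b) multigraph"
  have fin: "finite_multigraph ?G" using G(1,2) g by (auto simp: finite_multigraph_def)
  have deg: "degree_in ?G (g ` C) v = degree_in G C v" if "C \<subseteq> E" for C v
    unfolding degree_in_def using that g by (subst sum.reindex) (auto intro!: sum.cong intro: inj_on_subset simp: subset_iff)
  have cyc: "is_cycle ?G (g ` C) \<longleftrightarrow> is_cycle G C" if "C \<subseteq> E" for C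
    using deg[OF that] that G(2) by (auto simp: is_cycle_def)
  have "is_cycle ?G C \<longleftrightarrow> C \<in> (`) g ` \<C>" for C
  proof
    assume C: "is_cycle ?G C"
    then have "C \<subseteq> g ` E" by (simp add: is_cycle_def)
    then obtain D where "D \<subseteq> E" "C = g ` D" by (meson subset_imageE)
    then show "C \<in> (`) g ` \<C>" using cyc C G(3) by blast
  next
    assume "C \<in> (`) g ` \<C>"
    then obtain D where D: "C = g ` D" "is_cycle G D" using G(3) by blast
    then have "D \<subseteq> E" using G(2) by (simp add: is_cycle_def)
    then show "is_cycle ?G C" using cyc D by blast
  qed
  then show ?thesis unfolding graphic_def using fin by (intro exI[of _ ?G]) simp
qed

lemma graphic_atom_cycles: "graphic (atom_edges c) (atom_cycles c)"
proof -
  let ?G = "\<lparr>verts = {..<10}, edges = atom_edges c, ends = \<lambda>(p,r). {#fst (pet_ends p), snd (pet_ends p)#}\<rparr> :: (nat, nat \<times> nat) multigraph"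
  have "finite_multigraph ?G" using pet_ends_less by (auto simp: finite_multigraph_def atom_edges_def)
  moreover have "is_cycle ?G C \<longleftrightarrow> C \<in> atom_cycles c" for C
  proof -
    have "degree_in ?G C v = card (C \<inter> atom_star c v)" if Csub: "C \<subseteq> atom_edges c" for v
    proof -
      have "degree_in ?G C v = (\<Sum>x\<in>C. if x \<in> atom_star c v then 1 else 0)"
        unfolding degree_in_def
      proof (rule sum.cong)
        fix x assume "x \<in> C"
        then obtain p r where "x = (p,r)" "p < 15" "r < edge_mult c p" using Csub by (auto simp: atom_edges_def)
        then show "count (ends ?G x) v = (if x \<in> atom_star c v then 1 else 0)"
          using pet_ends_less(3)[of p] by (auto simp: atom_star_def pet_star_def incident_def)
      qed simp
      also have "\<dots> = card (C \<inter> atom_star c v)"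
        using finite_subset[OF Csub] by (simp add: sum.If_cases)
      finally show ?thesis .
    qed
    then show ?thesis by (auto simp: is_cycle_def atom_cycles_def)
  qed
  ultimately show ?thesis unfolding graphic_def by (intro exI[of _ ?G]) simp
qed

lemma graphic_placed_cycles: "graphic (placed_edges i) (placed_cycles i)"
  unfolding placed_edges_def placed_cycles_def by (rule graphic_image[OF _ graphic_atom_cycles]) (rule inj_on_subset[OF inj_edge_name subset_UNIV])

lemma handshake:
  assumes G: "finite_multigraph G" and C: "C \<subseteq> edges G"
  shows "(\<Sum>v\<in>verts G. degree_in G C v) = 2 * card C"
proof -
  have "(\<Sum>v\<in>verts G. degree_in G C v) = (\<Sum>e\<in>C. \<Sum>v\<in>verts G. count (ends G e) v)"
    unfolding degree_in_def by (rule sum.swap)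
  also have "\<dots> = (\<Sum>e\<in>C. 2)"
  proof (rule sum.cong)
    fix e assume "e \<in> C"
    then have e: "size (ends G e) = 2" "set_mset (ends G e) \<subseteq> verts G" "finite (verts G)"
      using G C by (auto simp: finite_multigraph_def)
    have "(\<Sum>v\<in>verts G. count (ends G e) v) = (\<Sum>v\<in>set_mset (ends G e). count (ends G e) v)"
      by (rule sum.mono_neutral_right) (use e in \<open>auto simp: count_eq_zero_iff\<close>)
    then show "(\<Sum>v\<in>verts G. count (ends G e) v) = 2" using e by (simp add: size_multiset_overloaded_eq)
  qed simp
  finally show ?thesis by simp
qed

lemma size_2_mset: "size M = 2 \<Longrightarrow> \<exists>a b. M = {#a, b#}"
proof (cases M)
  case (add a N)
  moreover assume "size M = 2"
  ultimately have "size N = 1" by simp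
  then obtain b where "N = {#b#}" using size_1_singleton_mset by blast
  then show ?thesis using add by blast
qed simp

lemma even_sum_cong:
  fixes a b :: "'e \<Rightarrow> nat"
  assumes "\<And>x. x \<in> C \<Longrightarrow> even (a x) \<longleftrightarrow> even (b x)" shows "even (sum a C) \<longleftrightarrow> even (sum b C)"
  using assms by (induction C rule: infinite_finite_induct) auto

lemma inj_count_image:
  assumes "inj \<rho>" shows "count (image_mset \<rho> M) (\<rho> v) = count M v"
  using assms by (induction M) (auto simp: inj_eq)

lemma count_image_outside: "x \<notin> range \<rho> \<Longrightarrow> count (image_mset \<rho> M) x = 0"
  by (induction M) auto

text \<open>The degrees sum to an even number, so one remaining vertex cannot be odd alone. This
  settles the vertex at which two graphs are merged.\<close>

lemma even_at_exceptional_vertex: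
  assumes G: "finite_multigraph G" and C: "C \<subseteq> edges G" and ev: "\<And>v. v \<in> verts G \<Longrightarrow> v \<noteq> b \<Longrightarrow> even (degree_in G C v)"
    and v: "v \<in> verts G"
  shows "even (degree_in G C v)"
proof (cases "v = b")
  case True
  have "finite (verts G)" using G by (simp add: finite_multigraph_def)
  then have "(\<Sum>v\<in>verts G. degree_in G C v) = degree_in G C b + (\<Sum>v\<in>verts G - {b}. degree_in G C v)"
    using v True by (simp add: sum.remove)
  moreover have "even (\<Sum>v\<in>verts G - {b}. degree_in G C v)" by (rule dvd_sum) (use ev in auto)
  ultimately show ?thesis using handshake[OF G C] True by (metis dvd_add_left_iff dvd_triv_left)
qed (use ev v in auto)

text \<open>Two graphs sharing one edge are glued along it: the shared edge \<open>s\<close> with ends \<open>a, b\<close> in the first and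
  \<open>c, d\<close> in the second graph becomes an edge from \<open>a\<close> to \<open>d\<close> after \<open>b\<close> and \<open>c\<close> are identified.\<close>

lemma graphic_glue:
  assumes "graphic E1 \<C>1" "graphic E2 \<C>2" "E1 \<inter> E2 \<subseteq> {s}"
  shows "graphic (E1 \<union> E2) {C. C \<subseteq> E1 \<union> E2 \<and> C \<inter> E1 \<in> \<C>1 \<and> C \<inter> E2 \<in> \<C>2}"
proof -
  obtain G1 :: "(nat, 'a) multigraph" where G1: "finite_multigraph G1" "edges G1 = E1" "\<And>C. is_cycle G1 C \<longleftrightarrow> C \<in> \<C>1"
    using assms(1) unfolding graphic_def by blast
  obtain G2 :: "(nat, 'a) multigraph" where G2: "finite_multigraph G2" "edges G2 = E2" "\<And>C. is_cycle G2 C \<longleftrightarrow> C \<in> \<C>2"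
    using assms(2) unfolding graphic_def by blast
  define e1 where "e1 = ends G1"
  define e2 where "e2 = ends G2"
  have "\<exists>(\<rho>1 :: nat \<Rightarrow> nat) (\<rho>2 :: nat \<Rightarrow> nat) b c S. inj \<rho>1 \<and> inj \<rho>2 \<and> (\<forall>u v. \<rho>1 u = \<rho>2 v \<longrightarrow> u = b \<and> v = c) \<and>
     (s \<in> E1 \<inter> E2 \<longrightarrow> size S = 2 \<and> set_mset S \<subseteq> \<rho>1 ` verts G1 \<union> \<rho>2 ` verts G2 \<and>
     (\<forall>x. even (count S x) \<longleftrightarrow> even (count (image_mset \<rho>1 (e1 s)) x + count (image_mset \<rho>2 (e2 s)) x)))"
  proof (cases "s \<in> E1 \<inter> E2")
    case True
    then have "size (e1 s) = 2" "size (e2 s) = 2" using G1 G2 by (auto simp: finite_multigraph_def e1_def e2_def)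
    then obtain a b c d where abcd: "e1 s = {#a, b#}" "e2 s = {#c, d#}" using size_2_mset by metis
    then have V: "a \<in> verts G1" "d \<in> verts G2" using True G1 G2 unfolding finite_multigraph_def e1_def e2_def by force+
    \<comment> \<open>Even numbers for the first graph and odd ones for the second, except that
      \<open>c\<close> takes the number of \<open>b\<close>.\<close>
    define \<rho>1 :: "nat \<Rightarrow> nat" where "\<rho>1 v = 2 * v" for v
    define \<rho>2 :: "nat \<Rightarrow> nat" where "\<rho>2 v = (if v = c then 2 * b else 2 * v + 1)" for v
    have i1: "inj \<rho>1" by (simp add: inj_def \<rho>1_def)
    have i2: "inj \<rho>2" unfolding inj_def \<rho>2_def by (auto split: if_splits) presburger+
    have i3: "u = b \<and> v = c" if "\<rho>1 u = \<rho>2 v" for u v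
      using that unfolding \<rho>1_def \<rho>2_def by (auto split: if_splits) presburger+
    have "\<rho>1 b = \<rho>2 c" by (simp add: \<rho>1_def \<rho>2_def)
    \<comment> \<open>At the merged vertex the contributions of \<open>b\<close> and
      \<open>c\<close> cancel modulo 2, leaving the ends \<open>a\<close> and
      \<open>d\<close>.\<close>
    then have i4: "even (count {#\<rho>1 a, \<rho>2 d#} x) \<longleftrightarrow> even (count (image_mset \<rho>1 (e1 s)) x + count (image_mset \<rho>2 (e2 s)) x)" for x
      unfolding abcd by simp
    have i5: "size {#\<rho>1 a, \<rho>2 d#} = 2" "set_mset {#\<rho>1 a, \<rho>2 d#} \<subseteq> \<rho>1 ` verts G1 \<union> \<rho>2 ` verts G2" using V by auto
    show ?thesis
      by (intro exI[of _ \<rho>1] exI[of _ \<rho>2] exI[of _ b] exI[of _ c] exI[of _ "{#\<rho>1 a, \<rho>2 d#}"] conjI allI impI i1 i2 i4 i5)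
        (drule i3, simp)+
  next
    case False
    \<comment> \<open>Without a shared edge the graphs are placed disjointly; the third fact is
      vacuous and supplies dummy values for \<open>b\<close> and \<open>c\<close>.\<close>
    have "inj (\<lambda>v::nat. 2 * v)" "inj (\<lambda>v::nat. 2 * v + 1)" "\<And>u v :: nat. 2 * u = 2 * v + 1 \<longrightarrow> u = 0 \<and> v = 0"
      by (auto simp: inj_def) presburger+
    then show ?thesis using False by blast
  qed
  then obtain \<rho>1 \<rho>2 :: "nat \<Rightarrow> nat" and b c S where
     r: "inj \<rho>1" "inj \<rho>2" "\<And>u v. \<rho>1 u = \<rho>2 v \<Longrightarrow> u = b \<and> v = c" and
     S: "s \<in> E1 \<inter> E2 \<Longrightarrow> size S = 2" "s \<in> E1 \<inter> E2 \<Longrightarrow> set_mset S \<subseteq> \<rho>1 ` verts G1 \<union> \<rho>2 ` verts G2"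
      "\<And>x. s \<in> E1 \<inter> E2 \<Longrightarrow> even (count S x) \<longleftrightarrow> even (count (image_mset \<rho>1 (e1 s)) x + count (image_mset \<rho>2 (e2 s)) x)"
    by blast
  define en where "en e = (if e \<in> E1 \<inter> E2 then S else if e \<in> E1 then image_mset \<rho>1 (e1 e) else image_mset \<rho>2 (e2 e))" for e
  define G where "G = \<lparr>verts = \<rho>1 ` verts G1 \<union> \<rho>2 ` verts G2, edges = E1 \<union> E2, ends = en\<rparr>"
  have E: "finite E1" "finite E2" using G1 G2 by (auto simp: finite_multigraph_def)
  have fin: "finite_multigraph G"
    unfolding finite_multigraph_def
  proof (intro conjI ballI)
    show "finite (verts G)" "finite (edges G)" using G1 G2 by (auto simp: finite_multigraph_def G_def)
    fix e assume "e \<in> edges G"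
    then consider "e = s" "s \<in> E1 \<inter> E2" | "e \<in> E1" "e \<notin> E2" | "e \<in> E2" "e \<notin> E1" using assms(3) by (auto simp: G_def)
    then have "size (en e) = 2 \<and> set_mset (en e) \<subseteq> \<rho>1 ` verts G1 \<union> \<rho>2 ` verts G2"
    proof cases
      case 1
      then show ?thesis using S by (simp add: en_def)
    next
      case 2
      then have "size (e1 e) = 2" "set_mset (e1 e) \<subseteq> verts G1" using G1 by (auto simp: finite_multigraph_def e1_def)
      then show ?thesis using 2 by (auto simp: en_def)
    next
      case 3
      then have "size (e2 e) = 2" "set_mset (e2 e) \<subseteq> verts G2" using G2 by (auto simp: finite_multigraph_def e2_def)
      then show ?thesis using 3 by (auto simp: en_def)
    qed
    then show "size (ends G e) = 2" "set_mset (ends G e) \<subseteq> verts G" by (simp_all add: G_def)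
  qed
  have cyc: "is_cycle G C \<longleftrightarrow> is_cycle G1 (C \<inter> E1) \<and> is_cycle G2 (C \<inter> E2)" if C: "C \<subseteq> E1 \<union> E2" for C
  proof -
    have finC: "finite C" using C E finite_subset by blast
    define d1 where "d1 x = (\<Sum>e\<in>C \<inter> E1. count (image_mset \<rho>1 (e1 e)) x)" for x
    define d2 where "d2 x = (\<Sum>e\<in>C \<inter> E2. count (image_mset \<rho>2 (e2 e)) x)" for x
    have d: "even (degree_in G C x) \<longleftrightarrow> even (d1 x + d2 x)" for x
    proof -
      have "d1 x + d2 x = (\<Sum>e\<in>C. (if e \<in> E1 then count (image_mset \<rho>1 (e1 e)) x else 0) +
         (if e \<in> E2 then count (image_mset \<rho>2 (e2 e)) x else 0))"
        unfolding d1_def d2_def sum.distrib using finC by (simp add: sum.inter_restrict)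
      moreover have "even (degree_in G C x) \<longleftrightarrow> even \<dots>"
        unfolding degree_in_def
      proof (rule even_sum_cong)
        fix e assume "e \<in> C"
        then consider "e = s" "s \<in> E1 \<inter> E2" | "e \<in> E1" "e \<notin> E2" | "e \<in> E2" "e \<notin> E1" using assms(3) C by auto
        then show "even (count (ends G e) x) \<longleftrightarrow> even ((if e \<in> E1 then count (image_mset \<rho>1 (e1 e)) x else 0) +
           (if e \<in> E2 then count (image_mset \<rho>2 (e2 e)) x else 0))"
          by cases (use S(3) in \<open>simp_all add: G_def en_def\<close>)
      qed
      ultimately show ?thesis by simp
    qed
    have d1: "d1 (\<rho>1 v) = degree_in G1 (C \<inter> E1) v" for v
      by (simp add: d1_def degree_in_def inj_count_image[OF r(1)] e1_def)
    have d2: "d2 (\<rho>2 v) = degree_in G2 (C \<inter> E2) v" for v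
      by (simp add: d2_def degree_in_def inj_count_image[OF r(2)] e2_def)
    have d1_0: "d1 x = 0" if "x \<notin> range \<rho>1" for x
      using that by (simp add: d1_def count_image_outside)
    have d2_0: "d2 x = 0" if "x \<notin> range \<rho>2" for x
      using that by (simp add: d2_def count_image_outside)
    have sub: "C \<inter> E1 \<subseteq> edges G1" "C \<inter> E2 \<subseteq> edges G2" using G1 G2 by auto
    have nG1: "count (e1 e) v = 0" if "e \<in> E1" "v \<notin> verts G1" for e v
      using G1 that by (auto simp: finite_multigraph_def e1_def count_eq_zero_iff)
    have nG2: "count (e2 e) v = 0" if "e \<in> E2" "v \<notin> verts G2" for e v
      using G2 that by (auto simp: finite_multigraph_def e2_def count_eq_zero_iff)
    show ?thesis
    proof
      assume "is_cycle G C"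
      then have ev: "even (d1 x + d2 x)" if "x \<in> \<rho>1 ` verts G1 \<union> \<rho>2 ` verts G2" for x
        using that d unfolding is_cycle_def G_def by simp
      \<comment> \<open>Away from the merged vertex only one of \<open>d1\<close>, \<open>d2\<close>
        contributes, so the even sum gives even degrees there; the merged vertex follows by
        handshaking.\<close>
      have "even (degree_in G1 (C \<inter> E1) v)" if v: "v \<in> verts G1" for v
      proof (rule even_at_exceptional_vertex[OF G1(1) sub(1) _ v])
        fix v assume v: "v \<in> verts G1" "v \<noteq> b"
        then have "\<rho>1 v \<notin> range \<rho>2" using r(3) by blast
        then show "even (degree_in G1 (C \<inter> E1) v)" using ev[of "\<rho>1 v"] v d1 d2_0 by simp
      qed
      moreover have "even (degree_in G2 (C \<inter> E2) v)" if v: "v \<in> verts G2" for v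
      proof (rule even_at_exceptional_vertex[OF G2(1) sub(2) _ v])
        fix v assume v: "v \<in> verts G2" "v \<noteq> c"
        then have "\<rho>2 v \<notin> range \<rho>1" using r(3) by (metis imageE)
        then show "even (degree_in G2 (C \<inter> E2) v)" using ev[of "\<rho>2 v"] v d2 d1_0 by simp
      qed
      ultimately show "is_cycle G1 (C \<inter> E1) \<and> is_cycle G2 (C \<inter> E2)" using sub by (simp add: is_cycle_def)
    next
      assume a: "is_cycle G1 (C \<inter> E1) \<and> is_cycle G2 (C \<inter> E2)"
      have "even (d1 x)" for x
      proof (cases "x \<in> range \<rho>1")
        case True
        then obtain v where v: "x = \<rho>1 v" by blast
        show ?thesis
        proof (cases "v \<in> verts G1")
          case True
          then show ?thesis using a d1 v by (simp add: is_cycle_def)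
        next
          case False
          then show ?thesis unfolding v d1 degree_in_def using nG1 by (simp add: e1_def)
        qed
      qed (simp add: d1_0)
      moreover have "even (d2 x)" for x
      proof (cases "x \<in> range \<rho>2")
        case True
        then obtain v where v: "x = \<rho>2 v" by blast
        show ?thesis
        proof (cases "v \<in> verts G2")
          case True
          then show ?thesis using a d2 v by (simp add: is_cycle_def)
        next
          case False
          then show ?thesis unfolding v d2 degree_in_def using nG2 by (simp add: e2_def)
        qed
      qed (simp add: d2_0)
      ultimately show "is_cycle G C" using C d by (simp add: is_cycle_def G_def)
    qed
  qed
  have "is_cycle G C \<longleftrightarrow> C \<in> {C. C \<subseteq> E1 \<union> E2 \<and> C \<inter> E1 \<in> \<C>1 \<and> C \<inter> E2 \<in> \<C>2}" for C
  proof (cases "C \<subseteq> E1 \<union> E2")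
    case True
    then show ?thesis using cyc G1(3) G2(3) by simp
  next
    case False
    then show ?thesis by (simp add: is_cycle_def G_def)
  qed
  moreover have "edges G = E1 \<union> E2" by (simp add: G_def)
  ultimately show ?thesis unfolding graphic_def using fin by blast
qed

lemma graphic_forest:
  assumes "forest Ed A" "\<And>i. i \<in> A \<Longrightarrow> graphic (Ed i) (\<X> i)"
  shows "graphic (\<Union>(Ed ` A)) (amalgam Ed \<X> A)"
  using assms
proof (induction rule: forest.induct)
  case empty
  show ?case by (simp add: amalgam_empty graphic_empty)
next
  case (insert A i s)
  have "\<Union>(Ed ` A) \<inter> Ed i \<subseteq> {s}" using insert.hyps by blast
  then have "graphic (\<Union>(Ed ` A) \<union> Ed i) {C. C \<subseteq> \<Union>(Ed ` A) \<union> Ed i \<and> C \<inter> \<Union>(Ed ` A) \<in> amalgam Ed \<X> A \<and> C \<inter> Ed i \<in> \<X> i}"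
    using insert by (intro graphic_glue) auto
  moreover have "C \<inter> \<Union>(Ed ` A) \<in> amalgam Ed \<X> A \<longleftrightarrow> (\<forall>j\<in>A. C \<inter> Ed j \<in> \<X> j)" for C
  proof -
    have "C \<inter> \<Union>(Ed ` A) \<inter> Ed j = C \<inter> Ed j" if "j \<in> A" for j using that by blast
    then show ?thesis by (simp add: amalgam_def)
  qed
  then have "{C. C \<subseteq> \<Union>(Ed ` A) \<union> Ed i \<and> C \<inter> \<Union>(Ed ` A) \<in> amalgam Ed \<X> A \<and> C \<inter> Ed i \<in> \<X> i} = amalgam Ed \<X> (insert i A)"
    unfolding amalgam_def[of Ed \<X> "insert i A"] by (auto simp: Un_commute)
  ultimately show ?case by (simp add: Un_commute)
qed

section \<open>Chains of atoms\<close>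

text \<open>In chain \<open>n\<close>, the node \<open>(n, j)\<close> is junction \<open>j\<close>,
  \<open>(n, j, 0)\<close> is the midpoint between junctions \<open>j\<close> and
  \<open>j + 1\<close>, and \<open>(n, j, c + 1)\<close> is the free end of the pendant of colour
  \<open>c\<close> at junction \<open>j\<close>; the shift keeps 0 for midpoints.\<close>

definition left_atom :: "nat \<Rightarrow> nat \<Rightarrow> atom" where "left_atom n j = ((n, j), (n, j, 0), j mod 3)"
definition right_atom :: "nat \<Rightarrow> nat \<Rightarrow> atom" where "right_atom n j = ((n, j + 1), (n, j, 0), j mod 3)"
definition pendant_atom :: "nat \<Rightarrow> nat \<times> nat \<Rightarrow> atom" where "pendant_atom n = (\<lambda>(j, c). ((n, j), (n, j, c + 1), c))"

definition pendants :: "(nat \<Rightarrow> nat set) \<Rightarrow> nat \<Rightarrow> (nat \<times> nat) set" where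
  "pendants mk n = {(0,4)} \<union> {(j,3) | j. j \<in> mk n \<and> j \<le> n} \<union> {(n + 1, c) | c. c < 4}"

definition chain :: "(nat \<Rightarrow> nat set) \<Rightarrow> nat \<Rightarrow> atom set" where
  "chain mk n = left_atom n ` {..n} \<union> right_atom n ` {..n} \<union> pendant_atom n ` pendants mk n"

lemmas atom_defs = y_node_def u_node_def colour_def left_atom_def right_atom_def pendant_atom_def

lemma finite_pendants: "finite (pendants mk n)"
proof -
  have "{(j,3) | j. j \<in> mk n \<and> j \<le> n} \<subseteq> {..n} \<times> {3}" by auto
  moreover have "{(n + 1, c) | c. c < 4} \<subseteq> {n+1} \<times> {..<4}" by auto
  ultimately show ?thesis unfolding pendants_def by (auto intro: finite_subset)
qed

lemma chainE:
  assumes "i \<in> chain mk n"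
  obtains j where "i = left_atom n j" "j \<le> n" | j where "i = right_atom n j" "j \<le> n" | "i = pendant_atom n (0,4)"
    | j where "i = pendant_atom n (j,3)" "j \<in> mk n" "j \<le> n" | c where "i = pendant_atom n (n+1,c)" "c < 4"
  using assms by (auto simp: chain_def pendants_def)

lemma chain_col: "i \<in> chain mk n \<Longrightarrow> colour i < 5"
  by (erule chainE) (auto simp: atom_defs intro: less_le_trans[OF mod_less_divisor])

lemma chain_component: "i \<in> chain mk n \<Longrightarrow> fst (y_node i) = n \<and> fst (u_node i) = n"
  by (erule chainE) (auto simp: atom_defs)

text \<open>If one of the two shareable edges of the new atom is fresh, the atom can meet the old
  ones only in the other.\<close>

lemma forest_insert_atom:
  assumes "forest placed_edges A" "u_node i \<notin> u_node ` A \<or> y_node i \<notin> y_node ` A"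
  shows "forest placed_edges (insert i A)"
proof -
  have i: "i \<notin> A" using assms by blast
  have "placed_edges i \<inter> sys_edges A \<subseteq> {if u_node i \<notin> u_node ` A then Inl (y_node i) else Inr (Inl (u_node i))}"
    using i assms(2) by (auto simp: placed_edges_def edge_name_def split: if_splits)
  then show ?thesis by (rule forest.insert[OF assms(1) i])
qed

text \<open>In order of insertion, each left atom brings a new midpoint and each right atom a new
  junction.\<close>

lemma forest_spine:
  assumes "forest placed_edges A" "\<And>i. i \<in> A \<Longrightarrow> fst (y_node i) \<noteq> n \<and> fst (u_node i) \<noteq> n"
  shows "forest placed_edges (A \<union> (left_atom n ` {..<k} \<union> right_atom n ` {..<k}))"
proof (induction k)
  case (Suc k)
  let ?B = "A \<union> (left_atom n ` {..<k} \<union> right_atom n ` {..<k})"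
  have "forest placed_edges (insert (left_atom n k) ?B)"
    by (rule forest_insert_atom[OF Suc]) (use assms(2) in \<open>force simp: atom_defs\<close>)
  then have "forest placed_edges (insert (right_atom n k) (insert (left_atom n k) ?B))"
    by (rule forest_insert_atom) (use assms(2) in \<open>force simp: atom_defs\<close>)
  moreover have "insert (right_atom n k) (insert (left_atom n k) ?B) = A \<union> (left_atom n ` {..<Suc k} \<union> right_atom n ` {..<Suc k})"
    by (auto simp: lessThan_Suc)
  ultimately show ?case by simp
qed (use assms(1) in simp)

lemma forest_pendants:
  assumes "finite X" "forest placed_edges A" "\<And>i j c. i \<in> A \<Longrightarrow> u_node i \<noteq> (n, j, Suc c)"
  shows "forest placed_edges (A \<union> pendant_atom n ` X)"
  using assms(1)
proof (induction X rule: finite_induct)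
  case (insert x X)
  obtain j c where x: "x = (j, c)" by force
  have "u_node (pendant_atom n x) \<notin> u_node ` (A \<union> pendant_atom n ` X)"
  proof
    assume "u_node (pendant_atom n x) \<in> u_node ` (A \<union> pendant_atom n ` X)"
    then obtain i where i: "i \<in> A \<union> pendant_atom n ` X" "u_node i = u_node (pendant_atom n x)" by (metis imageE)
    have u: "u_node (pendant_atom n x) = (n, j, Suc c)" by (simp add: x atom_defs)
    have "i \<in> pendant_atom n ` X" using assms(3)[of i j c] i u by auto
    then obtain y where y: "y \<in> X" "i = pendant_atom n y" by blast
    then have "y = x" using i(2) u by (cases y) (simp add: x atom_defs)
    then show False using insert.hyps y by simp
  qed
  then have "forest placed_edges (insert (pendant_atom n x) (A \<union> pendant_atom n ` X))" by (intro forest_insert_atom insert.IH) simp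
  then show ?case by simp
qed (use assms(2) in simp)

lemma forest_chains:
  assumes "finite Z" shows "forest placed_edges (\<Union>(chain mk ` Z))"
  using assms
proof (induction Z rule: finite_induct)
  case empty
  show ?case using forest.empty by simp
next
  case (insert n Z)
  let ?A = "\<Union>(chain mk ` Z)"
  have A: "fst (y_node i) \<noteq> n \<and> fst (u_node i) \<noteq> n" if iA: "i \<in> ?A" for i
  proof -
    obtain m where m: "m \<in> Z" "i \<in> chain mk m" using iA by blast
    have "m \<noteq> n" using m(1) insert.hyps by blast
    then show ?thesis using chain_component[OF m(2)] by simp
  qed
  have "forest placed_edges (?A \<union> (left_atom n ` {..<Suc n} \<union> right_atom n ` {..<Suc n}))"
    by (rule forest_spine[OF insert.IH A])
  then have "forest placed_edges (?A \<union> (left_atom n ` {..<Suc n} \<union> right_atom n ` {..<Suc n}) \<union> pendant_atom n ` pendants mk n)"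
  proof (rule forest_pendants[OF finite_pendants])
    fix i j c assume "i \<in> ?A \<union> (left_atom n ` {..<Suc n} \<union> right_atom n ` {..<Suc n})"
    then consider "i \<in> ?A" | k where "i = left_atom n k" | k where "i = right_atom n k" by blast
    then show "u_node i \<noteq> (n, j, Suc c)"
      by cases (use A in \<open>fastforce simp: atom_defs\<close>)+
  qed
  moreover have "?A \<union> (left_atom n ` {..<Suc n} \<union> right_atom n ` {..<Suc n}) \<union> pendant_atom n ` pendants mk n = \<Union>(chain mk ` insert n Z)"
    by (auto simp: chain_def lessThan_Suc_atMost)
  ultimately show ?case by simp
qed

text \<open>Chain \<open>n\<close> is retracted onto the shorter chain \<open>\<sigma> n\<close>.
  Everything beyond junction \<open>\<sigma> n + 1\<close> collapses to that junction, each later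
  pair of spine atoms folding onto the end pendant of its colour and each later mark onto the one of
  colour 3. Marks up to \<open>\<sigma> n\<close> stay in place, hence the assumption on
  \<open>mk\<close>.\<close>

lemma chain_hom:
  assumes "\<And>n. n \<in> Z \<Longrightarrow> \<sigma> n \<in> Z' \<and> \<sigma> n \<le> n \<and> (\<forall>i\<le>\<sigma> n. i \<in> mk n \<longrightarrow> i \<in> mk (\<sigma> n))"
  shows "\<exists>f. sys_cc (\<Union>(chain mk ` Z)) (\<Union>(chain mk ` Z')) f"
proof (rule hom_sys_cc)
  define Y :: "nat \<times> nat \<Rightarrow> nat \<times> nat" where "Y = (\<lambda>(n, j). (\<sigma> n, min j (\<sigma> n + 1)))"
  \<comment> \<open>The midpoint of a folded pair becomes the free end of the end pendant of colour
    \<open>j mod 3\<close>, whence the third coordinate \<open>j mod 3 + 1\<close>.\<close>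
  define M :: "nat \<times> nat \<times> nat \<Rightarrow> nat \<times> nat \<times> nat" where
    "M = (\<lambda>(n, j, k). if k = 0 then (if j \<le> \<sigma> n then (\<sigma> n, j, 0) else (\<sigma> n, \<sigma> n + 1, j mod 3 + 1))
       else (\<sigma> n, min j (\<sigma> n + 1), k))"
  define \<theta> :: "atom \<Rightarrow> atom" where "\<theta> i = (Y (y_node i), M (u_node i), colour i)" for i
  fix i assume "i \<in> \<Union>(chain mk ` Z)"
  then obtain n where n: "n \<in> Z" "i \<in> chain mk n" by blast
  let ?m = "\<sigma> n"
  have s: "?m \<in> Z'" "?m \<le> n" "\<And>i. i \<le> ?m \<Longrightarrow> i \<in> mk n \<Longrightarrow> i \<in> mk ?m" using assms[OF n(1)] by auto
  have L: "left_atom ?m j \<in> chain mk ?m" if "j \<le> ?m" for j using that by (simp add: chain_def)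
  have R: "right_atom ?m j \<in> chain mk ?m" if "j \<le> ?m" for j using that by (simp add: chain_def)
  have Q0: "pendant_atom ?m (0,4) \<in> chain mk ?m" by (simp add: chain_def pendants_def)
  have Q3: "pendant_atom ?m (j,3) \<in> chain mk ?m" if "j \<le> ?m" "j \<in> mk ?m" for j using that by (simp add: chain_def pendants_def)
  have Q: "pendant_atom ?m (?m+1,c) \<in> chain mk ?m" if "c < 4" for c using that by (simp add: chain_def pendants_def)
  from n(2) have "\<theta> i \<in> chain mk ?m"
  proof (cases rule: chainE)
    case (1 j)
    show ?thesis
    proof (cases "j \<le> ?m")
      case True
      then have "\<theta> i = left_atom ?m j" by (simp add: 1 \<theta>_def Y_def M_def atom_defs)
      then show ?thesis using L True by simp
    next
      case False
      then have "\<theta> i = pendant_atom ?m (?m+1, j mod 3)" by (simp add: 1 \<theta>_def Y_def M_def atom_defs)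
      moreover have "j mod 3 < 4" by (rule less_le_trans[OF mod_less_divisor]) simp_all
      ultimately show ?thesis using Q by simp
    qed
  next
    case (2 j)
    show ?thesis
    proof (cases "j \<le> ?m")
      case True
      then have "\<theta> i = right_atom ?m j" by (simp add: 2 \<theta>_def Y_def M_def atom_defs)
      then show ?thesis using R True by simp
    next
      case False
      then have "\<theta> i = pendant_atom ?m (?m+1, j mod 3)" by (simp add: 2 \<theta>_def Y_def M_def atom_defs)
      moreover have "j mod 3 < 4" by (rule less_le_trans[OF mod_less_divisor]) simp_all
      ultimately show ?thesis using Q by simp
    qed
  next
    case 3
    then have "\<theta> i = pendant_atom ?m (0,4)" by (simp add: \<theta>_def Y_def M_def atom_defs)
    then show ?thesis using Q0 by simp
  next
    case (4 j)
    show ?thesis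
    proof (cases "j \<le> ?m")
      case True
      then have "\<theta> i = pendant_atom ?m (j,3)" by (simp add: 4 \<theta>_def Y_def M_def atom_defs)
      then show ?thesis using Q3[OF True s(3)[OF True 4(2)]] by simp
    next
      case False
      then have "\<theta> i = pendant_atom ?m (?m+1,3)" by (simp add: 4 \<theta>_def Y_def M_def atom_defs)
      then show ?thesis using Q[of 3] by simp
    qed
  next
    case (5 c)
    then have "\<theta> i = pendant_atom ?m (?m+1,c)" using s(2) by (simp add: \<theta>_def Y_def M_def atom_defs)
    then show ?thesis using Q 5 by simp
  qed
  then show "\<theta> i \<in> \<Union>(chain mk ` Z') \<and> colour (\<theta> i) = colour i \<and> y_node (\<theta> i) = Y (y_node i) \<and> u_node (\<theta> i) = M (u_node i)"
    using s(1) by (auto simp: \<theta>_def y_node_def u_node_def colour_def)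
qed

section \<open>Rigidity of maps between chains\<close>

lemma linked_chain:
  assumes "i \<in> \<Union>(chain mk ` Z)" "linked i k" "k \<in> chain mk m" shows "i \<in> chain mk m"
proof -
  obtain n where n: "i \<in> chain mk n" using assms by blast
  have "n = m" using chain_component[OF n] chain_component[OF assms(3)] assms(2) by (auto simp: linked_def)
  then show ?thesis using n by simp
qed

lemma linked_pendant_0:
  assumes "i \<in> chain mk m" "linked i (pendant_atom m (0,4))" "colour i = 0" shows "i = left_atom m 0"
  using assms by (cases rule: chainE) (auto simp: atom_defs linked_def)

lemma linked_left_atom_cases:
  assumes "i \<in> chain mk m" "linked i (left_atom m j)" "j \<le> m"
  shows "i = left_atom m j \<or> i = right_atom m j \<or> (\<exists>k. j = Suc k \<and> i = right_atom m k) \<or> (i = pendant_atom m (0,4)) \<or> (i = pendant_atom m (j,3) \<and> j \<in> mk m)"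
  using assms(1)
proof (cases rule: chainE)
  case (1 k) then show ?thesis using assms(2) by (auto simp: atom_defs linked_def)
next
  case (2 k) then show ?thesis using assms(2) by (auto simp: atom_defs linked_def)
next
  case 3 then show ?thesis by simp
next
  case (4 k) then show ?thesis using assms(2) by (auto simp: atom_defs linked_def)
next
  case (5 c) then show ?thesis using assms(2,3) by (auto simp: atom_defs linked_def)
qed

lemma linked_right_atom_cases:
  assumes "i \<in> chain mk m" "linked i (right_atom m j)" "j + 1 \<le> m"
  shows "i = left_atom m j \<or> i = right_atom m j \<or> i = left_atom m (j + 1) \<or> i = pendant_atom m (j + 1,3)"
  using assms(1)
proof (cases rule: chainE)
  case (1 k) then show ?thesis using assms(2) by (auto simp: atom_defs linked_def)
next
  case (2 k) then show ?thesis using assms(2) by (auto simp: atom_defs linked_def)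
next
  case 3 then show ?thesis using assms(2) by (auto simp: atom_defs linked_def)
next
  case (4 k) then show ?thesis using assms(2) by (auto simp: atom_defs linked_def)
next
  case (5 c) then show ?thesis using assms(2,3) by (auto simp: atom_defs linked_def)
qed

lemma colour_simps: "colour (left_atom n j) = j mod 3" "colour (right_atom n j) = j mod 3" "colour (pendant_atom n (j, c)) = c"
  by (simp_all add: atom_defs)

text \<open>Besides colours 3 and 4, only the colours of positions \<open>j\<close> and
  \<open>j - 1\<close> occur around a left atom. The missing colour of \<open>j + 1\<close> prevents
  folding back, and since end pendants sit only at junction \<open>m + 1\<close>, colour 3 here
  reveals a mark.\<close>

lemma linked_left_atom:
  assumes "i \<in> chain mk m" "linked i (left_atom m j)" "j \<le> m"
  shows "colour i = j mod 3 \<Longrightarrow> i = left_atom m j \<or> i = right_atom m j" "colour i \<noteq> (j + 1) mod 3"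
    "colour i = 3 \<Longrightarrow> j \<in> mk m"
proof -
  have m: "k mod 3 \<noteq> 3" "k mod 3 \<noteq> 4" "Suc k mod 3 \<noteq> k mod 3" "Suc (Suc k) mod 3 \<noteq> k mod 3" for k :: nat by presburger+
  note c = linked_left_atom_cases[OF assms]
  show "colour i = j mod 3 \<Longrightarrow> i = left_atom m j \<or> i = right_atom m j"
    using c m by (metis colour_simps)
  show "colour i \<noteq> (j + 1) mod 3"
    using c m by (metis colour_simps Suc_eq_plus1)
  show "colour i = 3 \<Longrightarrow> j \<in> mk m"
    using c m by (metis colour_simps num.distinct numeral_eq_iff semiring_norm(89))
qed

text \<open>As long as the spine continues, the colour of \<open>j + 2\<close> is absent at junction
  \<open>j + 1\<close>, unlike at the end of a chain. This will show that a chain cannot map into a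
  longer one.\<close>

lemma linked_right_atom:
  assumes "i \<in> chain mk m" "linked i (right_atom m j)" "j + 1 \<le> m"
  shows "colour i = (j + 1) mod 3 \<Longrightarrow> i = left_atom m (j + 1)" "colour i \<noteq> (j + 2) mod 3"
proof -
  have m: "k mod 3 \<noteq> 3" "(k + 1) mod 3 \<noteq> k mod 3" "(k + 2) mod 3 \<noteq> k mod 3" "(k + 2) mod 3 \<noteq> (k + 1) mod 3" for k :: nat by presburger+
  note c = linked_right_atom_cases[OF assms]
  show "colour i = (j + 1) mod 3 \<Longrightarrow> i = left_atom m (j + 1)"
    using c m by (metis colour_simps)
  show "colour i \<noteq> (j + 2) mod 3"
    using c m by (metis colour_simps)
qed

text \<open>A right atom could only be folded back onto its left partner, where the next colour is missing.\<close>

lemma chain_walk: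
  assumes Z: "n \<in> Z" and th: "\<And>i. i \<in> \<Union>(chain mk ` Z) \<Longrightarrow> \<theta> i \<in> \<Union>(chain mk ` Z') \<and> colour (\<theta> i) = colour i"
    and li: "\<And>i j. i \<in> \<Union>(chain mk ` Z) \<Longrightarrow> j \<in> \<Union>(chain mk ` Z) \<Longrightarrow> linked i j \<Longrightarrow> linked (\<theta> i) (\<theta> j)"
  shows "\<exists>m\<in>Z'. m \<le> n \<and> (m \<in> mk n \<longrightarrow> m \<in> mk m)"
proof -
  have up: "i \<in> \<Union>(chain mk ` Z)" if "i \<in> chain mk n" for i using Z that by blast
  have L: "left_atom n j \<in> chain mk n" if "j \<le> n" for j using that by (simp add: chain_def)
  have R: "right_atom n j \<in> chain mk n" if "j \<le> n" for j using that by (simp add: chain_def)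
  have Q0: "pendant_atom n (0,4) \<in> chain mk n" by (simp add: chain_def pendants_def)
  have Q3: "pendant_atom n (j,3) \<in> chain mk n" if "j \<le> n" "j \<in> mk n" for j using that by (simp add: chain_def pendants_def)
  have Q: "pendant_atom n (n+1,c) \<in> chain mk n" if "c < 4" for c using that by (simp add: chain_def pendants_def)
  have colour: "colour (\<theta> i) = colour i" if "i \<in> chain mk n" for i using th[OF up[OF that]] by simp
  obtain m where m: "m \<in> Z'" "\<theta> (pendant_atom n (0,4)) \<in> chain mk m" using th[OF up[OF Q0]] by blast
  \<comment> \<open>Colour 4 occurs once per chain, so start goes to start and the target chain
    \<open>m\<close> is determined.\<close>
  have "colour (\<theta> (pendant_atom n (0,4))) = 4" using colour[OF Q0] by (simp add: atom_defs)
  with m(2) have S: "\<theta> (pendant_atom n (0,4)) = pendant_atom m (0,4)"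
    by (cases rule: chainE) (auto simp: atom_defs dest: sym[of _ 4])
  have step: "\<theta> i \<in> chain mk m \<and> linked (\<theta> i) (\<theta> k)"
    if "i \<in> chain mk n" "k \<in> chain mk n" "linked i k" "\<theta> k \<in> chain mk m" for i k
    using li[OF up[OF that(1)] up[OF that(2)] that(3)] linked_chain[of "\<theta> i" mk Z' "\<theta> k" m] th[OF up[OF that(1)]] that(4) by blast
  have Lm: "left_atom m j \<in> chain mk m" if "j \<le> m" for j using that by (simp add: chain_def)
  have Rm: "right_atom m j \<in> chain mk m" if "j \<le> m" for j using that by (simp add: chain_def)
  have RL: "\<theta> (right_atom n j) = left_atom m j \<or> \<theta> (right_atom n j) = right_atom m j" if j: "\<theta> (left_atom n j) = left_atom m j" "j \<le> n" "j \<le> m" for j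
  proof -
    have "\<theta> (right_atom n j) \<in> chain mk m \<and> linked (\<theta> (right_atom n j)) (\<theta> (left_atom n j))"
      by (rule step[OF R[OF j(2)] L[OF j(2)]]) (use j Lm in \<open>auto simp: linked_def atom_defs\<close>)
    moreover have "colour (\<theta> (right_atom n j)) = j mod 3" using colour[OF R[OF j(2)]] by (simp add: atom_defs)
    ultimately show ?thesis using linked_left_atom(1) j by metis
  qed
  have next_R: "\<theta> (right_atom n j) = right_atom m j"
    if j: "\<theta> (left_atom n j) = left_atom m j" "j \<le> n" "j \<le> m" and i: "i \<in> chain mk n" "linked i (right_atom n j)" "colour i = (j + 1) mod 3" for i j
  proof (rule ccontr)
    assume "\<not> ?thesis"
    then have RL: "\<theta> (right_atom n j) = left_atom m j" using RL[OF j] by blast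
    have "\<theta> i \<in> chain mk m \<and> linked (\<theta> i) (\<theta> (right_atom n j))"
      by (rule step[OF i(1) R[OF j(2)] i(2)]) (use RL Lm j in simp)
    then show False using linked_left_atom(2)[of "\<theta> i" mk m j] RL j(3) colour[OF i(1)] i(3) by simp
  qed
  have walk: "j \<le> n \<Longrightarrow> j \<le> m \<Longrightarrow> \<theta> (left_atom n j) = left_atom m j" for j
  proof (induction j)
    case 0
    have "\<theta> (left_atom n 0) \<in> chain mk m \<and> linked (\<theta> (left_atom n 0)) (\<theta> (pendant_atom n (0,4)))"
      by (rule step[OF L Q0]) (use m(2) in \<open>auto simp: linked_def atom_defs\<close>)
    moreover have "colour (\<theta> (left_atom n 0)) = 0" using colour[OF L[of 0]] by (simp add: atom_defs)
    ultimately show ?case using linked_pendant_0[of "\<theta> (left_atom n 0)" mk m] S by simp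
  next
    case (Suc j)
    have lk: "linked (left_atom n (Suc j)) (right_atom n j)" by (simp add: linked_def atom_defs)
    have cl: "colour (left_atom n (Suc j)) = (j + 1) mod 3" by (simp add: atom_defs)
    have Rj: "\<theta> (right_atom n j) = right_atom m j"
      by (rule next_R[OF _ _ _ L[OF Suc.prems(1)] lk cl]) (use Suc in auto)
    have "\<theta> (left_atom n (Suc j)) \<in> chain mk m \<and> linked (\<theta> (left_atom n (Suc j))) (\<theta> (right_atom n j))"
      by (rule step[OF L[OF Suc.prems(1)] R lk]) (use Suc Rj Rm in auto)
    moreover have "colour (\<theta> (left_atom n (Suc j))) = (j + 1) mod 3" using colour[OF L[OF Suc.prems(1)]] cl by simp
    ultimately show ?case using linked_right_atom(1)[of "\<theta> (left_atom n (Suc j))" mk m j] Rj Suc.prems(2) by simp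
  qed
  have mn: "m \<le> n"
  proof (rule ccontr)
    assume "\<not> m \<le> n"
    then have nm: "n + 1 \<le> m" by simp
    have lk: "linked (pendant_atom n (n+1, c)) (right_atom n n)" for c by (simp add: linked_def atom_defs)
    have cq: "colour (pendant_atom n (n+1, c)) = c" for c by (simp add: atom_defs)
    have m4: "k mod 3 < 4" for k :: nat by (rule less_le_trans[OF mod_less_divisor]) simp_all
    \<comment> \<open>No left atom follows at the end of chain \<open>n\<close>; the end pendant of
      colour \<open>(n + 1) mod 3\<close> takes its place in excluding the fold.\<close>
    have Rn: "\<theta> (right_atom n n) = right_atom m n"
      by (rule next_R[OF walk _ _ Q[OF m4] lk cq]) (use nm in auto)
    \<comment> \<open>The end pendant of this colour would need an image next to
      \<open>right_atom m n\<close>, where the colour is absent while the longer chain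
      \<open>m\<close> continues.\<close>
    have "\<theta> (pendant_atom n (n+1, (n+2) mod 3)) \<in> chain mk m \<and> linked (\<theta> (pendant_atom n (n+1, (n+2) mod 3))) (\<theta> (right_atom n n))"
      by (rule step[OF Q[OF m4] R lk]) (use nm Rn Rm in auto)
    then show False
      using linked_right_atom(2)[of "\<theta> (pendant_atom n (n+1, (n+2) mod 3))" mk m n] Rn nm colour[OF Q[OF m4]] cq by simp
  qed
  \<comment> \<open>The chains are aligned up to \<open>left_atom m m\<close>. Its junction
    \<open>m\<close> is the last one before the end pendants, so the image of the mark at
    \<open>m\<close> must again be a mark.\<close>
  have "m \<in> mk m" if mk: "m \<in> mk n"
  proof -
    have lk: "linked (pendant_atom n (m,3)) (left_atom n m)" by (simp add: linked_def atom_defs)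
    have Lw: "\<theta> (left_atom n m) = left_atom m m" using walk mn by simp
    have "\<theta> (pendant_atom n (m,3)) \<in> chain mk m \<and> linked (\<theta> (pendant_atom n (m,3))) (\<theta> (left_atom n m))"
      by (rule step[OF Q3[OF mn mk] L[OF mn] lk]) (use Lw Lm in auto)
    moreover have "colour (\<theta> (pendant_atom n (m,3))) = 3" using colour[OF Q3[OF mn mk]] by (simp add: atom_defs)
    ultimately show ?thesis using linked_left_atom(3)[of "\<theta> (pendant_atom n (m,3))" mk m m] Lw by simp
  qed
  then show ?thesis using m mn by blast
qed

section \<open>Transfer to multigraphs on natural numbers, and the representation\<close>

lemma sys_graph:
  assumes "forest placed_edges A"
  obtains G :: "(nat, nat) multigraph" where "finite_multigraph G" "edges G = to_nat ` sys_edges A"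
    "\<And>C. is_cycle G C \<longleftrightarrow> C \<in> (`) to_nat ` sys_cycles A"
proof -
  have "graphic (to_nat ` sys_edges A) ((`) to_nat ` sys_cycles A :: nat set set)"
    by (intro graphic_image graphic_forest assms graphic_placed_cycles) (rule inj_on_subset[OF inj_to_nat subset_UNIV])
  then show thesis using that unfolding graphic_def by blast
qed

lemma cycle_continuous_iff_sys_cc:
  assumes G: "edges G = to_nat ` sys_edges A" "\<And>C. is_cycle G C \<longleftrightarrow> C \<in> (`) to_nat ` sys_cycles A"
    and H: "edges H = to_nat ` sys_edges B" "\<And>C. is_cycle H C \<longleftrightarrow> C \<in> (`) to_nat ` sys_cycles B"
  shows "(\<exists>f. cycle_continuous G H f) \<longleftrightarrow> (\<exists>f. sys_cc A B f)"
proof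
  assume "\<exists>f. cycle_continuous G H f"
  then obtain f where f: "f \<in> edges G \<rightarrow> edges H" "\<And>C. is_cycle H C \<Longrightarrow> is_cycle G (f -` C \<inter> edges G)"
    unfolding cycle_continuous_def by blast
  define g :: "ename \<Rightarrow> ename" where "g e = from_nat (f (to_nat e))" for e
  have g: "g e \<in> sys_edges B" "to_nat (g e) = f (to_nat e)" if "e \<in> sys_edges A" for e
  proof -
    have "to_nat e \<in> edges G" unfolding G(1) using that by (rule imageI)
    then have "f (to_nat e) \<in> to_nat ` sys_edges B" using f(1) unfolding H(1) by (rule funcset_mem[rotated])
    then obtain e' where "f (to_nat e) = to_nat e'" "e' \<in> sys_edges B" by (rule imageE)
    then show "g e \<in> sys_edges B" "to_nat (g e) = f (to_nat e)" by (simp_all only: g_def from_nat_to_nat)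
  qed
  have "{x \<in> sys_edges A. g x \<in> D} \<in> sys_cycles A" if D: "D \<in> sys_cycles B" for D
  proof -
    have "is_cycle H (to_nat ` D)" unfolding H(2) using D by (rule imageI)
    then have "f -` (to_nat ` D) \<inter> edges G \<in> (`) to_nat ` sys_cycles A" using f(2) unfolding G(2) by blast
    then obtain D' where D': "D' \<in> sys_cycles A" "f -` (to_nat ` D) \<inter> edges G = to_nat ` D'" by (rule imageE)
    have "g x \<in> D \<longleftrightarrow> f (to_nat x) \<in> to_nat ` D" if "x \<in> sys_edges A" for x
      unfolding g(2)[OF that, symmetric] inj_image_mem_iff[OF inj_to_nat] ..
    then have "to_nat ` {x \<in> sys_edges A. g x \<in> D} = f -` (to_nat ` D) \<inter> edges G"
      unfolding G(1) by blast
    also note D'(2)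
    finally have "{x \<in> sys_edges A. g x \<in> D} = D'" by (simp only: inj_image_eq_iff[OF inj_to_nat])
    then show ?thesis using D'(1) by simp
  qed
  then have "sys_cc A B g" unfolding sys_cc_def using g(1) by blast
  then show "\<exists>f. sys_cc A B f" by (intro exI[of _ g])
next
  assume "\<exists>f. sys_cc A B f"
  then obtain g where "sys_cc A B g" by (elim exE)
  note gg = this[unfolded sys_cc_def]
  note g = subsetD[OF conjunct1[OF gg] imageI] bspec[OF conjunct2[OF gg]]
  define f :: "nat \<Rightarrow> nat" where "f k = to_nat (g (from_nat k))" for k
  have f: "f (to_nat e) = to_nat (g e)" for e by (simp add: f_def)
  have "f \<in> edges G \<rightarrow> edges H"
    unfolding G(1) H(1)
  proof
    fix k :: nat assume "k \<in> to_nat ` sys_edges A"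
    then obtain e where e: "k = to_nat e" "e \<in> sys_edges A" by (rule imageE)
    show "f k \<in> to_nat ` sys_edges B" unfolding e(1) f by (rule imageI[OF g(1)[OF e(2)]])
  qed
  moreover have "is_cycle G (f -` C \<inter> edges G)" if C: "is_cycle H C" for C
  proof -
    obtain D where D: "C = to_nat ` D" "D \<in> sys_cycles B" using C unfolding H(2) by blast
    have "f -` C \<inter> edges G = to_nat ` {x \<in> sys_edges A. g x \<in> D}"
    proof (intro set_eqI iffI)
      fix k assume "k \<in> f -` C \<inter> edges G"
      then obtain e where e: "k = to_nat e" "e \<in> sys_edges A" "f k \<in> to_nat ` D" unfolding G(1) D(1) by blast
      have "g e \<in> D" by (rule e(3)[unfolded e(1) f inj_image_mem_iff[OF inj_to_nat]])
      then show "k \<in> to_nat ` {x \<in> sys_edges A. g x \<in> D}" using e(1,2) by blast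
    next
      fix k assume "k \<in> to_nat ` {x \<in> sys_edges A. g x \<in> D}"
      then obtain e where e: "k = to_nat e" "e \<in> sys_edges A" "g e \<in> D" by blast
      then have "f k \<in> C" unfolding e(1) f D(1) by (intro imageI)
      then show "k \<in> f -` C \<inter> edges G" unfolding G(1) using e(1,2) by blast
    qed
    then show ?thesis unfolding G(2) using imageI[OF g(2)[OF D(2)]] by simp
  qed
  ultimately show "\<exists>f. cycle_continuous G H f" unfolding cycle_continuous_def by blast
qed

theorem theorem1p4:
  fixes P :: "'p set" and le :: "'p rel"
  assumes "countable P" and "partial_order_on P le"
  shows "\<exists>G :: 'p \<Rightarrow> (nat, nat) multigraph.
           (\<forall>x\<in>P. finite_multigraph (G x)) \<and>
           (\<forall>x\<in>P. \<forall>y\<in>P. (x, y) \<in> le \<longleftrightarrow> (\<exists>f. cycle_continuous (G x) (G y) f))"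
proof -
  define idx where "idx = to_nat_on P"
  have inj: "x = y" if "x \<in> P" "y \<in> P" "idx x = idx y" for x y
    using that assms(1) by (simp add: idx_def)
  have refl: "(x, x) \<in> le" if "x \<in> P" for x
    using assms(2) that by (auto simp: partial_order_on_def preorder_on_def refl_on_def)
  have trans: "trans le" using assms(2) by (simp add: partial_order_on_def preorder_on_def)
  define R where "R a b \<longleftrightarrow> (\<exists>x\<in>P. \<exists>y\<in>P. idx x = a \<and> idx y = b \<and> (x, y) \<in> le)" for a b
  have R_idx: "R (idx x) (idx y) \<longleftrightarrow> (x, y) \<in> le" if "x \<in> P" "y \<in> P" for x y
    unfolding R_def using that inj by metis
  have R_trans: "R a c" if "R a b" "R b c" for a b c
    using that inj transD[OF trans] unfolding R_def by metis
  have R_refl: "R a a" if "R a b" for a b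
    using that refl unfolding R_def by blast
  \<comment> \<open>If \<open>R n m\<close>, then failure of \<open>R n i\<close> implies failure of
    \<open>R m i\<close>, so marks survive a map upwards; and \<open>m\<close> carries no mark at
    itself when \<open>R m m\<close>.\<close>
  define mk where "mk n = {i. \<not> R n i}" for n
  define U where "U x = {n. R n (idx x) \<and> n \<le> idx x}" for x
  define A where "A x = \<Union>(chain mk ` U x)" for x
  have forest: "forest placed_edges (A x)" for x
    unfolding A_def by (rule forest_chains) (auto simp: U_def intro: finite_subset[of _ "{..idx x}"])
  have colours: "\<forall>i\<in>A x. colour i < 5" for x
    using chain_col unfolding A_def by blast
  have le_iff: "(x, y) \<in> le \<longleftrightarrow> (\<exists>f. sys_cc (A x) (A y) f)" if xy: "x \<in> P" "y \<in> P" for x y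
  proof
    assume "(x, y) \<in> le"
    then have Rxy: "R (idx x) (idx y)" using R_idx xy by blast
    \<comment> \<open>Chains numbered up to \<open>idx y\<close> already belong to
      \<open>U y\<close> and stay as they are; later ones fold onto the chain of
      \<open>y\<close>.\<close>
    define \<sigma> where "\<sigma> n = min n (idx y)" for n
    have "\<sigma> n \<in> U y \<and> \<sigma> n \<le> n \<and> (\<forall>i\<le>\<sigma> n. i \<in> mk n \<longrightarrow> i \<in> mk (\<sigma> n))" if "n \<in> U x" for n
    proof -
      have "R n (idx y)" using that Rxy R_trans by (auto simp: U_def)
      then show ?thesis using R_trans[of n "idx y"] R_idx[OF xy(2,2)] refl[OF xy(2)]
        by (auto simp: \<sigma>_def U_def mk_def min_def)
    qed
    then show "\<exists>f. sys_cc (A x) (A y) f" unfolding A_def by (rule chain_hom)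
  next
    assume "\<exists>f. sys_cc (A x) (A y) f"
    then obtain f where "sys_cc (A x) (A y) f" by blast
    then obtain \<theta> where th: "\<forall>i\<in>A x. \<theta> i \<in> A y \<and> colour (\<theta> i) = colour i"
      "\<forall>i\<in>A x. \<forall>j\<in>A x. linked i j \<longrightarrow> linked (\<theta> i) (\<theta> j)"
      using sys_cc_hom[OF forest colours colours] by blast
    have Ux: "idx x \<in> U x" using R_idx[OF xy(1,1)] refl[OF xy(1)] by (simp add: U_def)
    have "\<exists>m\<in>U y. m \<le> idx x \<and> (m \<in> mk (idx x) \<longrightarrow> m \<in> mk m)"
      by (rule chain_walk[OF Ux, of mk \<theta>]) (use th in \<open>simp_all only: A_def\<close>)
    then obtain m where m: "R m (idx y)" "m \<in> mk (idx x) \<longrightarrow> m \<in> mk m" unfolding U_def by blast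
    \<comment> \<open>Since \<open>R m (idx y)\<close> gives \<open>R m m\<close>, there is no mark
      at \<open>m\<close> in chain \<open>m\<close>, hence none in the chain of \<open>x\<close>:
      the relation does not fail.\<close>
    then have "R (idx x) m" using R_refl[OF m(1)] by (auto simp: mk_def)
    then show "(x, y) \<in> le" using R_trans m(1) R_idx[OF xy] by blast
  qed
  have "\<forall>x. \<exists>G :: (nat, nat) multigraph. finite_multigraph G \<and> edges G = to_nat ` sys_edges (A x) \<and>
    (\<forall>C. is_cycle G C \<longleftrightarrow> C \<in> (`) to_nat ` sys_cycles (A x))"
  proof
    fix x
    obtain G :: "(nat, nat) multigraph" where G: "finite_multigraph G" "edges G = to_nat ` sys_edges (A x)"
      "\<And>C. is_cycle G C \<longleftrightarrow> C \<in> (`) to_nat ` sys_cycles (A x)"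
      by (rule sys_graph[OF forest[of x]]) blast
    then show "\<exists>G :: (nat, nat) multigraph. finite_multigraph G \<and> edges G = to_nat ` sys_edges (A x) \<and>
      (\<forall>C. is_cycle G C \<longleftrightarrow> C \<in> (`) to_nat ` sys_cycles (A x))"
      by (intro exI[of _ G] conjI allI)
  qed
  from choice[OF this] obtain G :: "'p \<Rightarrow> (nat, nat) multigraph" where
    G': "\<forall>x. finite_multigraph (G x) \<and> edges (G x) = to_nat ` sys_edges (A x) \<and>
      (\<forall>C. is_cycle (G x) C \<longleftrightarrow> C \<in> (`) to_nat ` sys_cycles (A x))"
    by (elim exE)
  note G = G'[THEN spec, THEN conjunct1] G'[THEN spec, THEN conjunct2, THEN conjunct1]
    G'[THEN spec, THEN conjunct2, THEN conjunct2, THEN spec]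
  have "(x, y) \<in> le \<longleftrightarrow> (\<exists>f. cycle_continuous (G x) (G y) f)" if "x \<in> P" "y \<in> P" for x y
    unfolding le_iff[OF that] by (rule cycle_continuous_iff_sys_cc[OF G(2,3) G(2,3), symmetric])
  then show ?thesis using G(1) by blast
qed

end
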